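(* Let $p>2$ be a prime, let $r\geq 1$ be an integer, and put $q=p^r$. Then the pro-$p$ group $T=T(r)=\left\{ t+\sum_{k\geq 1}a_{qk+1}t^{qk+1} : a_{qk+1}\in\mathbb F_p\right\}$, with group operation given by substitution of formal power series, has finite width; that is, there exists a constant $C$, independent of $n$, such that $|\gamma_n(T):\gamma_{n+1}(T)|\leq C$ for all $n\in\mathbb N$, $n\ge 1$.
   Context: Let $p$ be a prime, $r\geq 1$ and $q=p^r$. The group $T(r)$ (a Fesenko group) is the set of formal power series $t+\sum_{k\geq 1}a_{qk+1}t^{qk+1}$ with coefficients $a_{qk+1}\in\mathbb F_p$ under substitution of one power series into another; it is a closed subgroup of the Nottingham group $\left\{ t+\sum_{k\geq 1}a_kt^{k+1} : a_k\in\mathbb F_p\right\}$ and hence a pro-$p$ group. For a pro-$p$ group $G$, $\gamma_n(G)$ denotes the $n$-th term of the lower central series of $G$, with $\gamma_1(G)=G$ and $\gamma_{n+1}(G)=[\gamma_n(G),G]$ (closed subgroups, as is usual for pro-$p$ groups). $G$ has finite width if there is a constant $C$ independent of $n$ with $|\gamma_n(G):\gamma_{n+1}(G)|\leq C$ for all $n$. *)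

theory Defs
  imports
    "HOL-Algebra.Generated_Groups"
    "HOL-Computational_Algebra.Formal_Power_Series"
    "HOL-Computational_Algebra.Primes"
    "HOL-Analysis.Abstract_Topology"
    "HOL-Library.Cardinality"
begin

text \<open>
  With coefficients in the prime field with \<open>p\<close> elements and \<open>q = p ^ r\<close>, this is \<open>T(r)\<close>.
  The product of \<open>f\<close> and \<open>g\<close> is \<open>f(g(t))\<close>; the opposite convention gives the
  opposite group, which is isomorphic via inversion.
\<close>

definition fesenko_group :: "nat \<Rightarrow> 'a::field fps monoid" where
  "fesenko_group q =
     \<lparr>carrier = {f. fps_nth f 1 = 1 \<and>
                    (\<forall>n. n \<noteq> 1 \<and> fps_nth f n \<noteq> 0 \<longrightarrow> (\<exists>k\<ge>1. n = q * k + 1))},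
      monoid.mult = fps_compose,
      one = fps_X\<rparr>"

definition commutator_subgroup :: "('a, 'b) monoid_scheme \<Rightarrow> 'a set \<Rightarrow> 'a set \<Rightarrow> 'a set" where
  "commutator_subgroup G H K =
     generate G (\<Union>h\<in>H. \<Union>k\<in>K. {h \<otimes>\<^bsub>G\<^esub> k \<otimes>\<^bsub>G\<^esub> (inv\<^bsub>G\<^esub> h) \<otimes>\<^bsub>G\<^esub> (inv\<^bsub>G\<^esub> k)})"

text \<open>
  The lower central series of a topological group, whose topology is induced on the carrier by the
  topology of the element type (for power series, the \<open>t\<close>-adic one, which is the pro-\<open>p\<close>
  topology here). Terms are numbered from 1; the value at 0 is a dummy.
\<close>

fun lower_central :: "('a::topological_space, 'b) monoid_scheme \<Rightarrow> nat \<Rightarrow> 'a set" where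
  "lower_central G 0 = carrier G"
| "lower_central G (Suc 0) = carrier G"
| "lower_central G (Suc (Suc n)) =
     top_of_set (carrier G) closure_of
       commutator_subgroup G (lower_central G (Suc n)) (carrier G)"

text \<open>Finiteness of the index is explicit because \<open>card\<close> is 0 on infinite sets.\<close>

definition finite_width :: "('a::topological_space, 'b) monoid_scheme \<Rightarrow> bool" where
  "finite_width G \<longleftrightarrow>
     (\<exists>C::nat. \<forall>n\<ge>1.
        finite (rcosets\<^bsub>G\<lparr>carrier := lower_central G n\<rparr>\<^esub> (lower_central G (n + 1))) \<and>
        card (rcosets\<^bsub>G\<lparr>carrier := lower_central G n\<rparr>\<^esub> (lower_central G (n + 1))) \<le> C)"

end

theory Submission
  imports
    Defs
    "HOL-Number_Theory.Residues"
    "HOL-Computational_Algebra.Formal_Laurent_Series"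
    "HOL-Analysis.Elementary_Metric_Spaces"
    "HOL-Algebra.Exponent"
begin

text \<open>
  Write \<open>f = t U(t^q)\<close>. Since the coefficients lie in the prime field, composition becomes
  \<open>U_(f o g) = U_g * (U_f o g)\<close>. Lift \<open>U\<close> to an integral power series and let \<open>\<lambda>_e\<close> be the
  coefficient of \<open>x^e\<close> in the logarithm of the lift, which is well defined modulo \<open>p Z_(p)\<close>. The
  exponents of \<open>f\<close> are the \<open>e\<close> with \<open>\<lambda>_e\<close> nonzero, and the least one is the depth of \<open>f\<close>.
  Composition with an element of the group produces from an exponent \<open>e\<close> only exponents
  \<open>p^a e + q k\<close> with \<open>p^v(e)\<close> dividing \<open>k\<close>, so each set stable under these moves defines a closed subgroup.

  With \<open>s = min (v(e)) r\<close>, induction on \<open>n\<close> shows that all exponents \<open>e\<close> of \<open>\<gamma>_(n+1)\<close> satisfy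
  \<open>e \<ge> p^s q (n - s)\<close>. Conversely, commutators with \<open>1 - x\<close> raise depths of valuation \<open>s \<le> r\<close> by
  \<open>p^s q\<close>, so every depth \<open>e \<ge> p^s q (n + 1)\<close> with \<open>v(e) = s \<le> r\<close> occurs in \<open>\<gamma>_(n+1)\<close>. A depth of
  valuation above \<open>r\<close> has the form \<open>q k\<close> with \<open>p\<close> dividing \<open>k\<close>. In the commutator of an element
  with \<open>U = 1 + u x^m + \<dots>\<close> and \<open>1 - x^\<nu>\<close>, where \<open>m + \<nu> = k\<close>, both halves contribute to
  \<open>\<lambda>_(q k)\<close>, with total \<open>(\<nu> - m) u = 2 \<nu> u\<close> modulo \<open>p\<close>; this is where \<open>p > 2\<close> enters. All smaller exponents of
  that commutator can be removed by further commutators. Hence the number of depths of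
  \<open>\<gamma>_n\<close> missing in \<open>\<gamma>_(n+1)\<close> is bounded, and the index is at most \<open>p\<close> to that number.
\<close>

text \<open>Valuations above r need their own construction because the raise p^s q comes from the
  first power p^s for which the binomial coefficient (d choose p^s) is prime to p; with s unbounded,
  so would be the gaps. The new source is a move with a = r: a depth d prime to p contributes at q
  d, and this factor q lets an exponent of large valuation arise from one of valuation 0. Such a
  contribution lies far beyond degree 2 d, where the coefficients of U mix. It can be computed
  because U(x)^p = U(x^p) over the prime field yields Dwork's congruence p lam_(p e) = lam_e modulo
  p Z_(p), which ties lam_(q d) to the leading coefficient of U. Logarithms serve this purpose as
  much as turning products into sums. The obstacle is that this commutator has many exponents below
  q k. Elements of the right depths do not suffice to remove them: all exponents of the removing
  elements must lie in an admissible set that misses q k. This requirement dictates the constants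
  \<open>step s\<close> and the bookkeeping by \<open>thr\<close> and
  \<open>low_exps\<close>.\<close>

unbundle fps_syntax

section \<open>Logarithms of integral power series\<close>

text \<open>The target ring is left open: over \<open>rat\<close> this is an embedding, needed to
  form logarithms; over the prime field it is reduction modulo p.\<close>

definition fps_red :: "int fps \<Rightarrow> 'b::comm_ring_1 fps" where
  "fps_red F = Abs_fps (\<lambda>i. of_int (F $ i))"

lemma fps_red_nth [simp]: "fps_red F $ i = of_int (F $ i)"
  by (simp add: fps_red_def)

lemma fps_red_1 [simp]: "fps_red 1 = 1"
  by (rule fps_ext) simp

lemma fps_red_X [simp]: "fps_red fps_X = fps_X"
  by (rule fps_ext) (simp add: fps_X_def)

lemma fps_red_diff: "fps_red (F - G) = fps_red F - fps_red G"
  by (rule fps_ext) simp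

lemma fps_red_mult: "fps_red (F * G) = fps_red F * fps_red G"
  by (rule fps_ext) (simp add: fps_mult_nth)

lemma fps_red_power: "fps_red (F ^ n) = fps_red F ^ n"
  by (induction n) (simp_all add: fps_red_mult)

lemma fps_red_compose: "fps_red (F oo G) = fps_red F oo fps_red G"
  by (rule fps_ext) (simp add: fps_compose_nth flip: fps_red_power)

lemma fps_red_deriv: "fps_red (fps_deriv F) = fps_deriv (fps_red F)"
  by (rule fps_ext) simp

definition plog :: "int fps \<Rightarrow> rat fps" where
  "plog F = fps_ln 1 oo (fps_red F - 1)"

lemma plog_0 [simp]: "plog F $ 0 = 0"
  by (simp add: plog_def)

lemma plog_one [simp]: "plog 1 = 0"
  by (simp add: plog_def)

text \<open>The logarithmic derivative without denominators; additivity of \<open>plog\<close> and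
  integrality of its derivative are read off from it.\<close>

lemma fps_deriv_plog:
  assumes "F $ 0 = 1"
  shows "fps_deriv (plog F) * fps_red F = fps_deriv (fps_red F)"
proof -
  define f :: "rat fps" where "f = fps_red F"
  have f0: "f $ 0 = 1" using assms by (simp add: f_def)
  have "inverse (1 + fps_X) * (1 + fps_X :: rat fps) = 1"
    by (rule inverse_mult_eq_1) simp
  hence "(inverse (1 + fps_X) * (1 + fps_X :: rat fps)) oo (f - 1) = 1 oo (f - 1)" by simp
  hence inv: "(inverse (1 + fps_X :: rat fps) oo (f - 1)) * f = 1"
    using f0 by (subst (asm) fps_compose_mult_distrib) (simp_all add: fps_compose_add_distrib)
  have "fps_deriv (plog F) = (inverse (1 + fps_X) oo (f - 1)) * fps_deriv f"
    using f0 unfolding plog_def f_def[symmetric]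
    by (subst fps_compose_deriv) (simp_all add: fps_ln_deriv)
  hence "fps_deriv (plog F) * f = fps_deriv f * ((inverse (1 + fps_X) oo (f - 1)) * f)"
    by (simp only: mult_ac)
  thus ?thesis unfolding inv by (simp only: mult_1_right f_def)
qed

lemma plog_mult:
  assumes "F $ 0 = 1" "G $ 0 = 1"
  shows "plog (F * G) = plog F + plog G"
proof -
  define f g :: "rat fps" where "f = fps_red F" and "g = fps_red G"
  have nz: "f * g \<noteq> 0"
    using assms by (metis f_def fps_mult_nth_0 fps_red_mult fps_red_nth fps_zero_nth g_def mult.right_neutral of_int_1 zero_neq_one)
  have FG: "(F * G) $ 0 = 1" using assms by simp
  have "fps_deriv (plog (F * G)) * (f * g) = fps_deriv (f * g)"
    using fps_deriv_plog[OF FG] by (simp add: fps_red_mult f_def g_def)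
  also have "\<dots> = (fps_deriv (plog F) + fps_deriv (plog G)) * (f * g)"
    by (simp add: f_def g_def algebra_simps flip: fps_deriv_plog[OF assms(1)] fps_deriv_plog[OF assms(2)])
  finally have "fps_deriv (plog (F * G)) = fps_deriv (plog F + plog G)"
    using nz by simp
  thus ?thesis by (simp add: fps_deriv_eq_iff del: fps_deriv_add)
qed

lemma plog_power:
  assumes "F $ 0 = 1"
  shows "plog (F ^ n) = of_nat n * plog F"
proof (induction n)
  case (Suc n)
  have "(F ^ n) $ 0 = 1" using assms by (simp add: fps_power_zeroth)
  thus ?case using plog_mult[OF assms, of "F ^ n"] Suc by (simp add: algebra_simps)
qed simp

lemma plog_compose:
  assumes "F $ 0 = 1" "G $ 0 = 0"
  shows "plog (F oo G) = plog F oo fps_red G"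
proof -
  have "(fps_red F oo fps_red G) - 1 = (fps_red F - 1 :: rat fps) oo fps_red G"
    by (simp add: fps_compose_sub_distrib)
  thus ?thesis using assms
    by (simp add: plog_def fps_red_compose fps_compose_assoc)
qed

text \<open>With F = 1 + g and g of order at least d, all g^i with i >= 2 have order at least 2
  d.\<close>

lemma plog_eq_below:
  assumes "F $ 0 = 1" "\<And>i. 0 < i \<Longrightarrow> i < d \<Longrightarrow> F $ i = 0" "n < 2 * d" "n > 0"
  shows "plog F $ n = of_int (F $ n)"
proof -
  define g :: "rat fps" where "g = fps_red F - 1"
  have g: "g $ i = 0" if "i < d" for i using assms(1,2) that by (cases "i = 0") (auto simp: g_def)
  have gp: "(g ^ i) $ n = 0" if "i \<ge> 2" for i
  proof (cases "g = 0")
    case False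
    hence "subdegree g \<ge> d" using g by (intro subdegree_geI) auto
    hence "subdegree (g ^ i) \<ge> 2 * d" using that by (simp add: mult_mono)
    thus ?thesis using assms by (meson less_le_trans nth_less_subdegree_zero)
  qed (use that in \<open>simp add: power_0_left\<close>)
  have "plog F $ n = (\<Sum>i=0..n. fps_ln 1 $ i * (g ^ i) $ n)"
    by (simp add: plog_def g_def fps_compose_nth)
  also have "\<dots> = (\<Sum>i\<in>{1}. fps_ln 1 $ i * (g ^ i) $ n)"
    using assms(4)
    by (intro sum.mono_neutral_right)
       (auto simp: gp not_le fps_ln_nth split: if_splits intro!: gp)
  also have "\<dots> = of_int (F $ n)" using assms(4) by (simp add: fps_ln_nth g_def)
  finally show ?thesis .
qed

text \<open>The derivative of log F is F' / F, and F is invertible over the integers.\<close>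

lemma int_coeff_plog:
  assumes "F $ 0 = 1"
  obtains l :: int where "of_nat e * plog F $ e = of_int l"
proof (cases e)
  case 0 thus ?thesis using that[of 0] by simp
next
  case (Suc i)
  define J where "J = fps_right_inverse F 1"
  have "F * J = 1" unfolding J_def using assms by (intro fps_right_inverse) simp
  hence FJ: "fps_red F * fps_red J = (1 :: rat fps)" by (metis fps_red_mult fps_red_1)
  have "fps_deriv (plog F) = fps_deriv (plog F) * (fps_red F * fps_red J)" using FJ by simp
  also have "\<dots> = fps_deriv (fps_red F) * fps_red J"
    using fps_deriv_plog[OF assms] by (simp only: mult.assoc [symmetric])
  also have "\<dots> = fps_red (fps_deriv F * J)" by (simp add: fps_red_mult fps_red_deriv)
  finally have "fps_deriv (plog F) $ i = of_int ((fps_deriv F * J) $ i)" by simp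
  thus ?thesis using that Suc by simp
qed

lemma dvd_mult_power_nth:
  fixes G :: "int fps"
  shows "int e dvd int k * (G ^ e) $ k"
  \<comment> \<open>compare coefficients in \<open>(G^e)' = e G^(e-1) G'\<close>\<close>
proof (cases k)
  case (Suc i)
  have "fps_deriv (G ^ e) $ i = int k * (G ^ e) $ k" using Suc by simp
  moreover have "fps_deriv (G ^ e) = of_nat e * (fps_deriv G * G ^ (e - 1))"
    by (simp add: fps_deriv_power mult_ac fps_of_nat)
  hence "fps_deriv (G ^ e) $ i = int e * (fps_deriv G * G ^ (e - 1)) $ i"
    by (simp add: fps_of_nat [symmetric] del: fps_of_nat)
  ultimately show ?thesis by (metis dvd_triv_left)
qed simp

text \<open>Products of such series have no cross terms below degree 2 d: of two positive degrees
  with sum less than 2 d one is less than d.\<close>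

lemma power_nth_eq_below:
  fixes F :: "int fps"
  assumes "F $ 0 = 1" "\<And>i. 0 < i \<Longrightarrow> i < d \<Longrightarrow> F $ i = 0" "0 < n" "n < 2 * d"
  shows "(F ^ e) $ n = int e * F $ n" and "\<And>i. 0 < i \<Longrightarrow> i < d \<Longrightarrow> (F ^ e) $ i = 0"
proof -
  have P: "(\<forall>i. 0 < i \<longrightarrow> i < d \<longrightarrow> (F ^ e) $ i = 0) \<and> (F ^ e) $ n = int e * F $ n"
  proof (induction e)
    case (Suc e)
    have pe0: "(F ^ e) $ 0 = 1" using assms(1) by (simp add: fps_power_zeroth)
    have *: "(F * F ^ e) $ i = F $ i + (F ^ e) $ i" if i: "0 < i" "i < 2 * d" for i
    proof -
      have "(F * F ^ e) $ i = (\<Sum>j\<in>{0..i}. F $ j * (F ^ e) $ (i - j))"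
        by (simp add: fps_mult_nth)
      also have "\<dots> = (\<Sum>j\<in>{0,i}. F $ j * (F ^ e) $ (i - j))"
      proof (intro sum.mono_neutral_right ballI)
        fix j assume j: "j \<in> {0..i} - {0, i}"
        show "F $ j * (F ^ e) $ (i - j) = 0"
        proof (cases "j < d")
          case True thus ?thesis using assms(2) j by auto
        next
          case False
          hence "0 < i - j" "i - j < d" using j i by auto
          thus ?thesis using Suc by simp
        qed
      qed (use i in auto)
      also have "\<dots> = F $ i + (F ^ e) $ i" using i assms(1) pe0 by simp
      finally show ?thesis .
    qed
    show ?case using * Suc assms by (auto simp: algebra_simps)
  qed (use assms in simp)
  show "(F ^ e) $ n = int e * F $ n" using P by blast
  show "\<And>i. 0 < i \<Longrightarrow> i < d \<Longrightarrow> (F ^ e) $ i = 0" using P by blast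
qed

lemma plog_one_minus_X_power:
  assumes "n > 0" "e > 0"
  shows "plog (1 - fps_X ^ n) $ e = (if n dvd e then - of_nat n / of_nat e else 0)"
proof -
  define g :: "rat fps" where "g = - (fps_X ^ n)"
  have gp: "(g ^ i) $ e = (if e = n * i then (-1) ^ i else 0)" for i
  proof -
    have "g ^ i = (-1) ^ i * fps_X ^ (n * i)"
      by (simp add: g_def power_minus[of "fps_X ^ n"] power_mult)
    also have "(-1 :: rat fps) ^ i = fps_const ((-1) ^ i)"
      by (metis fps_const_1_eq_1 fps_const_neg fps_const_power)
    finally show ?thesis by simp
  qed
  have red: "fps_red (1 - fps_X ^ n) - 1 = g"
    by (simp add: fps_red_diff fps_red_power g_def)
  have "plog (1 - fps_X ^ n) $ e = (\<Sum>i=0..e. fps_ln 1 $ i * (g ^ i) $ e)"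
    by (simp add: plog_def red fps_compose_nth)
  also have "\<dots> = (if n dvd e then - of_nat n / of_nat e else 0)"
  proof (cases "n dvd e")
    case False
    hence "\<And>i. e \<noteq> n * i" by auto
    thus ?thesis using False by (simp add: gp)
  next
    case True
    then obtain j where j: "e = n * j" by blast
    have j0: "j > 0" "j \<le> e" using j assms by auto
    have "(g ^ i) $ e = 0" if "i \<noteq> j" for i using that j assms gp[of i] by auto
    hence "(\<Sum>i=0..e. fps_ln 1 $ i * (g ^ i) $ e) = (\<Sum>i\<in>{j}. fps_ln 1 $ i * (g ^ i) $ e)"
      using j0 by (intro sum.mono_neutral_right) auto
    also have "\<dots> = (-1) ^ (j - 1) / of_nat j * (-1) ^ j"
      using j j0 gp[of j] by (simp add: fps_ln_nth)
    also have "(-1 :: rat) ^ j = - ((-1) ^ (j - 1))" using j0 by (cases j) auto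
    also have "(-1) ^ (j - 1) / of_nat j * (- ((-1) ^ (j - 1)) :: rat) = - (((-1) ^ (j - 1) * (-1) ^ (j - 1)) / of_nat j)"
      by simp
    also have "((-1) ^ (j - 1) * (-1) ^ (j - 1) :: rat) = 1"
      by (simp flip: power_mult_distrib)
    finally show ?thesis using True j assms by simp
  qed
  finally show ?thesis .
qed

section \<open>Truncated agreement and t-adic closure\<close>

definition fps_agree :: "nat \<Rightarrow> 'b::zero fps \<Rightarrow> 'b fps \<Rightarrow> bool" where
  "fps_agree N f g \<longleftrightarrow> (\<forall>i\<le>N. f $ i = g $ i)"

lemma fps_agree_refl [simp]: "fps_agree N f f"
  by (simp add: fps_agree_def)

lemma fps_agree_sym: "fps_agree N f g \<Longrightarrow> fps_agree N g f"
  by (simp add: fps_agree_def)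

lemma fps_agree_trans: "fps_agree N f g \<Longrightarrow> fps_agree N g h \<Longrightarrow> fps_agree N f h"
  by (simp add: fps_agree_def)

lemma fps_agree_mono: "fps_agree N f g \<Longrightarrow> M \<le> N \<Longrightarrow> fps_agree M f g"
  by (simp add: fps_agree_def)

lemma fps_agree_mult:
  fixes a b :: "'b::comm_ring_1 fps"
  shows "fps_agree N a a' \<Longrightarrow> fps_agree N b b' \<Longrightarrow> fps_agree N (a * b) (a' * b')"
  by (simp add: fps_agree_def fps_mult_nth)

lemma fps_agree_power:
  fixes a b :: "'b::comm_ring_1 fps"
  shows "fps_agree N a a' \<Longrightarrow> fps_agree N (a ^ i) (a' ^ i)"
  by (induction i) (simp_all add: fps_agree_mult)

lemma fps_agree_compose:
  fixes a b :: "'b::comm_ring_1 fps"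
  assumes "fps_agree N a a'" "fps_agree N b b'"
  shows "fps_agree N (a oo b) (a' oo b')"
  using assms(1) fps_agree_power[OF assms(2)] by (simp add: fps_agree_def fps_compose_nth)

lemma fps_agree_iff_dist:
  "(\<forall>e>0. \<exists>g\<in>S. dist g f < e) \<longleftrightarrow> (\<forall>N. \<exists>g\<in>S. fps_agree N f (g :: 'b::group_add fps))"
proof (intro iffI allI impI)
  fix N assume *: "\<forall>e>0. \<exists>g\<in>S. dist g f < e"
  have "inverse (2 ^ N :: real) > 0" by simp
  then obtain g where g: "g \<in> S" "dist g f < inverse (2 ^ N)" using * by blast
  have "fps_agree N f g"
  proof (cases "g = f")
    case False
    hence "(2 :: real) ^ N < 2 ^ subdegree (g - f)" using g(2) by (simp add: dist_fps_def)
    hence "N < subdegree (g - f)" by simp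
    hence "(g - f) $ i = 0" if "i \<le> N" for i using that by (intro nth_less_subdegree_zero) auto
    thus ?thesis by (simp add: fps_agree_def)
  qed simp
  thus "\<exists>g\<in>S. fps_agree N f g" using g(1) by blast
next
  fix e :: real assume *: "\<forall>N. \<exists>g\<in>S. fps_agree N f g" and "e > 0"
  obtain N where N: "inverse (2 ^ N) < e" using real_arch_pow_inv[OF \<open>e > 0\<close>, of "1/2"]
    by (auto simp: power_one_over field_simps)
  obtain g where g: "g \<in> S" "fps_agree N f g" using * by blast
  have "dist g f < e"
  proof (cases "g = f")
    case False
    have "subdegree (g - f) > N" using g(2) False by (intro subdegree_greaterI) (auto simp: fps_agree_def)
    hence "inverse (2 ^ subdegree (g - f)) \<le> inverse (2 ^ N :: real)" by (simp add: le_imp_inverse_le)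
    also have "\<dots> < e" by (rule N)
    finally show ?thesis using False by (simp add: dist_fps_def)
  qed (use \<open>e > 0\<close> in simp)
  thus "\<exists>g\<in>S. dist g f < e" using g by blast
qed

lemma mem_closure_of_fps_iff:
  assumes "S \<subseteq> C"
  shows "f \<in> top_of_set C closure_of S \<longleftrightarrow> f \<in> C \<and> (\<forall>N. \<exists>g\<in>S. fps_agree N f (g :: 'b::group_add fps))"
proof -
  have "top_of_set C closure_of S = C \<inter> closure S"
    using assms by (simp add: closure_of_subtopology Int_absorb1 euclidean_closure_of)
  thus ?thesis by (simp add: closure_approachable fps_agree_iff_dist)
qed

section \<open>Coefficients of logarithms modulo p\<close>

text \<open>\<open>pz p\<close> is the ideal \<open>p Z_(p)\<close>, modulo which the logarithms of lifts are well defined.\<close>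

definition pz :: "nat \<Rightarrow> rat set" where
  "pz p = {x. \<exists>a b :: int. \<not> int p dvd b \<and> x * of_int b = of_int (int p * a)}"

text \<open>Over the prime field \<open>LEAST\<close> picks the representative in \<open>{0..<p}\<close>; elsewhere it may be junk.\<close>

definition lift :: "'b::semiring_1 fps \<Rightarrow> int fps" where
  "lift U = Abs_fps (\<lambda>i. int (LEAST n. of_nat n = U $ i))"

definition lam :: "'b::semiring_1 fps \<Rightarrow> nat \<Rightarrow> rat" where
  "lam U e = plog (lift U) $ e"

lemma lam_0 [simp]: "lam U 0 = 0"
  by (simp add: lam_def)

lemma lift_nth_eq_0: "U $ i = 0 \<Longrightarrow> lift U $ i = 0"
  by (simp add: lift_def)

lemma lift_nth_eq_1:
  fixes U :: "'b::{semiring_1} fps"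
  assumes "U $ i = 1"
  shows "lift U $ i = 1"
proof -
  have "(LEAST n. of_nat n = (1 :: 'b)) = 1"
    by (rule Least_equality) (auto simp: Suc_le_eq intro: gr0I)
  thus ?thesis using assms by (simp add: lift_def)
qed

locale fesenko =
  fixes p r q :: nat and ty :: "'a::{field,finite} itself"
  assumes prime_p: "prime p" and p_gt_2: "p > 2" and r_pos: "r \<ge> 1" and q_def: "q = p ^ r"
    and card_p: "CARD('a) = p"
begin

abbreviation cong_pz :: "rat \<Rightarrow> rat \<Rightarrow> bool" (infix "\<approx>\<^sub>p" 50) where
  "x \<approx>\<^sub>p y \<equiv> x - y \<in> pz p"

lemma prime_int_p: "prime (int p)"
  using prime_p by simp

section \<open>Frobenius on power series over the prime field\<close>

lemma CHAR_eq: "CHAR('a) = p"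
proof -
  have "CHAR('a) dvd p" using CHAR_dvd_CARD[where 'a = 'a] card_p by simp
  moreover have "CHAR('a) \<noteq> 1" using CHAR_not_1[where 'a = 'a] by simp
  ultimately show ?thesis using prime_p by (metis prime_nat_iff)
qed

lemma of_int_eq_0_iff_dvd: "(of_int c :: 'a) = 0 \<longleftrightarrow> int p dvd c"
  by (simp add: of_int_eq_0_iff_char_dvd CHAR_eq)

lemma ex_of_nat: "\<exists>n. of_nat n = (c :: 'a)"
proof -
  have "inj_on (of_nat :: nat \<Rightarrow> 'a) {..<p}"
    by (rule inj_onI) (simp add: of_nat_eq_iff_cong_CHAR CHAR_eq cong_less_modulus_unique_nat)
  hence "card ((of_nat :: nat \<Rightarrow> 'a) ` {..<p}) = CARD('a)" by (simp add: card_image card_p)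
  hence "(of_nat :: nat \<Rightarrow> 'a) ` {..<p} = UNIV" by (simp add: card_eq_UNIV_imp_eq_UNIV)
  thus ?thesis by (metis UNIV_I imageE)
qed

lemma power_p_eq [simp]: "(c :: 'a) ^ p = c"
proof -
  have "(of_nat n :: 'a) ^ p = of_nat n" for n
  proof (induction n)
    case 0 thus ?case using p_gt_2 by simp
  next
    case (Suc n)
    have "(1 + of_nat n :: 'a) ^ p = 1 ^ p + of_nat n ^ p"
      by (rule freshmans_dream) (simp_all add: CHAR_eq prime_p)
    thus ?case using Suc by simp
  qed
  thus ?thesis using ex_of_nat[of c] by metis
qed

lemma red_lift [simp]: "fps_red (lift U) = (U :: 'a fps)"
proof (rule fps_ext)
  fix n
  show "fps_red (lift U) $ n = U $ n"
    using LeastI_ex[OF ex_of_nat[of "U $ n"]] by (simp add: lift_def)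
qed

lemma power_p_fps: "(U :: 'a fps) ^ p = U oo fps_X ^ p"
proof (rule fps_ext)
  fix n
  have pr: "prime CHAR('a fps)" "p = CHAR('a fps)" by (simp_all add: CHAR_eq prime_p)
  \<comment> \<open>The freshman's dream covers finite sums only, so U is cut at degree n; the p-th
    power of the tail starts in degree (n + 1) p > n.\<close>
  define T where "T = (\<Sum>i\<le>n. fps_const (U $ i) * fps_X ^ i)"
  define R where "R = fps_shift (Suc n) U"
  have "U = T + fps_X ^ Suc n * R"
  proof (rule fps_ext)
    fix m
    have "T $ m = (\<Sum>i\<le>n. if i = m then U $ m else 0)"
      unfolding T_def fps_sum_nth by (intro sum.cong) auto
    also have "\<dots> = (if m \<le> n then U $ m else 0)" by simp
    finally show "U $ m = (T + fps_X ^ Suc n * R) $ m"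
      by (simp add: R_def fps_X_power_mult_nth del: power_Suc)
  qed
  hence "U ^ p = T ^ p + (fps_X ^ Suc n * R) ^ p"
    using freshmans_dream[OF pr] by metis
  also have "(fps_X ^ Suc n * R) ^ p = fps_X ^ (Suc n * p) * R ^ p"
    by (simp add: power_mult_distrib flip: power_mult del: power_Suc)
  also have "T ^ p = (\<Sum>i\<le>n. fps_const (U $ i) * fps_X ^ (i * p))"
    unfolding T_def by (subst freshmans_dream_sum[OF pr])
      (simp add: power_mult_distrib fps_const_power flip: power_mult)
  finally have "(U ^ p) $ n = (\<Sum>i\<le>n. (fps_const (U $ i) * fps_X ^ (i * p)) $ n)
      + (fps_X ^ (Suc n * p) * R ^ p) $ n"
    by (simp only: fps_add_nth fps_sum_nth)
  also have "n < Suc n * p" using p_gt_2 by (cases p) auto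
  hence "(fps_X ^ (Suc n * p) * R ^ p) $ n = 0" by (simp add: fps_X_power_mult_nth del: mult_Suc)
  also have "(\<Sum>i\<le>n. (fps_const (U $ i) * fps_X ^ (i * p)) $ n) + 0
      = (\<Sum>i\<le>n. (fps_const (U $ i) * fps_X ^ (i * p)) $ n)" by simp
  also have "\<dots> = (\<Sum>i\<le>n. if n = i * p then U $ i else 0)"
    by (intro sum.cong) auto
  also have "\<dots> = (if p dvd n then U $ (n div p) else 0)"
  proof (cases "p dvd n")
    case True
    then obtain j where j: "n = j * p" by (metis dvdE mult.commute)
    have "(\<Sum>i\<le>n. if n = i * p then U $ i else 0) = (\<Sum>i\<le>n. if i = j then U $ i else 0)"
      using j p_gt_2 by (intro sum.cong) auto
    thus ?thesis using j p_gt_2 by simp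
  next
    case False
    hence "\<And>i. n \<noteq> i * p" by auto
    thus ?thesis using False by simp
  qed
  finally show "(U ^ p) $ n = (U oo fps_X ^ p) $ n"
    using p_gt_2 by (simp add: fps_nth_compose_X_power)
qed

lemma power_q_fps: "(U :: 'a fps) ^ q = U oo fps_X ^ q"
proof -
  have "U ^ p ^ j = U oo fps_X ^ p ^ j" for j
  proof (induction j)
    case (Suc j)
    have "U ^ p ^ Suc j = (U ^ p ^ j) ^ p" by (simp add: mult.commute flip: power_mult)
    also have "\<dots> = (U oo fps_X ^ p ^ j) oo fps_X ^ p" unfolding Suc by (rule power_p_fps)
    also have "\<dots> = U oo (fps_X ^ p ^ j oo fps_X ^ p)"
      using p_gt_2 by (intro fps_compose_assoc [symmetric]) (simp_all add: power_0_left)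
    also have "(fps_X ^ p ^ j oo fps_X ^ p :: 'a fps) = fps_X ^ p ^ Suc j"
    proof -
      have "(fps_X ^ p :: 'a fps) $ 0 = 0" using p_gt_2 by simp
      from fps_compose_power[OF this, of fps_X "p ^ j"] show ?thesis
        using p_gt_2 by (simp flip: power_mult)
    qed
    finally show ?case .
  qed simp
  thus ?thesis by (simp add: q_def)
qed

section \<open>The ideal p Z_(p) and congruences for logarithms of lifts\<close>

lemma pzI: "\<not> int p dvd b \<Longrightarrow> x * of_int b = of_int (int p * a) \<Longrightarrow> x \<in> pz p"
  unfolding pz_def by blast

lemma zero_pz [simp]: "0 \<in> pz p"
  using p_gt_2 by (intro pzI[of 1 _ 0]) auto

lemma pz_add [intro]:
  assumes "x \<in> pz p" "y \<in> pz p"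
  shows "x + y \<in> pz p"
proof -
  obtain a b c d where *: "\<not> int p dvd b" "x * of_int b = of_int (int p * a)"
      "\<not> int p dvd d" "y * of_int d = of_int (int p * c)"
    using assms unfolding pz_def by blast
  have "(x + y) * of_int (b * d) = (x * of_int b) * of_int d + (y * of_int d) * of_int b"
    by (simp add: algebra_simps)
  also have "\<dots> = of_int (int p * (a * d + c * b))" unfolding * by (simp add: algebra_simps)
  finally show ?thesis using * prime_int_p
    by (intro pzI[of "b * d" _ "a * d + c * b"]) (simp_all only: prime_dvd_mult_iff de_Morgan_disj simp_thms)
qed

lemma pz_uminus:
  assumes "x \<in> pz p"
  shows "- x \<in> pz p"
proof -
  obtain a b where "\<not> int p dvd b" "x * of_int b = of_int (int p * a)"
    using assms unfolding pz_def by blast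
  thus ?thesis by (intro pzI[of b _ "- a"]) auto
qed

lemma pz_diff [intro]: "x \<in> pz p \<Longrightarrow> y \<in> pz p \<Longrightarrow> x - y \<in> pz p"
  using pz_add[of x "- y"] pz_uminus[of y] by simp

lemma pz_mult_int [intro]:
  assumes "x \<in> pz p"
  shows "of_int k * x \<in> pz p" "x * of_int k \<in> pz p" "of_nat n * x \<in> pz p" "x * of_nat n \<in> pz p"
proof -
  obtain a b where ab: "\<not> int p dvd b" "x * of_int b = of_int (int p * a)"
    using assms unfolding pz_def by blast
  have *: "of_int j * x \<in> pz p" for j
    using ab by (intro pzI[of b _ "j * a"]) (auto simp: mult_ac)
  show "of_int k * x \<in> pz p" "x * of_int k \<in> pz p" "of_nat n * x \<in> pz p" "x * of_nat n \<in> pz p"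
    using *[of k] *[of "int n"] by (simp_all add: mult.commute)
qed

lemma pz_sum [intro]: "(\<And>i. i \<in> I \<Longrightarrow> f i \<in> pz p) \<Longrightarrow> sum f I \<in> pz p"
  by (induction I rule: infinite_finite_induct) auto

lemma of_int_pz_iff: "of_int c \<in> pz p \<longleftrightarrow> int p dvd c"
proof
  assume "of_int c \<in> pz p"
  then obtain a b where ab: "\<not> int p dvd b" "of_int c * of_int b = (of_int (int p * a) :: rat)"
    unfolding pz_def by blast
  hence "c * b = int p * a" by (metis of_int_eq_iff of_int_mult)
  thus "int p dvd c" using ab(1) prime_int_p by (metis dvd_triv_left prime_dvd_mult_iff)
next
  assume "int p dvd c"
  then obtain a where "c = int p * a" by blast
  thus "of_int c \<in> pz p" using p_gt_2 by (intro pzI[of 1 _ a]) auto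
qed

lemma cong_pz_sym: "x \<approx>\<^sub>p y \<Longrightarrow> y \<approx>\<^sub>p x"
  using pz_uminus[of "x - y"] by simp

lemma cong_pz_trans: "x \<approx>\<^sub>p y \<Longrightarrow> y \<approx>\<^sub>p z \<Longrightarrow> x \<approx>\<^sub>p z"
  using pz_add[of "x - y" "y - z"] by simp

lemma cong_pz_mem: "x \<approx>\<^sub>p y \<Longrightarrow> x \<in> pz p \<longleftrightarrow> y \<in> pz p"
  using pz_add[of "x - y" y] pz_diff[of x "x - y"] by auto

lemma pz_divide:
  assumes k: "k > 0" and dvd: "int p ^ Suc (multiplicity p k) dvd a"
  shows "of_int a / of_nat k \<in> pz p"
proof -
  define v where "v = multiplicity p k"
  obtain k' where k': "k = p ^ v * k'" "\<not> p dvd k'"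
    using multiplicity_decompose'[of k p] k prime_p p_gt_2 unfolding v_def
    by (metis not_prime_unit neq0_conv)
  obtain a' where a': "a = int p ^ Suc v * a'" using dvd unfolding v_def by blast
  have "of_int a / of_nat k * of_int (int k') = (of_int (int p * a') :: rat)"
    using k k' a' by (simp add: field_simps)
  thus ?thesis unfolding pz_def using k'(2) by (metis (mono_tags, lifting) int_dvd_int_iff mem_Collect_eq)
qed

text \<open>Series congruent modulo p differ by a factor 1 + p M with M integral. The terms of its
  logarithm are p^i M^i / i up to sign, and the valuation of i is less than i.\<close>

lemma plog_cong:
  assumes "fps_red F = (fps_red H :: 'a fps)" "F $ 0 = 1" "H $ 0 = 1"
  shows "plog F $ e \<approx>\<^sub>p plog H $ e"
proof -
  have dvd: "int p dvd (F - H) $ i" for i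
    using arg_cong[OF assms(1), of "\<lambda>U. U $ i"] by (simp flip: of_int_eq_0_iff_dvd)
  define K where "K = (\<lambda>i. (F - H) $ i div int p)"
  have K: "(F - H) $ i = int p * K i" for i
    unfolding K_def using dvd by (rule dvd_mult_div_cancel [symmetric])
  define J where "J = fps_right_inverse H 1"
  have J: "H * J = 1" unfolding J_def using assms by (intro fps_right_inverse) simp
  define M where "M = Abs_fps K * J"
  have FH: "F = H * (1 + fps_const (int p) * M)"
  proof -
    have "F = H + fps_const (int p) * Abs_fps K" using K by (intro fps_ext) (simp add: algebra_simps)
    also have "\<dots> = H + (H * J) * (fps_const (int p) * Abs_fps K)" by (simp add: J)
    also have "\<dots> = H * (1 + fps_const (int p) * M)" by (simp add: M_def algebra_simps)
    finally show ?thesis .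
  qed
  define N where "N = 1 + fps_const (int p) * M"
  have N0: "N $ 0 = 1"
    using arg_cong[OF FH, of "\<lambda>F. F $ 0"] assms unfolding N_def [symmetric] by simp
  have "plog N $ e = (\<Sum>i=0..e. fps_ln 1 $ i * (fps_const (of_nat p) * fps_red M :: rat fps) ^ i $ e)"
  proof -
    have "fps_red N - 1 = (fps_const (of_nat p) * fps_red M :: rat fps)"
      by (rule fps_ext) (simp add: N_def)
    thus ?thesis by (simp add: plog_def fps_compose_nth)
  qed
  also have "\<dots> \<in> pz p"
  proof (intro pz_sum)
    fix i assume "i \<in> {0..e}"
    show "fps_ln 1 $ i * (fps_const (of_nat p) * fps_red M :: rat fps) ^ i $ e \<in> pz p"
    proof (cases "i = 0")
      case False
      have "multiplicity p i < i"
      proof (rule ccontr)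
        assume "\<not> multiplicity p i < i"
        hence "p ^ i dvd i" using multiplicity_dvd' by (metis not_less)
        hence "p ^ i \<le> i" using False by (intro dvd_imp_le) auto
        moreover have "i < p ^ i" using p_gt_2 by (intro power_gt_expt) auto
        ultimately show False by simp
      qed
      hence "int p ^ Suc (multiplicity p i) dvd int p ^ i * (M ^ i) $ e"
        by (intro dvd_mult2 le_imp_power_dvd) simp
      hence "of_int (int p ^ i * (M ^ i) $ e) / of_nat i \<in> pz p"
        using False by (intro pz_divide) auto
      hence "of_int ((- 1) ^ (i - 1)) * (of_int (int p ^ i * (M ^ i) $ e) / of_nat i) \<in> pz p"
        by blast
      moreover have "(fps_const (of_nat p) * fps_red M :: rat fps) ^ i $ e = of_int (int p ^ i * (M ^ i) $ e)"
        by (simp add: power_mult_distrib fps_const_power flip: fps_red_power)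
      ultimately show ?thesis using False by (simp add: fps_ln_nth)
    qed (use p_gt_2 in simp)
  qed
  finally show ?thesis
    using plog_mult[OF assms(3) N0] FH unfolding N_def [symmetric] by simp
qed

lemma lift_0: "U $ 0 = (1 :: 'a) \<Longrightarrow> lift U $ 0 = 1"
  by (rule lift_nth_eq_1)

lemma lam_red:
  assumes "F $ 0 = 1"
  shows "lam (fps_red F :: 'a fps) e \<approx>\<^sub>p plog F $ e"
  unfolding lam_def by (rule plog_cong) (use assms in \<open>auto intro!: lift_0\<close>)

lemma lam_mult:
  assumes "U $ 0 = (1 :: 'a)" "V $ 0 = 1"
  shows "lam (U * V) e \<approx>\<^sub>p lam U e + lam V e"
  using lam_red[of "lift U * lift V" e] plog_mult[of "lift U" "lift V"] assms
  by (simp add: fps_red_mult lift_0 lam_def)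

text \<open>The logarithm of U(x)^p = U(x^p), which on lifts is a congruence modulo p.\<close>

lemma lam_dwork:
  assumes "U $ 0 = (1 :: 'a)"
  shows "of_nat p * lam U e \<approx>\<^sub>p (if p dvd e then lam U (e div p) else 0)"
proof -
  have F0: "lift U $ 0 = 1" using assms by (rule lift_0)
  have "fps_red (lift U ^ p) = (fps_red (lift U oo fps_X ^ p) :: 'a fps)"
    by (simp add: fps_red_power fps_red_compose power_p_fps[of U])
  hence "plog (lift U ^ p) $ e \<approx>\<^sub>p plog (lift U oo fps_X ^ p) $ e"
    using F0 p_gt_2 by (intro plog_cong) (auto simp: fps_power_zeroth)
  moreover have "plog (lift U ^ p) $ e = of_nat p * lam U e"
    by (simp add: plog_power[OF F0] lam_def flip: fps_of_nat)
  moreover have "plog (lift U oo fps_X ^ p) $ e = (if p dvd e then lam U (e div p) else 0)"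
    using F0 p_gt_2 by (simp add: plog_compose power_0_left fps_red_power fps_nth_compose_X_power lam_def)
  ultimately show ?thesis by simp
qed

lemma lam_dwork_iter:
  assumes "U $ 0 = (1 :: 'a)"
  shows "of_nat p ^ a * lam U (p ^ a * e) \<approx>\<^sub>p lam U e"
proof (induction a)
  case (Suc a)
  have "of_nat p * lam U (p ^ Suc a * e) \<approx>\<^sub>p lam U (p ^ a * e)"
    using lam_dwork[OF assms, of "p ^ Suc a * e"] p_gt_2 by simp
  hence "of_nat (p ^ a) * (of_nat p * lam U (p ^ Suc a * e) - lam U (p ^ a * e)) \<in> pz p"
    by (rule pz_mult_int)
  hence "of_nat p ^ Suc a * lam U (p ^ Suc a * e) \<approx>\<^sub>p of_nat p ^ a * lam U (p ^ a * e)"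
    by (simp add: algebra_simps)
  thus ?case using Suc cong_pz_trans by blast
qed simp

definition depth_ge :: "'a fps \<Rightarrow> nat \<Rightarrow> bool" where
  "depth_ge U d \<longleftrightarrow> (\<forall>i. 0 < i \<longrightarrow> i < d \<longrightarrow> U $ i = 0)"

lemma lam_of_depth_ge:
  assumes "U $ 0 = 1" "depth_ge U d" "0 < n" "n < 2 * d"
  shows "lam U n = of_int (lift U $ n)"
  unfolding lam_def using assms
  by (intro plog_eq_below) (auto simp: lift_0 depth_ge_def lift_nth_eq_0)

lemma lift_nth_dvd_iff: "int p dvd lift U $ n \<longleftrightarrow> (U :: 'a fps) $ n = 0"
  by (metis fps_red_nth of_int_eq_0_iff_dvd red_lift)

lemma lam_pz_iff_nth:
  assumes "U $ 0 = 1" "depth_ge U d" "0 < n" "n < 2 * d"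
  shows "lam U n \<in> pz p \<longleftrightarrow> U $ n = 0"
  using lam_of_depth_ge[OF assms] by (simp add: of_int_pz_iff lift_nth_dvd_iff)

text \<open>Once U vanishes in the positive degrees below d, its coefficient at d is
  \<open>lam U d\<close> modulo p, so vanishing propagates upwards.\<close>

lemma depth_ge_if_lam:
  assumes "U $ 0 = 1" "\<And>e. 0 < e \<Longrightarrow> e < d \<Longrightarrow> lam U e \<in> pz p"
  shows "depth_ge U d"
  using assms(2)
proof (induction d)
  case (Suc d)
  hence d: "depth_ge U d" by simp
  moreover have "U $ d = 0" if "d > 0"
    using lam_pz_iff_nth[OF assms(1) d that] Suc.prems[of d] that by simp
  ultimately show ?case by (auto simp: depth_ge_def less_Suc_eq)
qed (simp add: depth_ge_def)

text \<open>
  Write \<open>lam U e = l / e\<close> and \<open>k [x^k] G^e = e m\<close> with integers \<open>l\<close> and \<open>m\<close>. The product of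
  \<open>lam U e\<close> and \<open>[x^k] G^e\<close> is \<open>l m / k\<close>, so \<open>l\<close> has valuation at most that of \<open>k\<close>; by Dwork's congruence the
  quotient of \<open>e\<close> by its excess power of \<open>p\<close> over \<open>l\<close> is an exponent of \<open>U\<close>, too.
\<close>

lemma lam_mult_power_nth_support:
  fixes G :: "int fps"
  assumes U: "U $ 0 = (1 :: 'a)" and k: "k > 0" and e: "e > 0"
    and nz: "lam U e * of_int ((G ^ e) $ k) \<notin> pz p"
  obtains a e0 where "e = p ^ a * e0" "e0 > 0" "lam U e0 \<notin> pz p" "p ^ multiplicity p e0 dvd k"
proof -
  obtain l :: int where l: "of_nat e * lam U e = of_int l"
    using int_coeff_plog[of "lift U" e] lift_0[OF U] unfolding lam_def by metis
  obtain m where m: "int k * (G ^ e) $ k = int e * m"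
    using dvd_mult_power_nth[of e k G] by auto
  have m': "of_nat k * of_int ((G ^ e) $ k) = (of_nat e * of_int m :: rat)"
    using arg_cong[OF m, of "of_int :: int \<Rightarrow> rat"] by simp
  have lam_eq: "lam U e * of_int ((G ^ e) $ k) = of_int (l * m) / of_nat k"
  proof -
    have "of_nat e * (lam U e * of_int ((G ^ e) $ k) * of_nat k) = of_nat e * of_int (l * m)"
      using l m' by (simp add: algebra_simps) (metis (no_types, lifting) mult.assoc mult.commute)
    hence "lam U e * of_int ((G ^ e) $ k) * of_nat k = of_int (l * m)" using e by simp
    thus ?thesis using k by (simp add: field_simps)
  qed
  have lk: "\<not> int p ^ Suc (multiplicity p k) dvd l"
    using nz pz_divide[OF k, of "l * m"] unfolding lam_eq by (auto intro: dvd_mult2)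
  have lnz: "lam U e \<notin> pz p" using nz by blast
  have le: "\<not> int p ^ Suc (multiplicity p e) dvd l"
  proof
    assume "int p ^ Suc (multiplicity p e) dvd l"
    hence "of_int l / of_nat e \<in> pz p" by (rule pz_divide[OF e])
    moreover have "of_int l / of_nat e = lam U e" using l e by (simp add: field_simps)
    ultimately show False using lnz by simp
  qed
  have l0: "l \<noteq> 0" using le by auto
  have npu: "\<not> is_unit (int p)" using p_gt_2 by simp
  define b where "b = multiplicity (int p) l"
  have b_ke: "b \<le> multiplicity p k" "b \<le> multiplicity p e"
    using lk le l0 npu unfolding b_def
    by (simp_all add: power_dvd_iff_le_multiplicity not_less_eq_eq del: power_Suc)
  obtain l' where l': "l = int p ^ b * l'" "\<not> int p dvd l'"
    using multiplicity_decompose'[OF l0 npu] unfolding b_def by metis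
  define a where "a = multiplicity p e - b"
  define e0 where "e0 = e div p ^ a"
  have "p ^ a dvd e" using multiplicity_dvd'[of a p e] by (simp add: a_def)
  hence ee: "e = p ^ a * e0" by (simp add: e0_def)
  have e0: "e0 > 0" using ee e by (metis gr0I mult_0_right)
  have "multiplicity p e = a + multiplicity p e0"
    using ee e0 prime_p p_gt_2 by (simp add: prime_elem_multiplicity_mult_distrib)
  hence v0: "multiplicity p e0 = b" using b_ke by (simp add: a_def)
  obtain e' where e': "e0 = p ^ b * e'" "\<not> p dvd e'"
    using multiplicity_decompose'[of e0 p] e0 prime_p unfolding v0 [symmetric]
    by (metis neq0_conv not_prime_unit)
  have "of_nat p ^ a * lam U e * of_int (int e') = of_int l'"
    using l ee e' l' p_gt_2 by (simp add: mult_ac)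
  hence "of_nat p ^ a * lam U e \<notin> pz p"
    using pz_mult_int(2)[of "of_nat p ^ a * lam U e" "int e'"] l'(2)
    by (metis of_int_pz_iff)
  moreover have "of_nat p ^ a * lam U e \<approx>\<^sub>p lam U e0"
    using lam_dwork_iter[OF U, of a e0] ee by simp
  ultimately have "lam U e0 \<notin> pz p" using cong_pz_mem by blast
  moreover have "p ^ multiplicity p e0 dvd k" using v0 b_ke by (simp add: multiplicity_dvd')
  ultimately show ?thesis using that ee e0 by blast
qed

section \<open>Composition in the group\<close>

lemma q_gt_2: "q > 2"
proof -
  have "p ^ 1 \<le> p ^ r" using p_gt_2 r_pos by (intro power_increasing) auto
  thus ?thesis using p_gt_2 q_def by simp
qed

lemma p_dvd_q: "p dvd q"
  using r_pos by (simp add: q_def dvd_power)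

definition subst_series :: "'b::comm_ring_1 fps \<Rightarrow> 'b fps" where
  "subst_series U = fps_X * (U oo fps_X ^ q)"

definition unit_part :: "'b::comm_ring_1 fps \<Rightarrow> 'b fps" where
  "unit_part f = Abs_fps (\<lambda>i. f $ (q * i + 1))"

lemma subst_series_nth:
  "subst_series U $ n = (if n > 0 \<and> q dvd (n - 1) then U $ ((n - 1) div q) else 0)"
  by (cases n) (simp_all add: subst_series_def fps_nth_compose_X_power)

lemma subst_series_0 [simp]: "subst_series U $ 0 = 0"
  by (simp add: subst_series_nth)

lemma unit_part_subst_series [simp]: "unit_part (subst_series U) = U"
  using q_gt_2 by (intro fps_ext) (simp add: unit_part_def subst_series_nth)

lemma fps_red_subst_series: "fps_red (subst_series F) = subst_series (fps_red F)"
  by (rule fps_ext) (simp add: subst_series_nth)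

lemma subst_series_1 [simp]: "subst_series 1 = fps_X"
  by (simp add: subst_series_def)

abbreviation "T \<equiv> (fesenko_group q :: 'a fps monoid)"

lemma T_mult [simp]: "f \<otimes>\<^bsub>T\<^esub> g = f oo g"
  and T_one [simp]: "\<one>\<^bsub>T\<^esub> = fps_X"
  by (simp_all add: fesenko_group_def)

lemma carrier_T_iff: "f \<in> carrier T \<longleftrightarrow> f = subst_series (unit_part f) \<and> unit_part f $ 0 = 1"
proof
  assume f: "f \<in> carrier T"
  hence f1: "f $ 1 = 1" and fn: "\<And>n. n \<noteq> 1 \<Longrightarrow> f $ n \<noteq> 0 \<Longrightarrow> \<exists>k\<ge>1. n = q * k + 1"
    by (auto simp: fesenko_group_def)
  have "f $ n = subst_series (unit_part f) $ n" for n
  proof (cases "n > 0 \<and> q dvd (n - 1)")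
    case True
    then obtain j where "n = q * j + 1" by (metis Suc_diff_1 Suc_eq_plus1 dvdE)
    thus ?thesis using q_gt_2 by (simp add: subst_series_nth unit_part_def)
  next
    case False
    have "f $ n = 0"
    proof (rule ccontr)
      assume "f $ n \<noteq> 0"
      with fn[of n] have "n = 1 \<or> (\<exists>k. n = q * k + 1)" by blast
      with False show False by auto
    qed
    thus ?thesis using False by (simp only: subst_series_nth if_False)
  qed
  hence "f = subst_series (unit_part f)" by (rule fps_ext)
  moreover have "unit_part f $ 0 = 1" using f1 by (simp add: unit_part_def)
  ultimately show "f = subst_series (unit_part f) \<and> unit_part f $ 0 = 1" by blast
next
  assume *: "f = subst_series (unit_part f) \<and> unit_part f $ 0 = 1"
  hence "f $ 1 = 1" by (simp add: unit_part_def)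
  moreover have "\<exists>k\<ge>1. n = q * k + 1" if "n \<noteq> 1" "f $ n \<noteq> 0" for n
  proof -
    have "n > 0" "q dvd (n - 1)"
      using that(2) * by (metis subst_series_nth)+
    then obtain j where "n = q * j + 1" by (metis Suc_diff_1 Suc_eq_plus1 dvdE)
    moreover from this have "j \<ge> 1" using that(1) by (cases j) auto
    ultimately show ?thesis by blast
  qed
  ultimately show "f \<in> carrier T" by (simp add: fesenko_group_def)
qed

lemma unit_part_0 [simp]: "f \<in> carrier T \<Longrightarrow> unit_part f $ 0 = 1"
  by (simp add: carrier_T_iff)

lemma subst_series_unit_part: "f \<in> carrier T \<Longrightarrow> subst_series (unit_part f) = f"
  by (simp add: carrier_T_iff)

lemma subst_series_in_carrier: "U $ 0 = (1 :: 'a) \<Longrightarrow> subst_series U \<in> carrier T"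
  by (simp add: carrier_T_iff)

text \<open>Over the prime field v(x)^q = v(x^q), so substituting v commutes with substituting
  x^q.\<close>

lemma subst_series_compose:
  "subst_series U oo subst_series V = subst_series (V * (U oo subst_series V :: 'a fps))"
proof -
  define v where "v = subst_series V"
  have v0: "v $ 0 = 0" by (simp add: v_def)
  have X0: "(fps_X ^ q :: 'a fps) $ 0 = 0" using q_gt_2 by simp
  have Xv: "fps_X ^ q oo v = v oo fps_X ^ q"
    using fps_compose_power[OF v0, of fps_X q] v0 by (simp flip: power_q_fps)
  have "subst_series U oo v = (fps_X oo v) * ((U oo fps_X ^ q) oo v)"
    unfolding subst_series_def[of U] by (rule fps_compose_mult_distrib[OF v0])
  also have "(U oo fps_X ^ q) oo v = U oo (v oo fps_X ^ q)"
    using v0 X0 by (simp add: Xv flip: fps_compose_assoc)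
  also have "\<dots> = (U oo v) oo fps_X ^ q" using v0 X0 by (intro fps_compose_assoc)
  also have "(fps_X oo v) = fps_X * (V oo fps_X ^ q)" using v0 by (simp add: v_def subst_series_def)
  also have "\<dots> * ((U oo v) oo fps_X ^ q) = subst_series (V * (U oo v))"
    using X0 by (simp add: subst_series_def fps_compose_mult_distrib mult.assoc)
  finally show ?thesis unfolding v_def .
qed

lemma nth_0_carrier [simp]: "f \<in> carrier T \<Longrightarrow> f $ 0 = 0"
  by (metis carrier_T_iff subst_series_0)

lemma nth_1_carrier [simp]: "f \<in> carrier T \<Longrightarrow> f $ Suc 0 = 1"
  by (simp add: fesenko_group_def)

lemma unit_part_compose:
  assumes "f \<in> carrier T" "g \<in> carrier T"
  shows "unit_part (f oo g) = unit_part g * (unit_part f oo g)"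
  using subst_series_compose[of "unit_part f" "unit_part g"] assms
  by (metis subst_series_unit_part unit_part_subst_series)

lemma compose_in_carrier [intro]:
  assumes "f \<in> carrier T" "g \<in> carrier T"
  shows "f oo g \<in> carrier T"
proof -
  have "f oo g = subst_series (unit_part g * (unit_part f oo g))"
    using subst_series_compose[of "unit_part f" "unit_part g"] assms
    by (simp add: subst_series_unit_part)
  moreover have "(unit_part g * (unit_part f oo g)) $ 0 = 1" using assms by simp
  ultimately show ?thesis using subst_series_in_carrier by metis
qed

lemma fps_X_in_carrier [simp]: "fps_X \<in> carrier T"
  using subst_series_in_carrier[of 1] by simp

lemma nth_power_carrier_eq_0:
  assumes "f \<in> carrier T" "(f ^ i) $ n \<noteq> 0"
  shows "n \<ge> i" "q dvd n - i"
proof -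
  define U where "U = unit_part f"
  have "f = fps_X * (U oo fps_X ^ q)"
    using subst_series_unit_part[OF assms(1)] by (simp add: U_def subst_series_def)
  hence "f ^ i = fps_X ^ i * (U oo fps_X ^ q) ^ i" by (simp add: power_mult_distrib)
  also have "(U oo fps_X ^ q) ^ i = U ^ i oo fps_X ^ q"
    using q_gt_2 by (intro fps_compose_power) simp
  finally have "(f ^ i) $ n = (if n < i then 0 else if q dvd n - i then (U ^ i) $ ((n - i) div q) else 0)"
    by (simp add: fps_X_power_mult_nth fps_nth_compose_X_power)
  thus "n \<ge> i" "q dvd n - i" using assms(2) by (auto split: if_splits)
qed

text \<open>The i-th power of f lives in degrees congruent to i modulo q. Hence, in
  \<open>h oo f = fps_X\<close>, the residue classes modulo q of the degrees of h do not mix, and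
  only the class of 1 survives.\<close>

lemma inverse_in_carrier:
  assumes f: "f \<in> carrier T"
  shows "fps_inv f \<in> carrier T" "fps_inv f oo f = fps_X"
proof -
  define h where "h = fps_inv f"
  show hf: "fps_inv f oo f = fps_X"
    using f by (intro fps_inv) simp_all
  have h1: "h $ 1 = 1" using f by (simp add: h_def fps_inv_def)
  have "h $ n = 0" if "\<not> (n > 0 \<and> q dvd (n - 1))" for n
    using that
  proof (induction n rule: less_induct)
    case (less n)
    have "(h oo f) $ n = (\<Sum>i=0..n. h $ i * (f ^ i) $ n)" by (simp add: fps_compose_nth)
    also have "\<dots> = (\<Sum>i\<in>{n}. h $ i * (f ^ i) $ n)"
    proof (intro sum.mono_neutral_right ballI)
      fix i assume i: "i \<in> {0..n} - {n}"
      show "h $ i * (f ^ i) $ n = 0"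
      proof (cases "(f ^ i) $ n = 0")
        case False
        hence dv: "q dvd n - i" using nth_power_carrier_eq_0[OF f] by blast
        have "\<not> (i > 0 \<and> q dvd (i - 1))"
        proof
          assume *: "i > 0 \<and> q dvd (i - 1)"
          hence "q dvd (n - i) + (i - 1)" using dv by (intro dvd_add) auto
          moreover have "(n - i) + (i - 1) = n - 1" using i * by auto
          ultimately show False using less.prems i * by auto
        qed
        thus ?thesis using less.IH[of i] i by auto
      qed simp
    qed auto
    also have "(f ^ n) $ n = 1"
    proof -
      have "(f ^ n) $ n = (f $ 1) ^ n" by (rule startsby_zero_power_nth_same) (simp add: f)
      thus ?thesis using f by simp
    qed
    hence "(\<Sum>i\<in>{n}. h $ i * (f ^ i) $ n) = h $ n" by simp
    finally have "h $ n = fps_X $ n" using hf by (simp add: h_def)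
    thus ?case using less.prems by (cases "n = 1") auto
  qed
  moreover have "\<exists>k\<ge>1. n = q * k + 1" if n: "n \<noteq> 1" "n > 0 \<and> q dvd (n - 1)" for n
  proof -
    obtain j where "n = q * j + 1" using n(2) by (metis Suc_diff_1 Suc_eq_plus1 dvdE)
    moreover from this have "j \<ge> 1" using n(1) by (cases j) auto
    ultimately show ?thesis by blast
  qed
  ultimately have "\<forall>n. n \<noteq> 1 \<and> h $ n \<noteq> 0 \<longrightarrow> (\<exists>k\<ge>1. n = q * k + 1)" by blast
  with h1 show "fps_inv f \<in> carrier T"
    unfolding h_def fesenko_group_def partial_object.simps by blast
qed

lemma group_T: "group T"
proof (rule groupI)
  fix f g h assume "f \<in> carrier T" "g \<in> carrier T" "h \<in> carrier T"
  thus "f \<otimes>\<^bsub>T\<^esub> g \<otimes>\<^bsub>T\<^esub> h = f \<otimes>\<^bsub>T\<^esub> (g \<otimes>\<^bsub>T\<^esub> h)"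
    by (simp add: fps_compose_assoc)
next
  fix f assume "f \<in> carrier T"
  thus "\<exists>g\<in>carrier T. g \<otimes>\<^bsub>T\<^esub> f = \<one>\<^bsub>T\<^esub>" using inverse_in_carrier by auto
qed auto

sublocale T: group T
  by (rule group_T)

lemma plog_compose_subst_series:
  assumes "F $ 0 = 1" "G $ 0 = 1"
  shows "plog (F oo subst_series G) $ e =
    (\<Sum>i\<le>e. if q dvd (e - i) then plog F $ i * of_int ((G ^ i) $ ((e - i) div q)) else 0)"
proof -
  define g :: "rat fps" where "g = fps_red G"
  have "(subst_series g ^ i) $ e =
      (if e < i then 0 else if q dvd e - i then (g ^ i) $ ((e - i) div q) else 0)" for i
  proof -
    have "subst_series g ^ i = fps_X ^ i * (g oo fps_X ^ q) ^ i"
      by (simp add: subst_series_def power_mult_distrib)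
    also have "(g oo fps_X ^ q) ^ i = g ^ i oo fps_X ^ q"
      using q_gt_2 by (intro fps_compose_power) simp
    finally show ?thesis by (simp add: fps_X_power_mult_nth fps_nth_compose_X_power)
  qed
  thus ?thesis using assms
    by (auto simp: plog_compose fps_red_subst_series fps_compose_nth g_def atLeast0AtMost
        simp flip: fps_red_power intro!: sum.cong)
qed

text \<open>The i-th power of x G(x^q) has at x^e the coefficient of G^i at (e - i) / q. The
  diagonal term i = e is split off, as it is the coefficient of log F itself.\<close>

lemma lam_compose_subst_series:
  assumes "F $ 0 = 1" "G $ 0 = 1"
  shows "lam (fps_red F oo subst_series (fps_red G) :: 'a fps) e \<approx>\<^sub>p plog F $ e +
    (\<Sum>i | i < e \<and> q dvd (e - i). plog F $ i * of_int ((G ^ i) $ ((e - i) div q)))"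
proof -
  let ?t = "\<lambda>i. plog F $ i * of_int ((G ^ i) $ ((e - i) div q))"
  have "(F oo subst_series G) $ 0 = 1" using assms by simp
  from lam_red[OF this, of e]
  have "lam (fps_red F oo subst_series (fps_red G) :: 'a fps) e \<approx>\<^sub>p plog (F oo subst_series G) $ e"
    by (simp add: fps_red_compose fps_red_subst_series)
  also have "plog (F oo subst_series G) $ e = (\<Sum>i\<in>insert e {..<e}. if q dvd (e - i) then ?t i else 0)"
    unfolding plog_compose_subst_series[OF assms] by (intro sum.cong) auto
  also have "\<dots> = plog F $ e + (\<Sum>i<e. if q dvd (e - i) then ?t i else 0)"
    using assms by (subst sum.insert) (auto simp: fps_power_zeroth)
  also have "(\<Sum>i<e. if q dvd (e - i) then ?t i else 0) = sum ?t ({..<e} \<inter> {i. q dvd (e - i)})"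
    by (simp add: sum.If_cases)
  also have "{..<e} \<inter> {i. q dvd (e - i)} = {i. i < e \<and> q dvd (e - i)}" by auto
  finally show ?thesis .
qed

section \<open>Exponents of commutators\<close>

definition exps :: "'a fps \<Rightarrow> nat set" where
  "exps f = {e. lam (unit_part f) e \<notin> pz p}"

definition depth_at :: "'a fps \<Rightarrow> nat \<Rightarrow> bool" where
  "depth_at f d \<longleftrightarrow> d > 0 \<and> depth_ge (unit_part f) d \<and> unit_part f $ d \<noteq> 0"

text \<open>
  The exponents \<open>e\<close> that \<open>U \<circ> g\<close> may acquire from an exponent \<open>e0\<close> of \<open>U\<close>, when \<open>unit_part g\<close> is a
  power series in \<open>x^m\<close>.
\<close>

definition reaches :: "nat \<Rightarrow> nat \<Rightarrow> nat \<Rightarrow> bool" where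
  "reaches m e0 e \<longleftrightarrow> (\<exists>a k. k > 0 \<and> p ^ multiplicity p e0 dvd k \<and> e = p ^ a * e0 + q * m * k)"

text \<open>Unlike in \<open>reaches\<close>, k = 0 is allowed. This suits sets of exponents, which
  by Dwork's congruence are closed under multiplication by p.\<close>

definition admissible :: "nat set \<Rightarrow> bool" where
  "admissible A \<longleftrightarrow>
     (\<forall>e\<in>A. e > 0 \<longrightarrow> (\<forall>a k. p ^ multiplicity p e dvd k \<longrightarrow> p ^ a * e + q * k \<in> A))"

lemma admissibleD:
  "admissible A \<Longrightarrow> e0 \<in> A \<Longrightarrow> e0 > 0 \<Longrightarrow> reaches m e0 e \<Longrightarrow> e \<in> A"
  unfolding admissible_def reaches_def by (metis dvd_mult mult.assoc)

lemma exps_pos: "e \<in> exps f \<Longrightarrow> e > 0"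
  by (cases e) (auto simp: exps_def)

lemma reaches_gt: "e0 > 0 \<Longrightarrow> m > 0 \<Longrightarrow> reaches m e0 e \<Longrightarrow> e > e0"
proof -
  assume "e0 > 0" "m > 0" "reaches m e0 e"
  then obtain a k where k: "k > 0" "e = p ^ a * e0 + q * m * k" unfolding reaches_def by blast
  have "1 * e0 \<le> p ^ a * e0" using p_gt_2 by (intro mult_le_mono1) simp
  moreover have "q * m * k > 0" using q_gt_2 k \<open>m > 0\<close> by simp
  ultimately show "e > e0" using k by linarith
qed

lemma compose_X_power_power_nth:
  fixes G :: "int fps"
  assumes "m > 0"
  shows "((G oo fps_X ^ m) ^ i) $ j = (if m dvd j then (G ^ i) $ (j div m) else 0)"
proof -
  have "(G oo fps_X ^ m) ^ i = G ^ i oo fps_X ^ m" using assms by (intro fps_compose_power) simp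
  thus ?thesis by (simp add: fps_nth_compose_X_power)
qed

lemma lam_mult_compose_power_nth_support:
  fixes G :: "int fps"
  assumes U: "U $ 0 = (1 :: 'a)" and m: "m > 0" and j: "j > 0"
    and nz: "lam U i * of_int (((G oo fps_X ^ m) ^ i) $ j) \<notin> pz p"
  obtains a e0 k where "i = p ^ a * e0" "e0 > 0" "lam U e0 \<notin> pz p" "k > 0" "j = m * k"
    "p ^ multiplicity p e0 dvd k"
proof -
  have mj: "m dvd j" and *: "lam U i * of_int ((G ^ i) $ (j div m)) \<notin> pz p"
    using nz by (auto simp: compose_X_power_power_nth[OF m] split: if_splits)
  have "i > 0" using nz by (cases i) auto
  moreover have "j div m > 0" using mj j m by (simp add: dvd_imp_le div_greater_zero_iff)
  ultimately show ?thesis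
    using lam_mult_power_nth_support[OF U _ _ *] that mj by (metis dvd_mult_div_cancel)
qed

lemma sub_dvd_obtain:
  assumes "i < e" "q dvd e - i"
  shows "e = i + q * ((e - i) div q)" "(e - i) div q > 0"
  using assms q_gt_2 by (auto simp: div_greater_zero_iff dvd_imp_le)

text \<open>Each term of index i < e outside p Z_(p) would exhibit an exponent e0 of U that reaches
  e; otherwise only the diagonal term is left.\<close>

lemma lam_compose_unreachable:
  assumes U: "U $ 0 = (1 :: 'a)" and G: "G $ 0 = 1" and m: "m > 0"
    and unr: "\<And>e0. e0 > 0 \<Longrightarrow> lam U e0 \<notin> pz p \<Longrightarrow> \<not> reaches m e0 e"
  shows "lam (U oo subst_series (fps_red (G oo fps_X ^ m))) e \<approx>\<^sub>p lam U e"
proof -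
  define H where "H = G oo fps_X ^ m"
  have H0: "H $ 0 = 1" using G by (simp add: H_def)
  have "(\<Sum>i | i < e \<and> q dvd (e - i). plog (lift U) $ i * of_int ((H ^ i) $ ((e - i) div q))) \<in> pz p"
  proof (intro pz_sum, rule ccontr)
    fix i assume i: "i \<in> {i. i < e \<and> q dvd (e - i)}"
    note j = sub_dvd_obtain[of i e]
    assume "plog (lift U) $ i * of_int ((H ^ i) $ ((e - i) div q)) \<notin> pz p"
    hence "lam U i * of_int (((G oo fps_X ^ m) ^ i) $ ((e - i) div q)) \<notin> pz p"
      by (simp add: lam_def H_def)
    then obtain a e0 k where e0: "i = p ^ a * e0" "e0 > 0" "lam U e0 \<notin> pz p" "k > 0"
        "(e - i) div q = m * k" "p ^ multiplicity p e0 dvd k"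
      using lam_mult_compose_power_nth_support[OF U m] i j(2) by (metis (no_types, lifting) mem_Collect_eq)
    have "e = i + q * (m * k)" using j(1) i unfolding e0(5) [symmetric] by blast
    hence "e = p ^ a * e0 + q * m * k" by (simp add: e0(1) mult.assoc)
    hence "reaches m e0 e" unfolding reaches_def using e0 by blast
    thus False using unr e0 by blast
  qed
  moreover have "lam (U oo subst_series (fps_red H)) e \<approx>\<^sub>p plog (lift U) $ e +
    (\<Sum>i | i < e \<and> q dvd (e - i). plog (lift U) $ i * of_int ((H ^ i) $ ((e - i) div q)))"
    using lam_compose_subst_series[OF lift_0[OF U] H0] by simp
  ultimately show ?thesis unfolding H_def [symmetric]
    using pz_add by (fastforce simp: lam_def algebra_simps)
qed

lemma lam_compose_carrier_unreachable:
  assumes U: "U $ 0 = 1" and g: "g \<in> carrier T"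
    and unr: "\<And>e0. e0 > 0 \<Longrightarrow> lam U e0 \<notin> pz p \<Longrightarrow> \<not> reaches 1 e0 e"
  shows "lam (U oo g) e \<approx>\<^sub>p lam U e"
  using lam_compose_unreachable[OF U, of "lift (unit_part g)" 1 e] unr g
  by (simp add: lift_0 subst_series_unit_part)

lemma lam_unit_part_compose:
  assumes "f \<in> carrier T" "g \<in> carrier T"
  shows "lam (unit_part (f oo g)) e \<approx>\<^sub>p lam (unit_part g) e + lam (unit_part f oo g) e"
  using assms by (simp add: unit_part_compose lam_mult)

lemma lam_unit_part_compose_unreachable:
  assumes "f \<in> carrier T" "g \<in> carrier T" "\<And>e0. e0 \<in> exps f \<Longrightarrow> \<not> reaches 1 e0 e"
  shows "lam (unit_part (f oo g)) e \<approx>\<^sub>p lam (unit_part f) e + lam (unit_part g) e"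
proof -
  have "lam (unit_part f oo g) e \<approx>\<^sub>p lam (unit_part f) e"
    using assms by (intro lam_compose_carrier_unreachable) (auto simp: exps_def)
  from pz_add[OF this lam_unit_part_compose[OF assms(1,2), of e]] show ?thesis
    by (simp add: algebra_simps)
qed

lemma lam_one_pz: "lam (unit_part fps_X :: 'a fps) e \<in> pz p"
proof -
  have "unit_part fps_X = (1 :: 'a fps)" by (metis subst_series_1 unit_part_subst_series)
  thus ?thesis using lam_red[of 1 e] by simp
qed

definition exps_in :: "nat set \<Rightarrow> 'a fps set" where
  "exps_in A = {f \<in> carrier T. exps f \<subseteq> A}"

text \<open>No exponent in A reaches an e outside A, so at such e the coefficient of the logarithm
  is additive under composition.\<close>

lemma subgroup_exps_in:
  assumes "admissible A"
  shows "subgroup (exps_in A) T"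
proof
  show "exps_in A \<subseteq> carrier T" by (auto simp: exps_in_def)
  show "\<one>\<^bsub>T\<^esub> \<in> exps_in A" by (simp add: exps_in_def exps_def lam_one_pz)
next
  fix f g assume fg: "f \<in> exps_in A" "g \<in> exps_in A"
  have "lam (unit_part (f oo g)) e \<in> pz p" if "e \<notin> A" for e
  proof -
    have "lam (unit_part (f oo g)) e \<approx>\<^sub>p lam (unit_part f) e + lam (unit_part g) e"
      using fg that admissibleD[OF assms] exps_pos
      by (intro lam_unit_part_compose_unreachable) (auto simp: exps_in_def)
    moreover have "lam (unit_part f) e + lam (unit_part g) e \<in> pz p"
      using fg that by (intro pz_add) (auto simp: exps_in_def exps_def)
    ultimately show ?thesis using cong_pz_mem by blast
  qed
  thus "f \<otimes>\<^bsub>T\<^esub> g \<in> exps_in A" using fg by (auto simp: exps_in_def exps_def)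
next
  fix f assume f: "f \<in> exps_in A"
  hence fT: "f \<in> carrier T" by (simp add: exps_in_def)
  define g where "g = inv\<^bsub>T\<^esub> f"
  have g: "g \<in> carrier T" "f oo g = fps_X" using fT T.r_inv[of f] by (auto simp: g_def)
  have "lam (unit_part g) e \<in> pz p" if "e \<notin> A" for e
  proof -
    have "lam (unit_part (f oo g)) e \<approx>\<^sub>p lam (unit_part f) e + lam (unit_part g) e"
      using f g that admissibleD[OF assms] exps_pos
      by (intro lam_unit_part_compose_unreachable) (auto simp: exps_in_def)
    hence "lam (unit_part f) e + lam (unit_part g) e \<in> pz p"
      using lam_one_pz cong_pz_mem unfolding g by blast
    moreover have "lam (unit_part f) e \<in> pz p" using f that by (auto simp: exps_in_def exps_def)
    ultimately show ?thesis using pz_diff by fastforce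
  qed
  thus "inv\<^bsub>T\<^esub> f \<in> exps_in A" using g by (auto simp: exps_in_def exps_def g_def)
qed

section \<open>Logarithms of commutators\<close>

definition commut :: "'a fps \<Rightarrow> 'a fps \<Rightarrow> 'a fps" where
  "commut f g = f \<otimes>\<^bsub>T\<^esub> g \<otimes>\<^bsub>T\<^esub> inv\<^bsub>T\<^esub> f \<otimes>\<^bsub>T\<^esub> inv\<^bsub>T\<^esub> g"

lemma commut_in_carrier [simp]:
  "f \<in> carrier T \<Longrightarrow> g \<in> carrier T \<Longrightarrow> commut f g \<in> carrier T"
  unfolding commut_def by (intro T.m_closed T.inv_closed)

lemma commut_compose:
  assumes "f \<in> carrier T" "g \<in> carrier T"
  shows "commut f g oo (g oo f) = f oo g"
proof -
  have "commut f g \<otimes>\<^bsub>T\<^esub> (g \<otimes>\<^bsub>T\<^esub> f) = f \<otimes>\<^bsub>T\<^esub> g"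
    unfolding commut_def using assms
    by (simp add: T.m_assoc T.inv_solve_left' del: T_mult)
  thus ?thesis by simp
qed

text \<open>Take logarithms in \<open>c \<circ> (g \<circ> f) = f \<circ> g\<close>, where \<open>c\<close> is the commutator.\<close>

lemma lam_commut_compose:
  assumes f: "f \<in> carrier T" and g: "g \<in> carrier T"
  shows "lam (unit_part (commut f g) oo (g oo f)) e \<approx>\<^sub>p
    (lam (unit_part f oo g) e - lam (unit_part f) e) - (lam (unit_part g oo f) e - lam (unit_part g) e)"
proof -
  note 1 = lam_unit_part_compose[OF commut_in_carrier[OF f g] compose_in_carrier[OF g f], of e]
  note 2 = lam_unit_part_compose[OF f g, of e]
  note 3 = lam_unit_part_compose[OF g f, of e]
  from pz_diff[OF pz_diff[OF 2 1] 3] show ?thesis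
    unfolding commut_compose[OF f g] by (simp add: algebra_simps)
qed

text \<open>The hypotheses control the two halves of the commutator formula, hence the exponents of
  c composed with g o f, where c is the series of the commutator. Composing with the inverse of g o
  f recovers c and creates no exponents outside the admissible A.\<close>

lemma exps_commut_subset:
  assumes f: "f \<in> carrier T" and g: "g \<in> carrier T" and A: "admissible A"
    and fg: "\<And>e. e > 0 \<Longrightarrow> e \<notin> A \<Longrightarrow> lam (unit_part f oo g) e \<approx>\<^sub>p lam (unit_part f) e"
    and gf: "\<And>e. e > 0 \<Longrightarrow> e \<notin> A \<Longrightarrow> lam (unit_part g oo f) e \<approx>\<^sub>p lam (unit_part g) e"
  shows "exps (commut f g) \<subseteq> A"
proof (rule ccontr)
  define h where "h = g oo f"
  define c where "c = unit_part (commut f g)"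
  have h: "h \<in> carrier T" using f g by (auto simp: h_def)
  assume "\<not> exps (commut f g) \<subseteq> A"
  then obtain e where e: "e \<notin> A" "lam c e \<notin> pz p" by (auto simp: exps_def c_def)
  have *: "lam (c oo h) e \<in> pz p" if "e \<notin> A" "e > 0" for e
    using cong_pz_mem[OF lam_commut_compose[OF f g, of e]] pz_diff[OF fg gf] that
    unfolding c_def h_def by blast
  have hh: "h oo inv\<^bsub>T\<^esub> h = fps_X" using T.r_inv[OF h] by simp
  have i: "inv\<^bsub>T\<^esub> h \<in> carrier T" using h by simp
  have "(c oo h) oo inv\<^bsub>T\<^esub> h = c"
    using h i hh fps_compose_assoc[of "inv\<^bsub>T\<^esub> h" h c] by simp
  moreover have "lam ((c oo h) oo inv\<^bsub>T\<^esub> h) e \<approx>\<^sub>p lam (c oo h) e"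
    using f g i e admissibleD[OF A] *
    by (intro lam_compose_carrier_unreachable) (auto simp: c_def)
  moreover have "e > 0" using e by (cases e) auto
  ultimately show False using * e cong_pz_mem by metis
qed

lemma lam_commut:
  assumes f: "f \<in> carrier T" and g: "g \<in> carrier T"
    and unr: "\<And>e0. e0 \<in> exps (commut f g) \<Longrightarrow> \<not> reaches 1 e0 e"
  shows "lam (unit_part (commut f g)) e \<approx>\<^sub>p
    (lam (unit_part f oo g) e - lam (unit_part f) e) - (lam (unit_part g oo f) e - lam (unit_part g) e)"
proof -
  have "lam (unit_part (commut f g) oo (g oo f)) e \<approx>\<^sub>p lam (unit_part (commut f g)) e"
    using f g unr by (intro lam_compose_carrier_unreachable) (auto simp: exps_def)
  from cong_pz_trans[OF cong_pz_sym[OF this] lam_commut_compose[OF f g]] show ?thesis .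
qed

definition elem :: "nat \<Rightarrow> 'a fps" where
  "elem m = subst_series (1 - fps_X ^ m)"

lemma elem_in_carrier [simp]: "m > 0 \<Longrightarrow> elem m \<in> carrier T"
  unfolding elem_def by (intro subst_series_in_carrier) simp

lemma unit_part_elem: "unit_part (elem m) = fps_red (1 - fps_X ^ m)"
  by (simp add: elem_def fps_red_diff fps_red_power)

lemma lam_compose_elem_unreachable:
  assumes "f \<in> carrier T" "m > 0" "\<And>e0. e0 \<in> exps f \<Longrightarrow> \<not> reaches m e0 e"
  shows "lam (unit_part f oo elem m) e \<approx>\<^sub>p lam (unit_part f) e"
proof -
  have "(1 - fps_X) oo fps_X ^ m = (1 - fps_X ^ m :: int fps)"
    using assms(2) by (simp add: fps_compose_sub_distrib)
  hence "elem m = subst_series (fps_red ((1 - fps_X) oo fps_X ^ m))"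
    by (simp add: elem_def fps_red_diff fps_red_power)
  thus ?thesis using lam_compose_unreachable[of "unit_part f" "1 - fps_X" m e] assms
    by (auto simp: exps_def)
qed

text \<open>At a multiple i of m the coefficient of log (1 - x^m) is -m / i, and in degree j < 2 d
  the coefficient of F^i is i F_j. The factors i cancel and leave -m F_j.\<close>

lemma lam_elem_compose:
  assumes f: "f \<in> carrier T" and m: "m > 0" and d: "depth_ge (unit_part f) d" and e: "e < 2 * q * d"
  shows "lam (unit_part (elem m) oo f) e \<approx>\<^sub>p lam (unit_part (elem m)) e -
    of_int (\<Sum>i | 0 < i \<and> i < e \<and> q dvd (e - i) \<and> m dvd i. int m * lift (unit_part f) $ ((e - i) div q))"
proof -
  define P where "P = (1 - fps_X ^ m :: int fps)"
  define F where "F = lift (unit_part f)"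
  have P0: "P $ 0 = 1" using m by (simp add: P_def)
  have F0: "F $ 0 = 1" using f by (simp add: F_def lift_0)
  let ?S = "{i. i < e \<and> q dvd (e - i)}"
  have "lam (unit_part (elem m) oo f) e \<approx>\<^sub>p plog P $ e +
      (\<Sum>i\<in>?S. plog P $ i * of_int ((F ^ i) $ ((e - i) div q)))"
    using lam_compose_subst_series[OF P0 F0] f
    by (simp add: unit_part_elem P_def F_def subst_series_unit_part)
  also have "(\<Sum>i\<in>?S. plog P $ i * of_int ((F ^ i) $ ((e - i) div q))) =
      (\<Sum>i\<in>?S. if 0 < i \<and> m dvd i then - of_int (int m * F $ ((e - i) div q)) else 0)"
  proof (intro sum.cong refl)
    fix i assume i: "i \<in> ?S"
    define j where "j = (e - i) div q"
    have j: "e = i + q * j" "j > 0" using sub_dvd_obtain[of i e] i by (auto simp: j_def)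
    have "q * j < 2 * q * d" using j e by linarith
    also have "2 * q * d = q * (2 * d)" by simp
    finally have j2: "j < 2 * d" by (simp only: mult_less_cancel1)
    have "(F ^ i) $ j = int i * F $ j"
      by (rule power_nth_eq_below(1)[where d = d])
         (use F0 j j2 d in \<open>auto simp: F_def depth_ge_def lift_nth_eq_0\<close>)
    thus "plog P $ i * of_int ((F ^ i) $ ((e - i) div q)) =
        (if 0 < i \<and> m dvd i then - of_int (int m * F $ ((e - i) div q)) else 0)"
      using m plog_one_minus_X_power[OF m, of i]
      by (cases "i = 0") (auto simp: P_def simp flip: j_def)
  qed
  also have "\<dots> = (\<Sum>i\<in>?S \<inter> {i. 0 < i \<and> m dvd i}. - of_int (int m * F $ ((e - i) div q)))"
    by (simp add: sum.If_cases)
  also have "?S \<inter> {i. 0 < i \<and> m dvd i} = {i. 0 < i \<and> i < e \<and> q dvd (e - i) \<and> m dvd i}" by auto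
  finally have 1: "lam (unit_part (elem m) oo f) e \<approx>\<^sub>p plog P $ e -
    of_int (\<Sum>i | 0 < i \<and> i < e \<and> q dvd (e - i) \<and> m dvd i. int m * F $ ((e - i) div q))"
    by (simp add: sum_negf)
  have 2: "lam (unit_part (elem m)) e \<approx>\<^sub>p plog P $ e"
    using lam_red[OF P0] by (simp add: unit_part_elem P_def)
  from pz_diff[OF 1 2] show ?thesis by (simp add: F_def algebra_simps)
qed

section \<open>Depth as least exponent, and cancellation of depths\<close>

lemma depth_geD: "f \<in> carrier T \<Longrightarrow> depth_ge (unit_part f) d \<Longrightarrow> e \<in> exps f \<Longrightarrow> d \<le> e"
proof (rule ccontr)
  assume *: "f \<in> carrier T" "depth_ge (unit_part f) d" "e \<in> exps f" "\<not> d \<le> e"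
  have "e > 0" using * exps_pos by blast
  moreover from this have "unit_part f $ e = 0" using * by (auto simp: depth_ge_def)
  ultimately show False using lam_pz_iff_nth[of "unit_part f" d e] * by (auto simp: exps_def)
qed

lemma depth_geI:
  "f \<in> carrier T \<Longrightarrow> (\<And>e. e \<in> exps f \<Longrightarrow> d \<le> e) \<Longrightarrow> depth_ge (unit_part f) d"
  by (rule depth_ge_if_lam) (auto simp: exps_def dest: leD)

lemma depth_at_iff:
  "f \<in> carrier T \<Longrightarrow> depth_at f d \<longleftrightarrow> depth_ge (unit_part f) d \<and> d \<in> exps f"
  using lam_pz_iff_nth[of "unit_part f" d d] exps_pos[of d f]
  by (auto simp: depth_at_def exps_def)

lemma lam_compose_carrier_low:
  assumes g: "g \<in> carrier T" and f: "f \<in> carrier T" and low: "\<And>e0. e0 \<in> exps f \<Longrightarrow> e \<le> q * e0"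
  shows "lam (unit_part g oo f) e \<approx>\<^sub>p lam (unit_part g) e"
proof -
  \<comment> \<open>The ceiling of e / q: then f agrees with x up to degree q d, and composing with
    f changes nothing in degree e.\<close>
  define d where "d = (e + q - 1) div q"
  have qd: "e \<le> q * d"
  proof -
    have "e + q - 1 < q * Suc d"
      unfolding d_def using q_gt_2 dividend_less_div_times[of q "e + q - 1"] by (simp add: mult.commute)
    thus ?thesis by (simp add: algebra_simps)
  qed
  have d: "depth_ge (unit_part f) d"
  proof (rule depth_geI[OF f])
    fix e0 assume "e0 \<in> exps f"
    hence "e + q - 1 < q * Suc e0" using low q_gt_2 by fastforce
    hence "d < Suc e0" unfolding d_def using q_gt_2 by (simp add: less_mult_imp_div_less mult.commute)
    thus "d \<le> e0" by simp
  qed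
  define G F where "G = lift (unit_part g)" and "F = lift (unit_part f)"
  have G0: "G $ 0 = 1" and F0: "F $ 0 = 1" using f g by (simp_all add: G_def F_def lift_0)
  have "(\<Sum>i | i < e \<and> q dvd (e - i). plog G $ i * of_int ((F ^ i) $ ((e - i) div q))) = 0"
  proof (intro sum.neutral ballI)
    fix i assume i: "i \<in> {i. i < e \<and> q dvd (e - i)}"
    define j where "j = (e - i) div q"
    have j: "e = i + q * j" "j > 0" using sub_dvd_obtain[of i e] i by (auto simp: j_def)
    show "plog G $ i * of_int ((F ^ i) $ ((e - i) div q)) = 0"
    proof (cases "i = 0")
      case False
      hence "q * j < q * d" using j qd by linarith
      hence "j < d" by simp
      hence "(F ^ i) $ j = 0" using j F0 d
        by (intro power_nth_eq_below(2)[where d = d and n = j]) (auto simp: F_def depth_ge_def lift_nth_eq_0)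
      thus ?thesis by (simp add: j_def)
    qed simp
  qed
  thus ?thesis using lam_compose_subst_series[OF G0 F0, of e] f g
    by (simp add: G_def F_def lam_def subst_series_unit_part)
qed

lemma lam_power:
  assumes f: "f \<in> carrier T" and d: "depth_ge (unit_part f) d"
  shows "f [^]\<^bsub>T\<^esub> (n::nat) \<in> carrier T \<and> depth_ge (unit_part (f [^]\<^bsub>T\<^esub> n)) d \<and>
    lam (unit_part (f [^]\<^bsub>T\<^esub> n)) d \<approx>\<^sub>p of_nat n * lam (unit_part f) d"
proof (induction n)
  case 0
  show ?case by (auto simp: depth_ge_if_lam lam_one_pz)
next
  case (Suc n)
  define g where "g = f [^]\<^bsub>T\<^esub> n"
  have g: "g \<in> carrier T" "depth_ge (unit_part g) d" "lam (unit_part g) d \<approx>\<^sub>p of_nat n * lam (unit_part f) d"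
    using Suc by (auto simp: g_def)
  have unr: "\<not> reaches 1 e0 e" if "e0 \<in> exps g" "e \<le> d" for e0 e
    using that depth_geD[OF g(1,2)] exps_pos[of e0 g] reaches_gt[of e0 1 e] by fastforce
  have eq: "lam (unit_part (g oo f)) e \<approx>\<^sub>p lam (unit_part g) e + lam (unit_part f) e" if "e \<le> d" for e
    using unr that g(1) f by (intro lam_unit_part_compose_unreachable) auto
  have gf: "g oo f \<in> carrier T" using g f by blast
  have "depth_ge (unit_part (g oo f)) d"
  proof (rule depth_geI[OF gf], rule ccontr)
    fix e assume e: "e \<in> exps (g oo f)" "\<not> d \<le> e"
    hence "e \<notin> exps g" "e \<notin> exps f" using depth_geD[OF f d] depth_geD[OF g(1,2)] by blast+
    hence "lam (unit_part g) e + lam (unit_part f) e \<in> pz p" by (auto simp: exps_def)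
    thus False using eq[of e] cong_pz_mem e by (auto simp: exps_def)
  qed
  moreover have "lam (unit_part (g oo f)) d \<approx>\<^sub>p of_nat (Suc n) * lam (unit_part f) d"
    using pz_add[OF eq[of d] g(3)] by (simp add: algebra_simps)
  ultimately show ?case using gf by (simp add: g_def)
qed

text \<open>At the common depth composition adds leading coefficients a and b, so the power n = - a
  / b modulo p cancels. Both orders are provided since powers are later multiplied on either side;
  \<open>n < p\<close> bounds the number of representatives when cosets are counted.\<close>

lemma cancel_depth:
  assumes f: "f \<in> carrier T" "depth_ge (unit_part f) d" and g: "depth_at g d" "g \<in> carrier T"
  obtains n where "depth_ge (unit_part (f oo (g [^]\<^bsub>T\<^esub> (n::nat)))) (Suc d)"
    and "depth_ge (unit_part ((g [^]\<^bsub>T\<^esub> n) oo f)) (Suc d)" and "n < p"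
proof -
  define a b where "a = lift (unit_part f) $ d" and "b = lift (unit_part g) $ d"
  have d: "d > 0" and gd: "depth_ge (unit_part g) d" and b: "\<not> int p dvd b"
    using g by (auto simp: depth_at_def b_def lift_nth_dvd_iff)
  have la: "lam (unit_part f) d = of_int a" and lb: "lam (unit_part g) d = of_int b"
    using lam_of_depth_ge[of _ d d] f g gd d by (auto simp: a_def b_def)
  have "coprime b (int p)" using b prime_imp_coprime[OF prime_int_p] coprime_commute by blast
  then obtain x where x: "[b * x = 1] (mod int p)" using cong_solve_coprime_int by blast
  define n where "n = nat ((- a * x) mod int p)"
  have np: "int n = (- a * x) mod int p" using p_gt_2 by (simp add: n_def)
  have "[a + int n * b = a + (- a * x) * b] (mod int p)"
    unfolding np by (intro cong_add cong_mult) (auto simp: cong_def)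
  also have "a + (- a * x) * b = a - a * (b * x)" by (simp add: algebra_simps)
  also have "[a - a * (b * x) = a - a * 1] (mod int p)"
    using x by (intro cong_diff cong_mult) auto
  finally have dv: "int p dvd a + int n * b" by (simp add: cong_0_iff)
  define h where "h = g [^]\<^bsub>T\<^esub> n"
  have h: "h \<in> carrier T" "depth_ge (unit_part h) d" "lam (unit_part h) d \<approx>\<^sub>p of_nat n * of_int b"
    using lam_power[OF g(2) gd, of n] by (auto simp: h_def lb)
  have main: "depth_ge (unit_part (u oo v)) (Suc d)"
    if u: "u \<in> carrier T" "depth_ge (unit_part u) d" and v: "v \<in> carrier T" "depth_ge (unit_part v) d"
      and s: "lam (unit_part u) d + lam (unit_part v) d \<in> pz p" for u v
  proof -
    have unr: "\<not> reaches 1 e0 e" if "e0 \<in> exps u" "e \<le> d" for e0 e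
      using that depth_geD[OF u] exps_pos[of e0 u] reaches_gt[of e0 1 e] by fastforce
    have eq: "lam (unit_part (u oo v)) e \<approx>\<^sub>p lam (unit_part u) e + lam (unit_part v) e" if "e \<le> d" for e
      using unr that u v by (intro lam_unit_part_compose_unreachable) auto
    show ?thesis
    proof (rule depth_geI, use u v in blast, rule ccontr)
      fix e assume e: "e \<in> exps (u oo v)" "\<not> Suc d \<le> e"
      have "lam (unit_part u) e + lam (unit_part v) e \<in> pz p"
      proof (cases "e = d")
        case False
        hence "e \<notin> exps u" "e \<notin> exps v" using depth_geD[OF u] depth_geD[OF v] e by fastforce+
        thus ?thesis by (auto simp: exps_def)
      qed (use s in simp)
      thus False using eq[of e] cong_pz_mem e by (auto simp: exps_def)
    qed
  qed
  have "lam (unit_part f) d + lam (unit_part h) d \<in> pz p"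
  proof -
    have "of_int (a + int n * b) \<in> pz p" using dv by (simp only: of_int_pz_iff)
    from pz_add[OF h(3) this] show ?thesis by (simp add: la algebra_simps)
  qed
  hence "depth_ge (unit_part (f oo h)) (Suc d)" "depth_ge (unit_part (h oo f)) (Suc d)"
    using main[of f h] main[of h f] f h by (simp_all add: add.commute)
  moreover have "n < p" using np p_gt_2 by (metis nat_int_comparison(2) of_nat_0_less_iff pos_mod_bound prime_gt_0_nat prime_p)
  ultimately show ?thesis using that unfolding h_def by blast
qed

text \<open>
  Multiply \<open>W\<close> successively by powers of elements with exponents in \<open>A\<close>; since \<open>A\<close> is admissible
  and misses \<open>D\<close>, this does not change the coefficient at \<open>D\<close>.
\<close>

lemma eliminate_lower_exps:
  assumes H: "subgroup H T" and A: "admissible A" "admissible (insert D A)" "D \<notin> A"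
    and W: "W \<in> H" "exps W \<subseteq> insert D A" "D \<in> exps W"
    and X: "\<And>f. f \<in> A \<Longrightarrow> 0 < f \<Longrightarrow> f < D \<Longrightarrow> \<exists>X\<in>H. depth_at X f \<and> exps X \<subseteq> A"
  shows "\<exists>Z\<in>H. depth_at Z D \<and> exps Z \<subseteq> insert D A"
proof -
  have HT: "H \<subseteq> carrier T" using H by (rule subgroup.subset)
  have "\<exists>Z\<in>H. exps Z \<subseteq> insert D A \<and> D \<in> exps Z \<and> depth_ge (unit_part Z) j" if "j \<le> D" for j
    using that
  proof (induction j)
    case 0
    thus ?case using W by (auto simp: depth_ge_def)
  next
    case (Suc j)
    then obtain Z where Z: "Z \<in> H" "exps Z \<subseteq> insert D A" "D \<in> exps Z" "depth_ge (unit_part Z) j"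
      by auto
    have ZT: "Z \<in> carrier T" using Z HT by blast
    show ?case
    proof (cases "j \<in> exps Z")
      case False
      have "depth_ge (unit_part Z) (Suc j)"
        using depth_geD[OF ZT Z(4)] False by (intro depth_geI[OF ZT]) (metis not_less_eq_eq le_antisym)
      thus ?thesis using Z by blast
    next
      case True
      hence j: "j \<in> A" "0 < j" "j < D" using Z Suc.prems exps_pos by auto
      then obtain X where X: "X \<in> H" "depth_at X j" "exps X \<subseteq> A" using X by blast
      have XT: "X \<in> carrier T" using X HT by blast
      obtain n where n: "depth_ge (unit_part (Z oo (X [^]\<^bsub>T\<^esub> (n::nat)))) (Suc j)"
        using cancel_depth[OF ZT Z(4) X(2) XT] by blast
      define Y where "Y = X [^]\<^bsub>T\<^esub> n"
      have pow: "Y \<in> S" if "subgroup S T" "X \<in> S" for S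
        unfolding Y_def using that by (induction n) (auto simp: subgroup.one_closed subgroup.m_closed simp del: T_mult T_one)
      have Y: "Y \<in> H" "Y \<in> exps_in A" "Y \<in> exps_in (insert D A)"
        using pow[OF H X(1)] pow[OF subgroup_exps_in] A X XT by (auto simp: exps_in_def)
      have "Z \<in> exps_in (insert D A)" using Z ZT by (simp add: exps_in_def)
      hence ZY: "Z oo Y \<in> exps_in (insert D A)"
        using subgroup.m_closed[OF subgroup_exps_in[OF A(2)], of Z Y] Y by simp
      have "lam (unit_part (Z oo Y)) D \<approx>\<^sub>p lam (unit_part Z) D + lam (unit_part Y) D"
      proof (rule lam_unit_part_compose_unreachable[OF ZT])
        fix e0 assume e0: "e0 \<in> exps Z"
        show "\<not> reaches 1 e0 D"
          using Z(2) e0 exps_pos[OF e0] reaches_gt[of e0 1 D] admissibleD[OF A(1), of e0 1 D] A(3) by auto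
      qed (use Y in \<open>simp add: exps_in_def\<close>)
      moreover have "lam (unit_part Y) D \<in> pz p" using Y A by (auto simp: exps_in_def exps_def)
      ultimately have "lam (unit_part (Z oo Y)) D \<approx>\<^sub>p lam (unit_part Z) D"
        using pz_add by fastforce
      hence "D \<in> exps (Z oo Y)" using Z cong_pz_mem by (auto simp: exps_def)
      moreover have "Z oo Y \<in> H" using subgroup.m_closed[OF H Z(1) Y(1)] by simp
      ultimately show ?thesis using ZY n by (auto simp: Y_def exps_in_def)
    qed
  qed
  from this[of D] obtain Z where Z: "Z \<in> H" "exps Z \<subseteq> insert D A" "D \<in> exps Z" "depth_ge (unit_part Z) D"
    by auto
  moreover from this have "depth_at Z D" using HT by (subst depth_at_iff) auto
  ultimately show ?thesis by blast
qed

section \<open>Depths of small valuation in the lower central series\<close>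

abbreviation gam :: "nat \<Rightarrow> 'a fps set" where
  "gam n \<equiv> lower_central T (Suc n)"

section \<open>Closed subgroups and the lower central series\<close>

lemma inv_agree:
  assumes "f \<in> carrier T" "g \<in> carrier T" "fps_agree N f g"
  shows "fps_agree N (inv\<^bsub>T\<^esub> f) (inv\<^bsub>T\<^esub> g)"
proof -
  define f' g' where "f' = inv\<^bsub>T\<^esub> f" and "g' = inv\<^bsub>T\<^esub> g"
  have T: "f' \<in> carrier T" "g' \<in> carrier T" using assms by (auto simp: f'_def g'_def)
  have 1: "f' oo (g oo g') = f'" "(f' oo f) oo g' = g'"
    using T.r_inv[OF assms(2)] T.l_inv[OF assms(1)] T unfolding f'_def g'_def by auto
  have "fps_agree N (f' oo (g oo g')) (f' oo (f oo g'))"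
    using assms(3) fps_agree_sym by (intro fps_agree_compose) auto
  also have "f' oo (f oo g') = (f' oo f) oo g'" using T assms by (intro fps_compose_assoc) auto
  finally show ?thesis using 1 by (simp add: f'_def g'_def)
qed

lemma subgroup_closure_of:
  assumes S: "subgroup S T"
  shows "subgroup (top_of_set (carrier T) closure_of S) T" (is "subgroup ?C T")
proof
  note S' = subgroup.subset[OF S]
  note iff = mem_closure_of_fps_iff[OF S']
  show "?C \<subseteq> carrier T" using iff by blast
  show "\<one>\<^bsub>T\<^esub> \<in> ?C" unfolding iff using subgroup.one_closed[OF S]
    by (auto intro!: bexI[of _ fps_X])
  show "f \<otimes>\<^bsub>T\<^esub> g \<in> ?C" if "f \<in> ?C" "g \<in> ?C" for f g
  proof -
    have "\<exists>h\<in>S. fps_agree N (f oo g) h" for N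
    proof -
      have "\<exists>f'\<in>S. fps_agree N f f'" "\<exists>g'\<in>S. fps_agree N g g'"
        using that iff by blast+
      then obtain f' g' where "f' \<in> S" "g' \<in> S" "fps_agree N f f'" "fps_agree N g g'"
        by blast
      thus ?thesis using fps_agree_compose subgroup.m_closed[OF S, of f' g'] by (metis T_mult)
    qed
    thus ?thesis using that iff by auto
  qed
  show "inv\<^bsub>T\<^esub> f \<in> ?C" if "f \<in> ?C" for f
  proof -
    have "\<exists>h\<in>S. fps_agree N (inv\<^bsub>T\<^esub> f) h" for N
    proof -
      have "\<exists>f'\<in>S. fps_agree N f f'" using that iff by blast
      then obtain f' where "f' \<in> S" "fps_agree N f f'" by blast
      thus ?thesis using inv_agree[of f f' N] S' that iff subgroup.m_inv_closed[OF S, of f'] by blast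
    qed
    thus ?thesis using that iff by auto
  qed
qed

lemma commutator_subgroup_eq:
  "commutator_subgroup T A B = generate T (\<Union>f\<in>A. \<Union>g\<in>B. {commut f g})"
  by (simp add: commutator_subgroup_def commut_def)

lemma subgroup_commutator_subgroup:
  "A \<subseteq> carrier T \<Longrightarrow> subgroup (commutator_subgroup T A (carrier T)) T"
  unfolding commutator_subgroup_eq by (intro T.generate_is_subgroup) auto

lemma subgroup_gam: "subgroup (gam n) T"
proof (induction n)
  case 0
  show ?case using T.subgroup_self by simp
next
  case (Suc n)
  show ?case unfolding lower_central.simps
    by (intro subgroup_closure_of subgroup_commutator_subgroup subgroup.subset Suc)
qed

lemma gam_subset: "gam n \<subseteq> carrier T"
  using subgroup_gam by (rule subgroup.subset)

lemma mem_gam_Suc_iff: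
  "f \<in> gam (Suc n) \<longleftrightarrow> f \<in> carrier T \<and>
    (\<forall>N. \<exists>g\<in>commutator_subgroup T (gam n) (carrier T). fps_agree N f g)"
  unfolding lower_central.simps
  by (rule mem_closure_of_fps_iff) (intro subgroup.subset subgroup_commutator_subgroup gam_subset)

lemma commut_in_gam:
  assumes "f \<in> gam n" "g \<in> carrier T"
  shows "commut f g \<in> gam (Suc n)"
proof -
  have "commut f g \<in> commutator_subgroup T (gam n) (carrier T)"
    unfolding commutator_subgroup_eq using assms by (intro generate.incl) blast
  hence "\<exists>h\<in>commutator_subgroup T (gam n) (carrier T). fps_agree N (commut f g) h" for N
    using fps_agree_refl by blast
  moreover have "commut f g \<in> carrier T" using assms gam_subset[of n] by (intro commut_in_carrier) blast+
  ultimately show ?thesis unfolding mem_gam_Suc_iff by blast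
qed

lemma gam_Suc_subset: "gam (Suc n) \<subseteq> gam n"
proof (induction n)
  case 0
  thus ?case using gam_subset[of 1] by simp
next
  case (Suc n)
  have "commutator_subgroup T (gam (Suc n)) (carrier T) \<subseteq> commutator_subgroup T (gam n) (carrier T)"
    unfolding commutator_subgroup_eq using Suc by (intro T.mono_generate) blast
  hence "(\<exists>g\<in>commutator_subgroup T (gam (Suc n)) (carrier T). fps_agree N f g) \<Longrightarrow>
      (\<exists>g\<in>commutator_subgroup T (gam n) (carrier T). fps_agree N f g)" for N and f
    by blast
  thus ?case by (auto simp only: mem_gam_Suc_iff subset_eq)
qed

lemma gam_mono: "m \<le> n \<Longrightarrow> gam n \<subseteq> gam m"
  by (induction n rule: dec_induct) (use gam_Suc_subset in blast)+

lemma gam_limit: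
  assumes "f \<in> carrier T" "\<And>N. \<exists>g\<in>gam n. fps_agree N f g"
  shows "f \<in> gam n"
proof (cases n)
  case (Suc m)
  have "\<exists>h\<in>commutator_subgroup T (gam m) (carrier T). fps_agree N f h" for N
  proof -
    obtain g where g: "g \<in> gam (Suc m)" "fps_agree N f g" using assms(2)[of N] Suc by blast
    then obtain h where "h \<in> commutator_subgroup T (gam m) (carrier T)" "fps_agree N g h"
      unfolding mem_gam_Suc_iff by blast
    thus ?thesis using g(2) fps_agree_trans by blast
  qed
  thus ?thesis using assms(1) unfolding Suc mem_gam_Suc_iff by blast
qed (use assms in simp)

lemma gam_Suc_least:
  assumes P: "subgroup P T" and comm: "\<And>f g. f \<in> gam n \<Longrightarrow> g \<in> carrier T \<Longrightarrow> commut f g \<in> P"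
    and lim: "\<And>f. f \<in> carrier T \<Longrightarrow> (\<And>N. \<exists>g\<in>P. fps_agree N f g) \<Longrightarrow> f \<in> P"
  shows "gam (Suc n) \<subseteq> P"
proof
  fix f assume f: "f \<in> gam (Suc n)"
  have "commutator_subgroup T (gam n) (carrier T) \<subseteq> P"
    unfolding commutator_subgroup_eq using comm by (intro T.generate_subgroup_incl[OF _ P]) blast
  thus "f \<in> P" using f lim unfolding mem_gam_Suc_iff by blast
qed

lemma lam_agree:
  assumes "fps_agree e U (V :: 'a fps)"
  shows "lam U e = lam V e"
proof -
  have *: "fps_agree e (fps_red (lift U) - 1 :: rat fps) (fps_red (lift V) - 1)"
    using assms by (simp add: fps_agree_def lift_def)
  show ?thesis using fps_agree_power[OF *] unfolding lam_def plog_def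
    by (simp add: fps_compose_nth fps_agree_def)
qed

text \<open>Whether e is an exponent depends only on the coefficients of f up to degree q e + 1, so
  the condition passes to t-adic limits.\<close>

lemma exps_in_limit:
  assumes "f \<in> carrier T" "\<And>N. \<exists>g\<in>exps_in A. fps_agree N f g"
  shows "f \<in> exps_in A"
proof -
  have "e \<in> A" if "e \<in> exps f" for e
  proof -
    obtain g where g: "g \<in> exps_in A" "fps_agree (q * e + 1) f g" using assms(2) by blast
    have "fps_agree e (unit_part f) (unit_part g)"
      using g(2) by (auto simp: fps_agree_def unit_part_def)
    hence "e \<in> exps g" using that lam_agree by (auto simp: exps_def)
    thus ?thesis using g(1) by (auto simp: exps_in_def)
  qed
  thus ?thesis using assms(1) by (auto simp: exps_in_def)
qed

section \<open>Valuations under the moves\<close>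

abbreviation val :: "nat \<Rightarrow> nat" where "val \<equiv> multiplicity p"

text \<open>With a >= r the valuation of p^a e + q k can become arbitrarily large; the truncated
  valuation grows by at most a under a move.\<close>

definition sig :: "nat \<Rightarrow> nat" where "sig e = min (val e) r"

lemma power_val_dvd: "p ^ val e dvd e"
  by (rule multiplicity_dvd)

lemma val_eqI: "p ^ s dvd e \<Longrightarrow> \<not> p ^ Suc s dvd e \<Longrightarrow> val e = s"
  by (rule multiplicity_eqI)

lemma not_power_Suc_val_dvd: "e > 0 \<Longrightarrow> \<not> p ^ Suc (val e) dvd e"
  using p_gt_2 by (subst power_dvd_iff_le_multiplicity) auto

lemma power_dvd_iff: "e > 0 \<Longrightarrow> p ^ n dvd e \<longleftrightarrow> n \<le> val e"
  using p_gt_2 by (subst power_dvd_iff_le_multiplicity) auto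

lemma val_power_mult: "e > 0 \<Longrightarrow> val (p ^ a * e) = a + val e"
  using prime_p p_gt_2 by (simp add: prime_elem_multiplicity_mult_distrib)

lemma val_add:
  assumes "e > 0" "p ^ Suc (val e) dvd x"
  shows "val (e + x) = val e"
proof (rule val_eqI)
  have "p ^ val e dvd x" using assms(2) by (metis dvd_trans le_imp_power_dvd lessI less_imp_le)
  thus "p ^ val e dvd e + x" using power_val_dvd by (rule dvd_add[rotated])
  show "\<not> p ^ Suc (val e) dvd e + x"
    using not_power_Suc_val_dvd[OF assms(1)] assms(2) dvd_add_left_iff by blast
qed

lemma val_add_eq_less:
  assumes "e > 0" "p ^ s dvd x" "val (e + x) < s"
  shows "val e = val (e + x)"
proof -
  define t where "t = val (e + x)"
  have x: "p ^ t dvd x" "p ^ Suc t dvd x" using assms(2,3) unfolding t_def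
    by (meson dvd_trans le_imp_power_dvd less_imp_le Suc_leI)+
  show ?thesis unfolding t_def [symmetric]
  proof (rule val_eqI)
    show "p ^ t dvd e" using power_val_dvd[of "e + x"] x(1) unfolding t_def [symmetric]
      using dvd_add_left_iff by blast
    show "\<not> p ^ Suc t dvd e" using not_power_Suc_val_dvd[of "e + x"] x(2) assms(1) unfolding t_def [symmetric]
      using dvd_add_left_iff by blast
  qed
qed

lemma q_mult_dvd:
  assumes "p ^ v dvd k"
  shows "p ^ (r + v) dvd q * k" "p ^ Suc v dvd q * k"
proof -
  show *: "p ^ (r + v) dvd q * k" using assms unfolding q_def power_add by (intro mult_dvd_mono) auto
  have "p ^ Suc v dvd p ^ (r + v)" using r_pos by (intro le_imp_power_dvd) simp
  thus "p ^ Suc v dvd q * k" using * by (rule dvd_trans)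
qed

lemma sig_add:
  assumes "e > 0" "p ^ val e dvd k"
  shows "sig (e + q * k) = sig e"
proof (cases "val e < r")
  case True
  thus ?thesis using val_add[OF assms(1) q_mult_dvd(2)[OF assms(2)]] by (simp add: sig_def)
next
  case False
  have "p ^ r dvd e" using False assms(1) power_dvd_iff by simp
  moreover have "p ^ r dvd q * k" by (simp add: q_def)
  ultimately have "p ^ r dvd e + q * k" by (rule dvd_add)
  hence "r \<le> val (e + q * k)" using assms(1) power_dvd_iff by simp
  thus ?thesis using False by (simp add: sig_def)
qed

lemma power_p_mono: "a \<le> b \<Longrightarrow> p ^ a \<le> p ^ b"
  using p_gt_2 by (intro power_increasing) auto

lemma power_val_le: "k > 0 \<Longrightarrow> p ^ val e dvd k \<Longrightarrow> p ^ sig e \<le> k"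
  by (meson dvd_imp_le le_trans min.cobounded1 power_p_mono sig_def[THEN eq_refl])

lemma p_power_pos: "p ^ a > 0"
  using p_gt_2 by simp

lemma p_power_mult_ge: "e \<le> p ^ a * e"
  using mult_le_mono1[of 1 "p ^ a" e] p_power_pos[of a] by (simp add: Suc_le_eq)

lemma p_power_mult_ge_p: "a > 0 \<Longrightarrow> p * e \<le> p ^ a * e"
  using power_p_mono[of 1 a] by (intro mult_le_mono1) simp

section \<open>Commutators with \<open>elem m\<close>\<close>

definition depth_layer :: "nat \<Rightarrow> nat \<Rightarrow> nat set" where
  "depth_layer d m = {f. p * d \<le> f \<or> d + p ^ sig f * q * m \<le> f}"

lemma depth_layer_ge: "f \<in> depth_layer d m \<Longrightarrow> d \<le> f"
  using p_power_mult_ge[of d 1] unfolding depth_layer_def mem_Collect_eq power_one_right by linarith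

lemma admissible_depth_layer: "admissible (depth_layer d m)"
  unfolding admissible_def
proof (intro ballI impI allI)
  fix e a k assume e: "e \<in> depth_layer d m" "e > 0" "p ^ val e dvd k"
  show "p ^ a * e + q * k \<in> depth_layer d m"
  proof (cases "a = 0")
    case True
    thus ?thesis using e sig_add[OF e(2,3)] by (auto simp: depth_layer_def)
  next
    case False
    hence "p * d \<le> p ^ a * e" using depth_layer_ge[OF e(1)] p_power_mult_ge_p[of a e]
      by (meson gr0I le_trans mult_le_mono2)
    thus ?thesis by (simp add: depth_layer_def)
  qed
qed

lemma one_minus_X_power_nth: "((1 - fps_X :: int fps) ^ d) $ k = (-1) ^ k * int (d choose k)"
proof (induction d arbitrary: k)
  case 0
  thus ?case by (cases k) auto
next
  case (Suc d)
  have "(1 - fps_X :: int fps) ^ Suc d = (1 - fps_X) ^ d - fps_X * (1 - fps_X) ^ d"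
    by (simp add: algebra_simps)
  thus ?case by (cases k) (simp_all add: Suc algebra_simps)
qed

text \<open>For d = p^v d' with d' prime to p, this coefficient has the valuation of d'. It supplies
  the coefficient of (1 - x)^d that makes a commutator nontrivial at the intended exponent.\<close>

lemma not_dvd_choose:
  assumes "d > 0"
  shows "\<not> p dvd d choose (p ^ val d)"
proof -
  obtain d' where d': "d = p ^ val d * d'" "\<not> p dvd d'"
    using multiplicity_decompose'[of d p] assms prime_p by (metis neq0_conv not_prime_unit)
  have d0: "d' > 0" using d' assms by (metis gr0I mult_0_right)
  have "val (d choose (p ^ val d)) = val d'"
    using const_p_fac[OF d0 prime_p, of "val d"] d'(1) by simp
  also have "\<dots> = 0" using d' by (simp add: not_dvd_imp_multiplicity_0)
  finally have v: "val (d choose (p ^ val d)) = 0" .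
  have "p ^ val d \<le> d" using d' d0 by (metis One_nat_def Suc_leI mult.right_neutral mult_le_mono2)
  hence "d choose (p ^ val d) > 0" by simp
  thus ?thesis using v power_dvd_iff[of "d choose (p ^ val d)" 1] by simp
qed

text \<open>The first alternative in \<open>depth_layer\<close> absorbs the moves with a > 0 and the
  half \<open>elem m\<close> o U, which is unchanged up to q d >= p d. A move with a = 0 preserves
  \<open>sig\<close> and adds q m k, where k is a positive multiple of p ^ val e0; this is the
  second alternative.\<close>

lemma exps_commut_elem_subset_depth_layer:
  assumes U: "U \<in> carrier T" "depth_ge (unit_part U) d" and m: "m > 0"
  shows "exps (commut U (elem m)) \<subseteq> depth_layer d m"
proof (rule exps_commut_subset[OF U(1) _ admissible_depth_layer])
  fix e assume e: "e > 0" "e \<notin> depth_layer d m"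
  have "\<not> reaches m e0 e" if e0: "e0 \<in> exps U" for e0
  proof
    assume "reaches m e0 e"
    then obtain a k where k: "k > 0" "p ^ val e0 dvd k" "e = p ^ a * e0 + q * m * k"
      unfolding reaches_def by blast
    have e0d: "d \<le> e0" "e0 > 0" using e0 depth_geD[OF U] exps_pos by auto
    show False
    proof (cases "a = 0")
      case True
      hence ee: "e = e0 + q * (m * k)" using k by simp
      have "sig e = sig e0" unfolding ee by (rule sig_add[OF e0d(2)]) (simp add: k dvd_mult)
      hence "p ^ sig e * (q * m) \<le> k * (q * m)"
        using power_val_le[OF k(1,2)] by (intro mult_le_mono1) simp
      hence "p ^ sig e * q * m \<le> q * (m * k)" by (simp only: mult_ac)
      hence "d + p ^ sig e * q * m \<le> e" using e0d(1) ee by linarith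
      thus False using e by (simp add: depth_layer_def)
    next
      case False
      hence "p * d \<le> p ^ a * e0" using e0d(1) p_power_mult_ge_p[of a e0]
        by (meson gr0I le_trans mult_le_mono2)
      thus False using e k by (simp add: depth_layer_def)
    qed
  qed
  thus "lam (unit_part U oo elem m) e \<approx>\<^sub>p lam (unit_part U) e"
    using U m by (intro lam_compose_elem_unreachable) auto
  show "lam (unit_part (elem m) oo U) e \<approx>\<^sub>p lam (unit_part (elem m)) e"
  proof (rule lam_compose_carrier_low)
    fix e0 assume "e0 \<in> exps U"
    hence "d \<le> e0" using depth_geD[OF U] by blast
    moreover have "p \<le> q" using p_dvd_q q_gt_2 by (intro dvd_imp_le) auto
    ultimately have "p * d \<le> q * e0" by (intro mult_le_mono)
    thus "e \<le> q * e0" using e by (simp add: depth_layer_def)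
  qed (use U m in auto)
qed (use m in simp)

text \<open>D is least in the layer among elements of its truncated valuation. As D < p d, a move to
  D inside the layer has a = 0, so it would start at a smaller element of the same truncated
  valuation. The last claim lets elements built from larger depths be used for elimination without
  disturbing D.\<close>

lemma depth_layer_step:
  assumes D: "D = d + p ^ val d * q * m" and d: "d > 0" "val d \<le> r" and m: "m > 0"
    and lt: "D < p * d"
  shows "val D = val d" "sig D = val d" "D \<in> depth_layer d m" "admissible (depth_layer d m - {D})"
    "\<And>d'. d < d' \<Longrightarrow> D \<notin> depth_layer d' m"
proof -
  have "D = d + q * (p ^ val d * m)" using D by simp
  thus v: "val D = val d" using val_add[OF d(1)] q_mult_dvd(2)[of "val d" "p ^ val d * m"] by simp
  thus s: "sig D = val d" using d by (simp add: sig_def)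
  thus "D \<in> depth_layer d m" using D by (simp add: depth_layer_def)
  show "D \<notin> depth_layer d' m" if "d < d'" for d'
  proof -
    have "p * d < p * d'" using that p_gt_2 by simp
    thus ?thesis using D that lt unfolding depth_layer_def mem_Collect_eq s by linarith
  qed
  show "admissible (depth_layer d m - {D})"
    unfolding admissible_def
  proof (intro ballI impI allI)
    fix e a k assume e: "e \<in> depth_layer d m - {D}" "e > 0" "p ^ val e dvd k"
    have "p ^ a * e + q * k \<noteq> D"
    proof
      assume eq: "p ^ a * e + q * k = D"
      have "d \<le> e" using e depth_layer_ge by blast
      have "a = 0"
      proof (rule ccontr)
        assume "a \<noteq> 0"
        hence "p * d \<le> p ^ a * e" using \<open>d \<le> e\<close> p_power_mult_ge_p[of a e]
          by (meson gr0I le_trans mult_le_mono2)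
        thus False using eq lt by simp
      qed
      hence "sig e = val d" using eq sig_add[OF e(2,3)] s by simp
      moreover have "e < p * d" using eq lt \<open>a = 0\<close> by simp
      ultimately have "D \<le> e" using e D by (auto simp: depth_layer_def)
      thus False using eq e \<open>a = 0\<close> by simp
    qed
    thus "p ^ a * e + q * k \<in> depth_layer d m - {D}"
      using e admissible_depth_layer[of d m] unfolding admissible_def by blast
  qed
qed

text \<open>Only the exponent d contributes at D, namely the leading coefficient of U times (d
  choose p ^ val d) up to sign. Any other contributing exponent would have a = 0 and the valuation
  of d, so it would start later and add at least as much.\<close>

lemma mem_exps_commut_elem:
  assumes U: "U \<in> carrier T" "depth_at U d" and m: "m > 0" and vd: "val d \<le> r"
    and D: "D = d + p ^ val d * q * m" and lt: "D < p * d"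
  shows "D \<in> exps (commut U (elem m))"
proof -
  have d: "d > 0" "depth_ge (unit_part U) d" and dU: "d \<in> exps U"
    using U depth_at_iff by (auto simp: depth_at_def)
  note step = depth_layer_step[OF D d(1) vd m lt]
  note layer = exps_commut_elem_subset_depth_layer[OF U(1) d(2) m]
  have 0: "lam (unit_part (commut U (elem m))) D \<approx>\<^sub>p
    (lam (unit_part U oo elem m) D - lam (unit_part U) D) -
    (lam (unit_part (elem m) oo U) D - lam (unit_part (elem m)) D)"
  proof (rule lam_commut)
    fix e0 assume e0: "e0 \<in> exps (commut U (elem m))"
    hence pos: "e0 > 0" by (rule exps_pos)
    show "\<not> reaches 1 e0 D"
    proof
      assume R: "reaches 1 e0 D"
      hence "e0 \<noteq> D" using reaches_gt[OF pos _ R] by simp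
      hence "D \<in> depth_layer d m - {D}" using admissibleD[OF step(4) _ pos R] e0 layer by blast
      thus False by simp
    qed
  qed (use U m in auto)
  have "lam (unit_part (elem m) oo U) D \<approx>\<^sub>p lam (unit_part (elem m)) D"
  proof (rule lam_compose_carrier_low)
    fix e0 assume "e0 \<in> exps U"
    hence "d \<le> e0" using depth_geD[OF U(1) d(2)] by blast
    moreover have "p \<le> q" using p_dvd_q q_gt_2 by (intro dvd_imp_le) auto
    ultimately have "p * d \<le> q * e0" by (intro mult_le_mono)
    thus "D \<le> q * e0" using lt by simp
  qed (use U m in auto)
  from pz_diff[OF 0 this] have 1: "lam (unit_part (commut U (elem m))) D \<approx>\<^sub>p
      lam (unit_part U oo elem m) D - lam (unit_part U) D" by (simp add: algebra_simps)
  define F P where "F = lift (unit_part U)" and "P = (1 - fps_X) oo (fps_X ^ m :: int fps)"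
  have F0: "F $ 0 = 1" and P0: "P $ 0 = 1" using U m by (simp_all add: F_def P_def lift_0)
  have P: "P = 1 - fps_X ^ m" using m by (simp add: P_def fps_compose_sub_distrib)
  let ?t = "\<lambda>i. plog F $ i * of_int ((P ^ i) $ ((D - i) div q))"
  let ?S = "{i. i < D \<and> q dvd (D - i)}"
  have "lam (unit_part U oo elem m) D \<approx>\<^sub>p plog F $ D + (\<Sum>i\<in>?S. ?t i)"
    using lam_compose_subst_series[OF F0 P0] by (simp add: F_def P elem_def fps_red_diff fps_red_power)
  hence 2: "lam (unit_part U oo elem m) D \<approx>\<^sub>p lam (unit_part U) D + (\<Sum>i\<in>?S. ?t i)"
    by (simp add: F_def lam_def)
  have Dd: "(D - d) div q = m * p ^ val d" using D q_gt_2 by (simp add: mult_ac)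
  have dS: "d \<in> ?S" using D m q_gt_2 p_gt_2 by auto
  have "(\<Sum>i\<in>?S. ?t i) = ?t d + (\<Sum>i\<in>?S - {d}. ?t i)" using dS by (intro sum.remove) auto
  moreover have 4: "(\<Sum>i\<in>?S - {d}. ?t i) \<in> pz p"
  proof (intro pz_sum, rule ccontr)
    fix i assume i: "i \<in> ?S - {d}" and nz: "?t i \<notin> pz p"
    note j = sub_dvd_obtain[of i D]
    have "lam (unit_part U) i * of_int ((((1 - fps_X) oo fps_X ^ m) ^ i) $ ((D - i) div q)) \<notin> pz p"
      using nz by (simp add: F_def P_def lam_def)
    then obtain a e0 k where e0: "i = p ^ a * e0" "e0 > 0" "lam (unit_part U) e0 \<notin> pz p" "k > 0"
        "(D - i) div q = m * k" "p ^ val e0 dvd k"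
      using lam_mult_compose_power_nth_support[OF unit_part_0[OF U(1)] m] i j(2)
      by (metis (no_types, lifting) DiffD1 mem_Collect_eq)
    have "D = i + q * (m * k)" using j(1) i unfolding e0(5) [symmetric] by blast
    hence De: "D = p ^ a * e0 + q * (m * k)" by (simp add: e0(1))
    have e0d: "d \<le> e0" using e0 depth_geD[OF U(1) d(2), of e0] by (simp add: exps_def)
    have a: "a = 0"
    proof (rule ccontr)
      assume "a \<noteq> 0"
      hence "p * d \<le> p ^ a * e0" using e0d p_power_mult_ge_p[of a e0]
        by (meson gr0I le_trans mult_le_mono2)
      thus False using De lt by simp
    qed
    hence "e0 > d" using e0 e0d i by auto
    have "val D = val e0" using val_add[OF e0(2) q_mult_dvd(2)[of "val e0" "m * k"]] De a e0(6) by simp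
    hence "p ^ val d \<le> k" using e0 step(1) by (auto intro: dvd_imp_le)
    hence "q * m * p ^ val d \<le> q * m * k" by (rule mult_le_mono2)
    hence "p ^ val d * q * m \<le> q * (m * k)" by (simp only: mult_ac)
    moreover have "D = e0 + q * (m * k)" using De a by simp
    ultimately show False using D \<open>e0 > d\<close> by linarith
  qed
  ultimately have 3: "lam (unit_part (commut U (elem m))) D \<approx>\<^sub>p ?t d"
    using pz_add[OF pz_add[OF 1 2] 4] by (simp add: algebra_simps)
  have "?t d = of_int (lift (unit_part U) $ d * ((-1) ^ p ^ val d * int (d choose p ^ val d)))"
  proof -
    have "plog F $ d = of_int (lift (unit_part U) $ d)"
      using lam_of_depth_ge[of "unit_part U" d d] U(1) d by (simp add: F_def lam_def)
    moreover have "(P ^ d) $ ((D - d) div q) = (-1) ^ p ^ val d * int (d choose p ^ val d)"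
      unfolding Dd P_def compose_X_power_power_nth[OF m] using m by (simp add: one_minus_X_power_nth)
    ultimately show ?thesis by simp
  qed
  also have "\<dots> \<notin> pz p"
  proof -
    have "\<not> int p dvd lift (unit_part U) $ d" using U(2) by (simp add: depth_at_def lift_nth_dvd_iff)
    moreover have "\<not> int p dvd (-1) ^ p ^ val d * int (d choose p ^ val d)"
      using not_dvd_choose[OF d(1)] by (simp add: minus_one_power_iff)
    ultimately show ?thesis using prime_int_p by (simp only: of_int_pz_iff prime_dvd_mult_iff simp_thms)
  qed
  finally show ?thesis using 3 cong_pz_mem by (auto simp: exps_def)
qed

text \<open>
  The commutator of an element of depth \<open>d\<close> with \<open>elem m\<close> has the exponent
  \<open>d + p ^ val d * q * m\<close>; its smaller exponents have smaller valuation and are removed by induction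
  on the valuation. The bound on \<open>m\<close> keeps them below \<open>p * d\<close>.
\<close>

lemma ex_commut_elem_depth:
  assumes H: "subgroup H T" and N: "N \<subseteq> carrier T" and m: "0 < m" "m < 2 * (n + 1)"
    and N_depth: "\<And>e. d0 \<le> e \<Longrightarrow> val e \<le> r \<Longrightarrow> p ^ val e * q * (n + 1) \<le> e \<Longrightarrow> \<exists>U\<in>N. depth_at U e"
    and comm: "\<And>U. U \<in> N \<Longrightarrow> depth_ge (unit_part U) d0 \<Longrightarrow> commut U (elem m) \<in> H"
    and d: "d0 \<le> d" "val d \<le> r" "p ^ val d * q * (n + 1) \<le> d"
  shows "\<exists>X\<in>H. depth_at X (d + p ^ val d * q * m) \<and> exps X \<subseteq> depth_layer d m"
  using d
proof (induction "val d" arbitrary: d rule: less_induct)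
  case less
  define D where "D = d + p ^ val d * q * m"
  have "0 < p ^ val d * q * (n + 1)" using p_gt_2 q_gt_2 by simp
  hence d0: "d > 0" using less.prems by linarith
  have "p ^ val d * q * m < p ^ val d * q * (2 * (n + 1))"
    using m p_gt_2 q_gt_2 by (intro mult_strict_left_mono) auto
  \<comment> \<open>D < 3 d <= p d: the assumption p > 2 enters here, too.\<close>
  hence "D < d + 2 * d" using less.prems unfolding D_def by (simp add: algebra_simps)
  also have "\<dots> \<le> p * d" using p_gt_2 mult_le_mono1[of 3 p d] by simp
  finally have lt: "D < p * d" .
  note step = depth_layer_step[OF D_def d0 less.prems(2) m(1) lt]
  obtain U where U: "U \<in> N" "depth_at U d" using N_depth less.prems by blast
  have UT: "U \<in> carrier T" using U N by blast
  have dU: "depth_ge (unit_part U) d" using U by (simp add: depth_at_def)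
  hence "depth_ge (unit_part U) d0" using less.prems(1) by (auto simp: depth_ge_def)
  define W where "W = commut U (elem m)"
  have W: "W \<in> H" using comm[OF U(1)] \<open>depth_ge (unit_part U) d0\<close> by (simp add: W_def)
  have ins: "insert D (depth_layer d m - {D}) = depth_layer d m" using step(3) by blast
  have "\<exists>Z\<in>H. depth_at Z D \<and> exps Z \<subseteq> insert D (depth_layer d m - {D})"
  proof (rule eliminate_lower_exps[OF H step(4) _ _ W])
    show "admissible (insert D (depth_layer d m - {D}))" unfolding ins by (rule admissible_depth_layer)
    show "exps W \<subseteq> insert D (depth_layer d m - {D})"
      unfolding ins W_def by (rule exps_commut_elem_subset_depth_layer[OF UT dU m(1)])
    show "D \<in> exps W"
      unfolding W_def by (rule mem_exps_commut_elem[OF UT U(2) m(1) less.prems(2) D_def lt])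
    fix f assume f: "f \<in> depth_layer d m - {D}" "0 < f" "f < D"
    define s where "s = sig f"
    have fs: "d + p ^ s * q * m \<le> f" using f lt by (auto simp: depth_layer_def s_def)
    have "s < val d"
    proof (rule ccontr)
      assume "\<not> s < val d"
      hence "p ^ val d * q * m \<le> p ^ s * q * m" by (intro mult_le_mono1 power_p_mono) simp
      thus False using fs f(3) unfolding D_def by linarith
    qed
    hence vf: "val f = s" using less.prems(2) by (auto simp: s_def sig_def)
    \<comment> \<open>The depth from which f itself is obtained. Its valuation is s because p^(s +
      1) divides the raise p^s q m.\<close>
    define d' where "d' = f - p ^ s * q * m"
    have d': "f = d' + p ^ s * q * m" "d \<le> d'" using fs by (auto simp: d'_def)
    have "p ^ Suc s dvd p ^ s * q * m" using q_mult_dvd(2)[of s "p ^ s * m"] by (simp add: mult_ac)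
    hence vd': "val d' = s" using val_add_eq_less[of d' "Suc s" "p ^ s * q * m"] vf d' d0 by simp
    have "p ^ s * q * (n + 1) \<le> p ^ val d * q * (n + 1)"
      using \<open>s < val d\<close> by (intro mult_le_mono1 power_p_mono) simp
    hence "p ^ s * q * (n + 1) \<le> d'" using less.prems(3) d'(2) by linarith
    then obtain X where X: "X \<in> H" "depth_at X f" "exps X \<subseteq> depth_layer d' m"
      using less.hyps[of d'] vd' \<open>s < val d\<close> less.prems d' by auto
    have "d < d'" using vd' \<open>s < val d\<close> d'(2) by (metis le_neq_implies_less less_irrefl)
    moreover have "depth_layer d' m \<subseteq> depth_layer d m"
      using d'(2) by (auto simp: depth_layer_def dest: le_trans[OF mult_le_mono2])
    ultimately show "\<exists>X\<in>H. depth_at X f \<and> exps X \<subseteq> depth_layer d m - {D}"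
      using X step(5)[of d'] by blast
  qed auto
  thus ?case unfolding ins unfolding D_def .
qed

lemma ex_depth_in_gam:
  assumes "val e \<le> r" "p ^ val e * q * (n + 1) \<le> e"
  shows "\<exists>U\<in>gam n. depth_at U e"
  using assms
proof (induction n arbitrary: e)
  case 0
  have "0 < p ^ val e * q" using p_gt_2 q_gt_2 by simp
  moreover have "p ^ val e * q \<le> e" using 0 by simp
  ultimately have "e > 0" by linarith
  hence "depth_at (elem e) e"
    by (simp add: depth_at_def elem_def depth_ge_def)
  thus ?case using \<open>e > 0\<close> by auto
next
  case (Suc n)
  \<comment> \<open>One commutator step below e; the valuation is the same because p times p ^ val e
    divides the raise.\<close>
  define d where "d = e - p ^ val e * q"
  have de: "e = d + p ^ val e * q * 1" using Suc.prems by (simp add: d_def)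
  have le: "p ^ val e * q * (n + 1) \<le> d" using Suc.prems by (simp add: d_def algebra_simps)
  moreover have "0 < p ^ val e * q * (n + 1)" using p_gt_2 q_gt_2 by simp
  ultimately have d0: "d > 0" by linarith
  have "p ^ Suc (val e) dvd p ^ val e * q" using q_mult_dvd(2)[of "val e" "p ^ val e"] by (simp add: mult_ac)
  hence vd: "val d = val e"
    using val_add_eq_less[of d "Suc (val e)" "p ^ val e * q"] de d0 by simp
  have "\<exists>X\<in>gam (Suc n). depth_at X (d + p ^ val d * q * 1) \<and> exps X \<subseteq> depth_layer d 1"
    by (rule ex_commut_elem_depth[where N = "gam n" and n = n and ?d0.0 = 0])
       (use Suc le vd subgroup_gam gam_subset commut_in_gam in \<open>auto simp del: lower_central.simps\<close>)
  thus ?case unfolding vd de [symmetric] by blast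
qed

section \<open>Lower bounds for the exponents in the lower central series\<close>

definition gam_exps :: "nat \<Rightarrow> nat set" where
  "gam_exps n = {e. p ^ sig e * q * (n - sig e) \<le> e}"

lemma sig_power_mult_le: "e > 0 \<Longrightarrow> p ^ val e dvd k \<Longrightarrow>
    sig (p ^ a * e + q * k) = sig e \<or> sig e < sig (p ^ a * e + q * k) \<and> sig (p ^ a * e + q * k) \<le> a + sig e"
proof -
  assume e: "e > 0" "p ^ val e dvd k"
  define f where "f = p ^ a * e + q * k"
  have f0: "f > 0" using e p_gt_2 by (simp add: f_def)
  have dv: "p ^ sig e dvd f"
  proof -
    have "p ^ sig e dvd p ^ val e" by (intro le_imp_power_dvd) (simp add: sig_def)
    thus ?thesis using e(2) power_val_dvd[of e] unfolding f_def
      by (meson dvd_add dvd_mult dvd_trans)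
  qed
  hence ge: "sig e \<le> sig f" using power_dvd_iff[OF f0] by (simp add: sig_def)
  have "sig f \<le> a + sig e"
  proof (cases "a + val e < r")
    case True
    have "val f = val (p ^ a * e)" unfolding f_def
    proof (rule val_add)
      have "p ^ (r + val e) dvd q * k" by (rule q_mult_dvd(1)[OF e(2)])
      moreover have "Suc (val (p ^ a * e)) \<le> r + val e" using True e by (simp add: val_power_mult)
      ultimately show "p ^ Suc (val (p ^ a * e)) dvd q * k" by (meson dvd_trans le_imp_power_dvd)
    qed (use e p_gt_2 in simp)
    thus ?thesis using True e by (simp add: sig_def val_power_mult)
  next
    case False
    thus ?thesis by (auto simp: sig_def)
  qed
  thus "sig f = sig e \<or> sig e < sig f \<and> sig f \<le> a + sig e" using ge by auto
qed

text \<open>This explains the defect in n - s. A move with k > 0 that preserves s adds at least p^s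
  q, one step in n. A move that raises s to t may spend its factor p^a entirely on passing from p^s
  to p^t, but then n + 1 - t <= n - s makes up for the missing step.\<close>

lemma gam_exps_reach:
  assumes e: "e \<in> gam_exps n" "e > 0" "p ^ val e dvd k"
  shows "p ^ a * e + q * k \<in> gam_exps n" "k > 0 \<Longrightarrow> p ^ a * e + q * k \<in> gam_exps (Suc n)"
proof -
  define f where "f = p ^ a * e + q * k"
  define s where "s = sig e"
  define t where "t = sig f"
  have en: "p ^ s * q * (n - s) \<le> e" using e by (simp add: gam_exps_def s_def)
  have ef: "e \<le> p ^ a * e" by (rule p_power_mult_ge)
  have cs: "t = s \<or> s < t \<and> t \<le> a + s"
    using sig_power_mult_le[OF e(2,3), of a] by (simp add: s_def t_def f_def)
  have up: "p ^ t * q * (n - s) \<le> f" if "t \<le> a + s"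
  proof -
    have "p ^ t * q * (n - s) \<le> p ^ (a + s) * q * (n - s)"
      using that by (intro mult_le_mono1 power_p_mono)
    also have "\<dots> = p ^ a * (p ^ s * q * (n - s))" by (simp add: power_add)
    also have "\<dots> \<le> p ^ a * e" using en by (rule mult_le_mono2)
    finally show ?thesis by (simp add: f_def)
  qed
  have mono: "p ^ t * q * (n' - t) \<le> p ^ t * q * (n - s)" if "n' - t \<le> n - s" for n'
    using that by (rule mult_le_mono2)
  show "p ^ a * e + q * k \<in> gam_exps n"
  proof -
    have "t \<le> a + s" "n - t \<le> n - s" using cs by auto
    hence "p ^ t * q * (n - t) \<le> f" using up mono[of n] by linarith
    thus ?thesis by (simp add: gam_exps_def t_def f_def)
  qed
  show "p ^ a * e + q * k \<in> gam_exps (Suc n)" if k: "k > 0"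
  proof -
    have "p ^ t * q * (Suc n - t) \<le> f"
    proof (cases "t = s")
      case True
      have "p ^ s \<le> k" using power_val_le[OF k e(3)] by (simp add: s_def)
      hence "p ^ s * q \<le> q * k" using mult_le_mono2[of "p ^ s" k q] by (simp add: mult.commute)
      moreover have "p ^ s * q * (Suc n - s) \<le> p ^ s * q * (n - s) + p ^ s * q"
        by (cases "s \<le> n") (auto simp: Suc_diff_le)
      ultimately show ?thesis using en ef unfolding f_def True by linarith
    next
      case False
      hence "t \<le> a + s" "Suc n - t \<le> n - s" using cs by auto
      thus ?thesis using up mono[of "Suc n"] by linarith
    qed
    thus ?thesis by (simp add: gam_exps_def t_def f_def)
  qed
qed

lemma admissible_gam_exps: "admissible (gam_exps n)"
  unfolding admissible_def using gam_exps_reach(1) by blast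

text \<open>Needed for the half g o f of a commutator, which f affects only beyond q times its least
  exponent. A factor q outweighs any change of truncated valuation: for s < n one has n <= (s + 1)
  (n - s) <= p^s (n - s), hence q n <= e0.\<close>

lemma gam_exps_gap:
  assumes e0: "e0 \<in> gam_exps n" "e0 > 0" and e: "q * e0 < e"
  shows "e \<in> gam_exps (Suc n)"
proof -
  define s t where "s = sig e0" and "t = sig e"
  have le: "p ^ s * q * (n - s) \<le> e0" using e0 by (simp add: gam_exps_def s_def)
  have tr: "t \<le> r" by (simp add: t_def sig_def)
  have exp: "i + 1 \<le> p ^ i" for i using power_gt_expt[of p i] p_gt_2 by simp
  have "p ^ t * (Suc n - t) \<le> e0"
  proof (cases "s < n")
    case True
    have "(s + 1) * (n - s) = s * (n - s) + (n - s)" by (simp only: add_mult_distrib mult_1)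
    moreover have "s \<le> s * (n - s)" using mult_le_mono2[of 1 "n - s" s] True by linarith
    ultimately have "n \<le> (s + 1) * (n - s)" using True by linarith
    also have "\<dots> \<le> p ^ s * (n - s)" using exp by (rule mult_le_mono1)
    finally have "q * n \<le> q * (p ^ s * (n - s))" by (rule mult_le_mono2)
    also have "\<dots> = p ^ s * q * (n - s)" by (simp only: mult_ac)
    finally have qn: "q * n \<le> e0" using le by linarith
    show ?thesis
    proof (cases "t = 0")
      case True
      have "Suc n \<le> 2 * n" using \<open>s < n\<close> by simp
      also have "\<dots> \<le> q * n" using q_gt_2 by (intro mult_le_mono1) simp
      finally show ?thesis using True qn by simp
    next
      case False
      hence "p ^ t * (Suc n - t) \<le> p ^ t * n" by (intro mult_le_mono2) simp
      also have "\<dots> \<le> q * n" unfolding q_def using tr by (intro mult_le_mono1 power_p_mono)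
      finally show ?thesis using qn by simp
    qed
  next
    case False
    \<comment> \<open>Here n - s = 0 and the hypothesis on e0 is void; divisibility of e0 by p^s
      takes its place.\<close>
    have "p ^ n \<le> p ^ s" using False by (intro power_p_mono) simp
    also have "\<dots> \<le> e0" unfolding s_def by (rule power_val_le[OF e0(2) power_val_dvd])
    finally have "p ^ n \<le> e0" .
    moreover have "p ^ t * (Suc n - t) \<le> p ^ n"
    proof (cases "t \<le> n")
      case True
      have "p ^ t * (Suc n - t) \<le> p ^ t * p ^ (n - t)" using exp[of "n - t"] True
        by (intro mult_le_mono2) (simp add: Suc_diff_le)
      thus ?thesis using True by (simp flip: power_add)
    qed simp
    ultimately show ?thesis by simp
  qed
  hence "q * (p ^ t * (Suc n - t)) \<le> q * e0" by (rule mult_le_mono2)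
  moreover have "q * (p ^ t * (Suc n - t)) = p ^ t * q * (Suc n - t)" by (simp only: mult_ac)
  ultimately have "p ^ t * q * (Suc n - t) \<le> e" using e by linarith
  thus ?thesis by (simp add: gam_exps_def t_def)
qed

lemma gam_subset_exps_in: "gam n \<subseteq> exps_in (gam_exps n)"
proof (induction n)
  case 0
  show ?case by (auto simp: exps_in_def gam_exps_def)
next
  case (Suc n)
  show ?case
  proof (rule gam_Suc_least[OF subgroup_exps_in[OF admissible_gam_exps] _ exps_in_limit])
    fix f g assume f: "f \<in> gam n" and g: "g \<in> carrier T"
    have fT: "f \<in> carrier T" and fe: "exps f \<subseteq> gam_exps n" using f Suc by (auto simp: exps_in_def)
    have "exps (commut f g) \<subseteq> gam_exps (Suc n)"
    proof (rule exps_commut_subset[OF fT g admissible_gam_exps])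
      fix e assume e: "e > 0" "e \<notin> gam_exps (Suc n)"
      show "lam (unit_part f oo g) e \<approx>\<^sub>p lam (unit_part f) e"
      proof (rule lam_compose_carrier_unreachable)
        fix e0 assume e0: "e0 > 0" "lam (unit_part f) e0 \<notin> pz p"
        hence "e0 \<in> gam_exps n" using fe by (auto simp: exps_def)
        thus "\<not> reaches 1 e0 e" using e e0 gam_exps_reach(2) unfolding reaches_def
          by (metis mult.right_neutral)
      qed (use fT g in auto)
      show "lam (unit_part g oo f) e \<approx>\<^sub>p lam (unit_part g) e"
      proof (rule lam_compose_carrier_low[OF g fT])
        fix e0 assume "e0 \<in> exps f"
        thus "e \<le> q * e0" using gam_exps_gap[of e0 n e] fe e exps_pos by (meson not_le subsetD)
      qed
    qed
    thus "commut f g \<in> exps_in (gam_exps (Suc n))" using fT g by (simp add: exps_in_def)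
  qed
qed

section \<open>Depths of large valuation in the lower central series\<close>

text \<open>
  A depth \<open>q k\<close> with \<open>p dvd k\<close> is produced by a commutator with \<open>elem top_step\<close>, where
  \<open>top_step\<close> is \<open>1\<close> modulo \<open>q\<close>. Its smaller exponents of valuation \<open>s\<close> are removed by commutators
  with \<open>elem (step s)\<close>. The latter must not contribute at \<open>q k\<close> themselves: for this \<open>step s\<close> is a
  multiple of \<open>p\<close>, and \<open>p ^ s * step s\<close> decreases in \<open>s\<close> fast enough to make up for the
  defect \<open>n - s\<close> instead of \<open>n + 1\<close> in the bound \<open>gam_exps\<close>.
\<close>

definition base_shift :: nat where "base_shift = p * (r + 2) ^ 2"

text \<open>The raise of depth by \<open>elem (step s)\<close> in units of q^2. Successive values
  differ by r + 1, which bounds the possible defect t + 1 with t <= r. The constant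
  \<open>base_shift\<close> is a multiple of p, so that \<open>step r\<close> is one as well, and it
  dominates the terms quadratic in r.\<close>

definition shift :: "nat \<Rightarrow> nat" where "shift s = base_shift + (r - s) * (r + 1)"

definition step :: "nat \<Rightarrow> nat" where "step s = p ^ (r - s) * shift s"

text \<open>The square makes q times \<open>top_step\<close> exceed q^2 times any
  \<open>shift\<close> plus defect. The final 1 makes k - \<open>top_step\<close> prime to p
  whenever p divides k.\<close>

definition top_step :: nat where "top_step = q * (base_shift + (r + 1) ^ 2) + 1"

lemma base_shift_ge: "3 * (r + 2) ^ 2 \<le> base_shift"
  unfolding base_shift_def using p_gt_2 by (intro mult_le_mono1) simp

lemma base_shift_less: "base_shift + (r + 1) ^ 2 + r + 2 < p * base_shift"
proof -
  have "(r + 1) ^ 2 + r + 2 \<le> (r + 2) ^ 2" by (simp add: power2_eq_square)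
  moreover have "0 < (r + 2) ^ 2" by simp
  moreover have "3 * base_shift \<le> p * base_shift" using p_gt_2 by (intro mult_le_mono1) simp
  ultimately show ?thesis using base_shift_ge by linarith
qed

lemma shift_ge: "base_shift \<le> shift s"
  by (simp add: shift_def)

lemma shift_antimono: "s \<le> u \<Longrightarrow> shift u \<le> shift s"
  unfolding shift_def by (intro add_left_mono mult_le_mono1) simp

lemma shift_gap: "s < u \<Longrightarrow> u \<le> r \<Longrightarrow> shift u + (r + 1) \<le> shift s"
proof -
  assume "s < u" "u \<le> r"
  hence "(r - u + 1) * (r + 1) \<le> (r - s) * (r + 1)" by (intro mult_le_mono1) simp
  thus ?thesis unfolding shift_def by simp
qed

lemma shift_le: "shift s \<le> base_shift + r * (r + 1)"
  unfolding shift_def by (intro add_left_mono mult_le_mono1) simp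

lemma power_mult_step: "s \<le> r \<Longrightarrow> p ^ s * step s = q * shift s"
proof -
  assume "s \<le> r"
  hence "p ^ s * p ^ (r - s) = q" by (simp add: q_def flip: power_add)
  thus ?thesis unfolding step_def by (simp only: mult.assoc [symmetric])
qed

lemma step_pos: "step s > 0"
proof -
  have "base_shift > 0" unfolding base_shift_def using p_gt_2 by simp
  thus ?thesis using shift_ge[of s] p_gt_2 by (simp add: step_def)
qed

lemma p_dvd_step: "s \<le> r \<Longrightarrow> p dvd step s"
  by (cases "s = r") (auto simp: step_def shift_def base_shift_def)

lemma step_ge: "base_shift \<le> step s"
proof -
  have "1 * base_shift \<le> p ^ (r - s) * shift s"
    using shift_ge[of s] p_power_pos[of "r - s"] by (intro mult_le_mono) (simp_all add: Suc_le_eq)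
  thus ?thesis by (simp add: step_def)
qed

lemma step_le: "step s \<le> q * (base_shift + r * (r + 1))"
  unfolding step_def q_def by (intro mult_le_mono power_p_mono shift_le) simp

lemma top_step_pos: "top_step > 0"
  by (simp add: top_step_def)

lemma power_p_le_q: "u \<le> r \<Longrightarrow> p ^ u \<le> q"
  unfolding q_def by (rule power_p_mono)

lemma p_power_Suc_le: "a < b \<Longrightarrow> 3 * p ^ a \<le> p ^ b"
proof -
  assume "a < b"
  have "3 * p ^ a \<le> p * p ^ a" using p_gt_2 by (intro mult_le_mono1) simp
  also have "\<dots> \<le> p ^ b" using power_p_mono[of "Suc a" b] \<open>a < b\<close> by simp
  finally show ?thesis .
qed

section \<open>The target exponent q k and the exponents that may be removed\<close>

context
  fixes n k \<delta> :: nat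
  assumes n_ge: "top_step + 3 * r + 2 \<le> n" and delta_less: "\<delta> < q"
    and k_eq: "k = q * (n + 1) + top_step + \<delta>" and p_dvd_k: "p dvd k"
begin

text \<open>Chosen with \<open>top_step\<close> + \<delta> <= q C, so that q k <= q^2 (n + 1 + C)
  and q k can be compared with multiples of q^2.\<close>

definition C where "C = base_shift + (r + 1) ^ 2 + 1"

text \<open>The least depth p^s q (n + 1) guaranteed in \<open>gam n\<close> for valuation s, plus
  the raise p^s q \<open>step s\<close> = q^2 \<open>shift s\<close>.\<close>

definition thr :: "nat \<Rightarrow> nat" where "thr s = p ^ s * q * (n + 1) + q * q * shift s"

text \<open>Exponents above q k are harmless, as moves never decrease; q k itself is kept out by its
  valuation, which exceeds r.\<close>

definition low_exps :: "nat set" where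
  "low_exps = {f. q * k < f \<or> val f \<le> r \<and> thr (val f) \<le> f}"

lemma n_large: "3 * C + 3 * r \<le> n" "q * (base_shift + r * (r + 1)) \<le> n"
proof -
  have "3 * (base_shift + (r + 1) ^ 2) \<le> q * (base_shift + (r + 1) ^ 2)"
    using q_gt_2 by (intro mult_le_mono1) simp
  thus "3 * C + 3 * r \<le> n" using n_ge by (simp add: top_step_def C_def)
  have "q * (base_shift + r * (r + 1)) \<le> q * (base_shift + (r + 1) ^ 2)"
    by (intro mult_le_mono2 add_left_mono) (simp add: power2_eq_square)
  thus "q * (base_shift + r * (r + 1)) \<le> n" using n_ge unfolding top_step_def by linarith
qed

lemma C_less: "C + r + 1 < p * base_shift"
  using base_shift_less by (simp add: C_def)

lemma top_step_delta_le: "top_step + \<delta> \<le> q * C"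
proof -
  have "q * C = q * (base_shift + (r + 1) ^ 2) + q" by (simp only: C_def distrib_left mult_1_right)
  thus ?thesis using delta_less unfolding top_step_def by linarith
qed

lemma qk_le: "q * k \<le> q * q * (n + 1 + C)"
proof -
  have "q * (n + 1) + q * C = q * (n + 1 + C)" by (simp only: distrib_left)
  hence "k \<le> q * (n + 1 + C)" using top_step_delta_le k_eq by linarith
  hence "q * k \<le> q * (q * (n + 1 + C))" by (rule mult_le_mono2)
  thus ?thesis by (simp only: mult.assoc)
qed

lemma qk_less: "n + 1 + C < x \<Longrightarrow> q * k < q * q * x"
  using qk_le q_gt_2 mult_strict_left_mono[of "n + 1 + C" x "q * q"]
  by (meson le_less_trans less_trans nat_0_less_mult_iff zero_less_numeral)

text \<open>Since n is large, q k < 3 q^2 (n - t), whereas p^(r + 1) >= 3 q.\<close>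

lemma qk_less_power:
  assumes "t \<le> r" "p ^ b * q * (n - t) \<le> q * k"
  shows "b \<le> r"
proof (rule ccontr)
  assume "\<not> b \<le> r"
  hence "p ^ Suc r \<le> p ^ b" by (intro power_p_mono) simp
  hence "p * q \<le> p ^ b" by (simp add: q_def)
  moreover have "3 * q \<le> p * q" using p_gt_2 by (intro mult_le_mono1) simp
  ultimately have "3 * q * q * (n - t) \<le> p ^ b * q * (n - t)" by (intro mult_le_mono1) linarith
  moreover have "n + 1 + C < 3 * (n - t)" using n_large(1) assms(1) by (simp add: C_def)
  hence "q * k < q * q * (3 * (n - t))" by (rule qk_less)
  moreover have "q * q * (3 * (n - t)) = 3 * q * q * (n - t)" by simp
  ultimately show False using assms(2) by linarith
qed

lemma qk_less_shift: "n - r + p * base_shift \<le> x \<Longrightarrow> q * k < q * q * x"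
  using C_less n_large(1) by (intro qk_less) simp

lemma thr_le_of_pow:
  assumes "u < b"
  shows "thr u \<le> p ^ b * q * (n + 1)"
proof -
  have "q * shift u \<le> n"
    using mult_le_mono2[OF shift_le[of u], of q] n_large(2) by linarith
  hence "q * (q * shift u) \<le> q * (n + 1)" by (intro mult_le_mono2) simp
  also have "\<dots> \<le> p ^ u * (q * (n + 1))" by (rule p_power_mult_ge)
  finally have "q * q * shift u \<le> p ^ u * q * (n + 1)" by (simp only: mult.assoc)
  moreover have "3 * p ^ u * (q * (n + 1)) \<le> p ^ b * (q * (n + 1))"
    by (intro mult_le_mono1 p_power_Suc_le assms)
  hence "3 * (p ^ u * q * (n + 1)) \<le> p ^ b * q * (n + 1)" by (simp only: mult.assoc)
  ultimately show ?thesis unfolding thr_def by linarith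
qed

text \<open>Results up to q k have a + s <= r. If a > 0 and a + s = r, the valuation could jump, but
  p^a \<open>shift s\<close> >= p \<open>base_shift\<close> pushes the result beyond q k. In all
  other cases the new valuation is exactly a + s.\<close>

lemma admissible_low_exps: "admissible low_exps"
  unfolding admissible_def
proof (intro ballI impI allI)
  fix e a j assume e: "e \<in> low_exps" "e > 0" "p ^ val e dvd j"
  define f where "f = p ^ a * e + q * j"
  show "p ^ a * e + q * j \<in> low_exps"
  proof (cases "q * k < f")
    case True
    thus ?thesis by (simp add: low_exps_def f_def)
  next
    case False
    define s where "s = val e"
    have ef: "e \<le> p ^ a * e" by (rule p_power_mult_ge)
    hence "e \<le> q * k" using False unfolding f_def by linarith
    hence s: "s \<le> r" "thr s \<le> e" using e by (auto simp: low_exps_def s_def)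
    have "p ^ a * thr s \<le> p ^ a * e" using s by (intro mult_le_mono2)
    moreover have "p ^ a * thr s = p ^ (a + s) * q * (n + 1) + q * q * (p ^ a * shift s)"
      by (simp add: thr_def power_add algebra_simps)
    ultimately have le: "p ^ (a + s) * q * (n + 1) + q * q * (p ^ a * shift s) \<le> f"
      unfolding f_def by linarith
    have "p ^ (a + s) * q * (n - 0) \<le> p ^ (a + s) * q * (n + 1)" by (intro mult_le_mono2) simp
    hence "a + s \<le> r" using qk_less_power[of 0 "a + s"] le False by linarith
    show ?thesis
    proof (cases "a = 0")
      case True
      hence "val f = s" "e \<le> f" using val_add[OF e(2) q_mult_dvd(2)[OF e(3)]] by (simp_all add: f_def s_def)
      thus ?thesis using s by (simp add: low_exps_def flip: f_def)
    next
      case a: False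
      show ?thesis
      proof (cases "a + s = r")
        case True
        have "p * base_shift \<le> p ^ a * shift s"
          using power_p_mono[of 1 a] a shift_ge[of s] by (intro mult_le_mono) auto
        hence "q * k < q * q * (n + 1 + p ^ a * shift s)" by (intro qk_less_shift) simp
        also have "\<dots> \<le> f" using le unfolding True by (simp add: q_def distrib_left)
        finally show ?thesis using False by simp
      next
        case neq: False
        have "p ^ (r + s) dvd q * j" using e(3) q_mult_dvd(1) unfolding s_def by blast
        moreover have "Suc (a + s) \<le> r + s" using \<open>a + s \<le> r\<close> neq by simp
        ultimately have "p ^ Suc (val (p ^ a * e)) dvd q * j"
          using val_power_mult[OF e(2), of a] unfolding s_def by (metis dvd_trans le_imp_power_dvd)
        hence vf: "val f = a + s"
          unfolding f_def using val_add[of "p ^ a * e" "q * j"] e(2) p_gt_2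
          by (simp add: val_power_mult s_def)
        have "shift (a + s) \<le> p ^ a * shift s"
          using shift_antimono[of s "a + s"] p_power_mult_ge[of "shift s" a] by linarith
        hence "q * q * shift (a + s) \<le> q * q * (p ^ a * shift s)" by (rule mult_le_mono2)
        hence "thr (a + s) \<le> f" using le unfolding thr_def by linarith
        thus ?thesis using vf \<open>a + s \<le> r\<close> by (simp add: low_exps_def flip: f_def)
      qed
    qed
  qed
qed

lemma gam_exps_ge: "e \<in> gam_exps n \<Longrightarrow> p ^ sig e * q * (n - sig e) \<le> e"
  by (simp add: gam_exps_def)

lemma power_mult_gam_exps_ge:
  assumes "e \<in> gam_exps n" "val e \<le> r"
  shows "p ^ (a + val e) * q * (n - val e) \<le> p ^ a * e"
proof -
  have "p ^ val e * q * (n - val e) \<le> e" using assms by (simp add: gam_exps_def sig_def)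
  hence "p ^ a * (p ^ val e * q * (n - val e)) \<le> p ^ a * e" by (rule mult_le_mono2)
  thus ?thesis by (simp only: power_add mult.assoc)
qed

lemma val_power_mult_add:
  assumes "e > 0" "p ^ Suc (a + val e) dvd x"
  shows "val (p ^ a * e + x) = a + val e"
  using val_add[of "p ^ a * e" x] assms p_gt_2 by (simp add: val_power_mult)

lemma deficit_le:
  assumes "t \<le> r" "u \<le> r" "t + 1 \<le> x"
  shows "p ^ u * q * (n + 1) \<le> p ^ u * q * (n - t) + q * q * x"
proof -
  have tn: "t \<le> n" using n_large(1) assms(1) by simp
  hence "p ^ u * q * (n + 1) = p ^ u * q * (n - t) + p ^ u * q * (t + 1)"
    by (simp flip: distrib_left)
  also have "p ^ u * q * (t + 1) \<le> q * q * x"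
    using assms power_p_le_q[of u] by (intro mult_le_mono) auto
  finally show ?thesis by simp
qed

section \<open>Commutators with \<open>elem (step s)\<close> have exponents in
  \<open>low_exps\<close>\<close>

lemma step_reach_low_exps:
  assumes e: "e \<in> gam_exps n" "e > 0" "p ^ s * q * (n + 1) \<le> e" and s: "s \<le> r"
    and j: "j > 0" "p ^ val e dvd j"
  shows "p ^ a * e + q * step s * j \<in> low_exps"
proof (cases "q * k < p ^ a * e + q * step s * j")
  case True
  thus ?thesis by (simp add: low_exps_def)
next
  case False
  define f where "f = p ^ a * e + q * step s * j"
  define t where "t = val e"
  have fk: "f \<le> q * k" using False by (simp add: f_def)
  have pj: "p ^ t \<le> j" using j by (simp add: dvd_imp_le t_def)
  \<comment> \<open>For t > r the added term is at least q^2 p \<open>base_shift\<close> and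
    overshoots q k.\<close>
  have tr: "t \<le> r"
  proof (rule ccontr)
    assume t: "\<not> t \<le> r"
    hence "sig e = r" by (simp add: sig_def t_def)
    hence "q * q * (n - r) \<le> e" using gam_exps_ge[OF e(1)] by (simp add: q_def)
    hence 1: "q * q * (n - r) \<le> p ^ a * e" using p_power_mult_ge[of e a] by linarith
    have "p * q \<le> p ^ t" using t power_p_mono[of "Suc r" t] by (simp add: q_def)
    hence "q * base_shift * (p * q) \<le> q * step s * j"
      using step_ge[of s] pj by (intro mult_le_mono) auto
    moreover have "q * base_shift * (p * q) = q * q * (p * base_shift)" by (simp only: mult_ac)
    ultimately have "q * q * (n - r + p * base_shift) \<le> f"
      using 1 unfolding f_def distrib_left by linarith
    moreover have "q * k < q * q * (n - r + p * base_shift)" by (rule qk_less_shift) simp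
    ultimately show False using fk by linarith
  qed
  have e1: "p ^ (a + t) * q * (n - t) \<le> p ^ a * e"
    using power_mult_gam_exps_ge[OF e(1)] tr by (simp add: t_def)
  hence "p ^ (a + t) * q * (n - t) \<le> q * k" using fk unfolding f_def by linarith
  hence atr: "a + t \<le> r" using qk_less_power tr by blast
  have dvd: "p ^ (r + (r - s) + t) dvd q * step s * j"
    unfolding q_def step_def power_add t_def using j(2) by (intro mult_dvd_mono) auto
  show ?thesis
  proof (cases "t < s")
    case True
    \<comment> \<open>For t < s the depth of U alone suffices: \<open>thr\<close> at a + t lies
      below p^(a + s) q (n + 1).\<close>
    have "p ^ a * (p ^ s * q * (n + 1)) \<le> p ^ a * e" using e(3) by (rule mult_le_mono2)
    hence e2: "p ^ (a + s) * q * (n + 1) \<le> p ^ a * e" by (simp only: power_add mult.assoc)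
    have "p ^ (a + s) * q * (n - 0) \<le> p ^ (a + s) * q * (n + 1)" by (intro mult_le_mono2) simp
    hence "a + s \<le> r" using qk_less_power[of 0 "a + s"] e2 fk unfolding f_def by linarith
    hence "p ^ Suc (a + t) dvd q * step s * j"
      using True dvd by (elim dvd_trans[rotated]) (intro le_imp_power_dvd, simp)
    hence "val f = a + t" unfolding f_def using val_power_mult_add e(2) by (simp add: t_def)
    moreover have "thr (a + t) \<le> f" using thr_le_of_pow[of "a + t" "a + s"] True e2 unfolding f_def by simp
    ultimately show ?thesis using atr by (simp add: low_exps_def flip: f_def)
  next
    case False
    have "p ^ Suc (a + t) dvd q * step s * j"
    proof (cases "a = 0 \<and> t = s")
      case True
      thus ?thesis using dvd r_pos by (elim dvd_trans[rotated]) (intro le_imp_power_dvd, simp)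
    next
      case neq: False
      have "Suc (a + t) \<le> r + (r - s) + t" using False neq atr s r_pos by (cases "t = s") auto
      thus ?thesis using dvd by (meson dvd_trans le_imp_power_dvd)
    qed
    hence vf: "val f = a + t" unfolding f_def using val_power_mult_add e(2) by (simp add: t_def)
    have qs: "q * step s * p ^ t \<le> q * step s * j" using pj by (rule mult_le_mono2)
    have "thr (a + t) \<le> f"
    proof (cases "t = s")
      case True
      have "q * step s * p ^ t = q * q * shift s"
        using power_mult_step[OF s] True by (metis mult.assoc mult.commute)
      hence 1: "q * q * shift s \<le> q * step s * j" using qs by linarith
      show ?thesis
      proof (cases "a = 0")
        case True
        thus ?thesis using 1 e(3) unfolding thr_def f_def True \<open>t = s\<close> add_0 power_0 mult_1_left
          by linarith
      next
        case a: False
        \<comment> \<open>The valuation grows, and the drop of \<open>shift\<close> pays for the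
          defect t + 1.\<close>
        have "shift (a + t) + (t + 1) \<le> shift s"
          using shift_gap[of s "a + t"] a atr tr \<open>t = s\<close> by simp
        hence "q * q * (shift (a + t) + (t + 1)) \<le> q * q * shift s" by (rule mult_le_mono2)
        moreover have "p ^ (a + t) * q * (n + 1) \<le> p ^ (a + t) * q * (n - t) + q * q * (t + 1)"
          using tr atr by (intro deficit_le) auto
        ultimately show ?thesis using 1 e1 unfolding thr_def f_def distrib_left by linarith
      qed
    next
      case neq: False
      hence st: "s < t" using False by simp
      \<comment> \<open>For t > s the added term carries a surplus factor p >= 3, which pays for the
        defect.\<close>
      have "p * q \<le> p ^ (r - s) * p ^ t"
      proof -
        have "p ^ Suc r \<le> p ^ (r - s + t)" using st s by (intro power_p_mono) simp
        thus ?thesis by (simp only: q_def power_add power_Suc)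
      qed
      hence "p * q * shift s \<le> p ^ (r - s) * p ^ t * shift s" by (rule mult_le_mono1)
      hence "q * (p * q * shift s) \<le> q * (p ^ (r - s) * p ^ t * shift s)" by (rule mult_le_mono2)
      hence "q * q * (p * shift s) \<le> q * step s * p ^ t" by (simp only: step_def mult_ac)
      moreover have "3 * shift s \<le> p * shift s" using p_gt_2 by (intro mult_le_mono1) simp
      hence "q * q * (3 * shift s) \<le> q * q * (p * shift s)" by (rule mult_le_mono2)
      moreover have "shift (a + t) + (t + 1) \<le> 3 * shift s"
      proof -
        have "(r + 2) ^ 2 = r * r + 4 * r + 4" by (simp add: power2_eq_square)
        hence "t + 1 \<le> shift s" using base_shift_ge shift_ge[of s] tr by linarith
        thus ?thesis using shift_antimono[of s "a + t"] st by linarith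
      qed
      hence "q * q * (shift (a + t) + (t + 1)) \<le> q * q * (3 * shift s)" by (rule mult_le_mono2)
      moreover have "p ^ (a + t) * q * (n + 1) \<le> p ^ (a + t) * q * (n - t) + q * q * (t + 1)"
        using tr atr by (intro deficit_le) auto
      ultimately show ?thesis using qs e1 unfolding thr_def f_def distrib_left by linarith
    qed
    thus ?thesis using vf atr by (simp add: low_exps_def flip: f_def)
  qed
qed

lemma exps_commut_step:
  assumes U: "U \<in> gam n" "depth_ge (unit_part U) (p ^ s * q * (n + 1))" and s: "s \<le> r"
  shows "exps (commut U (elem (step s))) \<subseteq> low_exps"
proof (rule exps_commut_subset[OF _ _ admissible_low_exps])
  show UT: "U \<in> carrier T" using U gam_subset by blast
  show "elem (step s) \<in> carrier T" using step_pos by simp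
  fix e assume e: "e > 0" "e \<notin> low_exps"
  show "lam (unit_part U oo elem (step s)) e \<approx>\<^sub>p lam (unit_part U) e"
  proof (rule lam_compose_elem_unreachable[OF UT step_pos])
    fix e0 assume e0: "e0 \<in> exps U"
    have "e0 \<in> gam_exps n" using e0 U(1) gam_subset_exps_in by (auto simp: exps_in_def)
    thus "\<not> reaches (step s) e0 e"
      using step_reach_low_exps[of e0 s] e0 exps_pos[OF e0] depth_geD[OF UT U(2)] s e(2)
      unfolding reaches_def by blast
  qed
  define d where "d = p ^ s * q * (n + 1)"
  have "e \<le> q * k" using e by (simp add: low_exps_def)
  also have "q * k < q * q * (2 * (n + 1))" using n_large by (intro qk_less) simp
  also have "\<dots> = 2 * q * (q * (n + 1))" by (simp only: mult_ac)
  also have "q * (n + 1) \<le> d" unfolding d_def mult.assoc by (rule p_power_mult_ge)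
  hence "2 * q * (q * (n + 1)) \<le> 2 * q * d" by (rule mult_le_mono2)
  finally have "e < 2 * q * d" .
  \<comment> \<open>Up to q k this half is linear in the coefficients of U with factor
    \<open>step s\<close>, a multiple of p, so it vanishes modulo p.\<close>
  have "int p dvd (\<Sum>i | 0 < i \<and> i < e \<and> q dvd (e - i) \<and> step s dvd i.
      int (step s) * lift (unit_part U) $ ((e - i) div q))"
    using p_dvd_step[OF s] by (intro dvd_sum dvd_mult2) simp
  hence "of_int (\<Sum>i | 0 < i \<and> i < e \<and> q dvd (e - i) \<and> step s dvd i.
      int (step s) * lift (unit_part U) $ ((e - i) div q)) \<in> pz p"
    by (simp only: of_int_pz_iff)
  from pz_diff[OF lam_elem_compose[OF UT step_pos[of s] U(2) \<open>e < 2 * q * d\<close>[unfolded d_def]] this]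
  show "lam (unit_part (elem (step s)) oo U) e \<approx>\<^sub>p lam (unit_part (elem (step s))) e"
    by simp
qed

section \<open>The commutator with \<open>elem top_step\<close>\<close>

lemma qk_eq: "q * k = q * (q * (n + 1) + \<delta>) + q * top_step"
  unfolding k_eq by (simp only: distrib_left add_ac)

lemma val_qk: "r < val (q * k)"
proof -
  have "p ^ Suc r dvd q * k" using mult_dvd_mono[OF dvd_refl p_dvd_k, of q] by (simp add: q_def mult.commute)
  moreover have "q * k > 0" using q_gt_2 by (simp add: k_eq top_step_def)
  ultimately show ?thesis using power_dvd_iff[of "q * k" "Suc r"] by simp
qed

lemma qk_notin_low_exps: "q * k \<notin> low_exps"
  using val_qk by (simp add: low_exps_def)

lemma top_step_ge: "q * (r + 2) \<le> top_step" "C + r + 1 < 3 * top_step"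
proof -
  have *: "(r + 2) ^ 2 = r * r + 4 * r + 4" "(r + 1) ^ 2 = r * r + 2 * r + 1"
    by (simp_all add: power2_eq_square)
  define S where "S = base_shift + (r + 1) ^ 2"
  have S: "r + 2 \<le> S" using base_shift_ge * unfolding S_def by linarith
  hence "q * (r + 2) \<le> q * S" by (rule mult_le_mono2)
  thus "q * (r + 2) \<le> top_step" by (simp add: top_step_def S_def)
  have "3 * S \<le> q * S" using q_gt_2 by (intro mult_le_mono1) simp
  moreover have "C = S + 1" "top_step = q * S + 1" by (simp_all add: C_def top_step_def S_def)
  ultimately show "C + r + 1 < 3 * top_step" using S by linarith
qed

lemma top_step_reach:
  assumes e: "e \<in> gam_exps n" "e > 0" "q * (n + 1) + \<delta> \<le> e"
    and j: "j > 0" "p ^ val e dvd j" and le: "p ^ a * e + q * top_step * j \<le> q * k"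
  shows "p ^ a * e + q * top_step * j \<in> low_exps \<or>
    p ^ a * e + q * top_step * j = q * k \<and> p ^ a * e = q * (q * (n + 1) + \<delta>) \<and> j = 1"
proof -
  define f where "f = p ^ a * e + q * top_step * j"
  define t where "t = val e"
  have fk: "f \<le> q * k" using le by (simp add: f_def)
  have pj: "p ^ t \<le> j" using j by (simp add: dvd_imp_le t_def)
  have qj: "q * top_step * p ^ t \<le> q * top_step * j" using pj by (rule mult_le_mono2)
  have tr: "t \<le> r"
  proof (rule ccontr)
    assume t: "\<not> t \<le> r"
    hence "sig e = r" by (simp add: sig_def t_def)
    hence "q * q * (n - r) \<le> e" using gam_exps_ge[OF e(1)] by (simp add: q_def)
    hence 1: "q * q * (n - r) \<le> p ^ a * e" using p_power_mult_ge[of e a] by linarith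
    have "p * q \<le> p ^ t" using t power_p_mono[of "Suc r" t] by (simp add: q_def)
    moreover have "3 * q \<le> p * q" using p_gt_2 by (intro mult_le_mono1) simp
    ultimately have "q * top_step * (3 * q) \<le> q * top_step * p ^ t" by (intro mult_le_mono2) linarith
    moreover have "q * top_step * (3 * q) = q * q * (3 * top_step)" by (simp only: mult_ac)
    ultimately have "q * q * (n - r + 3 * top_step) \<le> f"
      using 1 qj unfolding f_def distrib_left by linarith
    moreover have "q * k < q * q * (n - r + 3 * top_step)"
      using top_step_ge(2) n_large(1) by (intro qk_less) simp
    ultimately show False using fk by linarith
  qed
  have e1: "p ^ (a + t) * q * (n - t) \<le> p ^ a * e"
    using power_mult_gam_exps_ge[OF e(1)] tr by (simp add: t_def)
  hence "p ^ (a + t) * q * (n - t) \<le> q * k" using fk unfolding f_def by linarith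
  hence atr: "a + t \<le> r" using qk_less_power tr by blast
  show ?thesis
  proof (cases "a + t = r")
    case True
    \<comment> \<open>For t > 0 the added term is at least 3 q \<open>top_step\<close>, more than
      the room left by the defect t + 1 and by \<delta>.\<close>
    have "t = 0"
    proof (rule ccontr)
      assume t: "t \<noteq> 0"
      have "3 \<le> p ^ t" using p_power_Suc_le[of 0 t] t by simp
      hence 1: "q * top_step * 3 \<le> q * top_step * p ^ t" by (rule mult_le_mono2)
      have "q * q * (n + 1) \<le> q * q * (n - t) + q * q * (t + 1)"
        using deficit_le[OF tr, of r "t + 1"] by (simp add: q_def)
      moreover have "q * q * (t + 1) \<le> q * q * (r + 1)" using tr by (intro mult_le_mono2) simp
      moreover have "q * (q * (r + 2)) \<le> q * top_step" by (intro mult_le_mono2 top_step_ge)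
      hence "q * q * (r + 1) + q * q \<le> q * top_step" by (simp add: algebra_simps)
      moreover have "q * \<delta> < q * q" using delta_less by simp
      moreover have "q * k = q * q * (n + 1) + q * \<delta> + q * top_step"
        unfolding qk_eq by (simp add: algebra_simps)
      moreover have "q * q * (n - t) \<le> p ^ a * e" using e1 unfolding True by (simp add: q_def)
      moreover have "0 < q * top_step" using q_gt_2 top_step_pos by simp
      ultimately show False using 1 qj fk unfolding f_def by linarith
    qed
    hence a: "p ^ a = q" using True by (simp add: q_def)
    \<comment> \<open>Now p^a = q, and both summands are at least their minimal values, whose sum is
      q k; hence equality holds in both.\<close>
    have 1: "q * (q * (n + 1) + \<delta>) \<le> q * e" using e(3) by (rule mult_le_mono2)
    have "q * top_step * 1 \<le> q * top_step * j" using j(1) by (intro mult_le_mono2) simp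
    hence 2: "q * e = q * (q * (n + 1) + \<delta>)" "q * top_step * j = q * top_step * 1"
      using 1 fk unfolding f_def a qk_eq by linarith+
    have "j = 1" using 2(2) q_gt_2 top_step_pos by (metis mult_is_0 mult_cancel1 neq0_conv not_less_zero)
    thus ?thesis using 2(1) unfolding a qk_eq by simp
  next
    case False
    have "p ^ (r + t) dvd q * (top_step * j)" using j(2) by (intro q_mult_dvd) (simp add: t_def dvd_mult)
    moreover have "Suc (a + t) \<le> r + t" using False atr by simp
    ultimately have "p ^ Suc (a + t) dvd q * top_step * j"
      unfolding mult.assoc by (meson dvd_trans le_imp_power_dvd)
    hence vf: "val f = a + t" unfolding f_def using val_power_mult_add e(2) by (simp add: t_def)
    have "(r - (a + t)) * (r + 1) + (t + 1) \<le> (r + 1) ^ 2"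
    proof -
      have "(r - (a + t)) * (r + 1) \<le> r * (r + 1)" by (intro mult_le_mono1) simp
      moreover have "(r + 1) ^ 2 = r * (r + 1) + (r + 1)" by (simp add: power2_eq_square)
      ultimately show ?thesis using tr by linarith
    qed
    hence "shift (a + t) + (t + 1) \<le> base_shift + (r + 1) ^ 2" by (simp add: shift_def)
    hence "q * q * (shift (a + t) + (t + 1)) \<le> q * q * (base_shift + (r + 1) ^ 2)" by (rule mult_le_mono2)
    also have "\<dots> \<le> q * top_step" unfolding top_step_def by (simp add: algebra_simps)
    also have "\<dots> \<le> q * top_step * p ^ t" using p_power_mult_ge[of "q * top_step" t] by (simp only: mult.commute)
    finally have "q * q * (shift (a + t) + (t + 1)) \<le> q * top_step * j" using qj by linarith
    moreover have "p ^ (a + t) * q * (n + 1) \<le> p ^ (a + t) * q * (n - t) + q * q * (t + 1)"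
      using tr atr by (intro deficit_le) auto
    ultimately have "thr (a + t) \<le> f" using e1 unfolding thr_def f_def distrib_left by linarith
    thus ?thesis using vf atr by (simp add: low_exps_def flip: f_def)
  qed
qed

lemma top_step_multiple_low_exps:
  assumes i: "0 < i" "top_step dvd i" and j: "q * (n + 1) + \<delta> \<le> j" and e: "e = i + q * j" "e \<le> q * k"
  shows "e \<in> low_exps \<or> e = q * k \<and> i = q * top_step \<and> j = q * (n + 1) + \<delta>"
proof -
  obtain c where c: "i = top_step * c" using i(2) by blast
  have c0: "c > 0" using i(1) c by (cases c) auto
  have qj: "q * (q * (n + 1) + \<delta>) \<le> q * j" using j by (rule mult_le_mono2)
  have "i \<le> q * top_step" using e qj unfolding qk_eq by linarith
  hence "top_step * c \<le> top_step * q" using c by (metis mult.commute)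
  hence cq: "c \<le> q" using top_step_pos by simp
  show ?thesis
  proof (cases "c = q")
    case True
    hence "i = q * top_step" by (simp add: c mult.commute)
    moreover from this have "q * j \<le> q * (q * (n + 1) + \<delta>)" using e unfolding qk_eq by linarith
    hence "j = q * (n + 1) + \<delta>" using j q_gt_2 by simp
    ultimately show ?thesis using e qk_eq by simp
  next
    case False
    \<comment> \<open>As \<open>top_step\<close> is 1 modulo q, e is congruent to c modulo q, and 0
      < c < q puts the valuation of e below r.\<close>
    define x where "x = (base_shift + (r + 1) ^ 2) * c + j"
    have ex: "e = c + q * x" unfolding e(1) c x_def top_step_def by (simp add: algebra_simps)
    have "\<not> p ^ r dvd c" using False cq c0 by (auto simp flip: q_def dest: dvd_imp_le)
    hence vc: "val c < r" using power_dvd_iff[OF c0] by simp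
    have "p ^ Suc (val c) dvd q" unfolding q_def using vc by (intro le_imp_power_dvd) simp
    hence v: "val e = val c" unfolding ex using val_add[OF c0] by simp
    have "p ^ r * q * (n + 1) \<le> q * j" using qj by (simp add: q_def algebra_simps)
    hence "thr (val c) \<le> e" using thr_le_of_pow[OF vc] unfolding e(1) by linarith
    thus ?thesis using v vc by (simp add: low_exps_def)
  qed
qed

lemma admissible_insert_qk: "admissible (insert (q * k) low_exps)"
  unfolding admissible_def
proof (intro ballI impI allI)
  fix e a j assume e: "e \<in> insert (q * k) low_exps" "e > 0" "p ^ val e dvd j"
  show "p ^ a * e + q * j \<in> insert (q * k) low_exps"
  proof (cases "e = q * k")
    case True
    hence "q * k \<le> p ^ a * e + q * j" using p_power_mult_ge[of e a] by linarith
    thus ?thesis by (cases "p ^ a * e + q * j = q * k") (simp_all add: low_exps_def)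
  next
    case False
    thus ?thesis using e admissible_low_exps unfolding admissible_def by blast
  qed
qed

lemma qk_less_twice: "q * k < 2 * q * (q * (n + 1) + \<delta>)"
proof -
  have "q * k < q * q * (2 * (n + 1))" using n_large by (intro qk_less) simp
  also have "\<dots> = 2 * q * (q * (n + 1))" by (simp only: mult_ac)
  also have "\<dots> \<le> 2 * q * (q * (n + 1) + \<delta>)" by (intro mult_le_mono2) simp
  finally show ?thesis .
qed

context
  fixes U :: "'a fps"
  assumes U: "U \<in> gam n" "depth_at U (q * (n + 1) + \<delta>)"
begin

lemma top_elem_facts:
  "U \<in> carrier T" "depth_ge (unit_part U) (q * (n + 1) + \<delta>)"
  "\<And>e. e \<in> exps U \<Longrightarrow> e \<in> gam_exps n \<and> e > 0 \<and> q * (n + 1) + \<delta> \<le> e"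
proof -
  show UT: "U \<in> carrier T" using U gam_subset by blast
  show d: "depth_ge (unit_part U) (q * (n + 1) + \<delta>)" using U by (simp add: depth_at_def)
  show "e \<in> gam_exps n \<and> e > 0 \<and> q * (n + 1) + \<delta> \<le> e" if "e \<in> exps U" for e
    using that depth_geD[OF UT d] exps_pos U(1) gam_subset_exps_in[of n] by (auto simp: exps_in_def)
qed

lemma lift_eq_0_below: "0 < j \<Longrightarrow> j < q * (n + 1) + \<delta> \<Longrightarrow> lift (unit_part U) $ j = 0"
  using top_elem_facts(2) by (simp add: depth_ge_def lift_nth_eq_0)

lemma exps_commut_top: "exps (commut U (elem top_step)) \<subseteq> insert (q * k) low_exps"
proof (rule exps_commut_subset[OF top_elem_facts(1) _ admissible_insert_qk])
  fix e assume e: "e > 0" "e \<notin> insert (q * k) low_exps"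
  hence ek: "e \<le> q * k" by (simp add: low_exps_def)
  show "lam (unit_part U oo elem top_step) e \<approx>\<^sub>p lam (unit_part U) e"
  proof (rule lam_compose_elem_unreachable[OF top_elem_facts(1) top_step_pos])
    fix e0 assume "e0 \<in> exps U"
    thus "\<not> reaches top_step e0 e"
      using top_step_reach[of e0] top_elem_facts(3)[of e0] e(2) ek unfolding reaches_def by blast
  qed
  have e2: "e < 2 * q * (q * (n + 1) + \<delta>)" using ek qk_less_twice by linarith
  have "(\<Sum>i | 0 < i \<and> i < e \<and> q dvd (e - i) \<and> top_step dvd i.
      int top_step * lift (unit_part U) $ ((e - i) div q)) = 0"
  proof (intro sum.neutral ballI)
    fix i assume i: "i \<in> {i. 0 < i \<and> i < e \<and> q dvd (e - i) \<and> top_step dvd i}"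
    define j where "j = (e - i) div q"
    have j: "e = i + q * j" "j > 0" using sub_dvd_obtain[of i e] i by (auto simp: j_def)
    have "j < q * (n + 1) + \<delta>"
      using top_step_multiple_low_exps[of i j e] i j e(2) ek by fastforce
    thus "int top_step * lift (unit_part U) $ ((e - i) div q) = 0"
      using lift_eq_0_below j(2) by (simp flip: j_def)
  qed
  thus "lam (unit_part (elem top_step) oo U) e \<approx>\<^sub>p lam (unit_part (elem top_step)) e"
    using lam_elem_compose[OF top_elem_facts(1) top_step_pos top_elem_facts(2) e2] by simp
qed (use top_step_pos in simp)

text \<open>Every multiple of \<open>top_step\<close> other than q \<open>top_step\<close> is paired
  with a coefficient of U below its depth.\<close>

lemma lam_elem_compose_top:
  "lam (unit_part (elem top_step) oo U) (q * k) - lam (unit_part (elem top_step)) (q * k)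
    \<approx>\<^sub>p - of_int (int top_step * lift (unit_part U) $ (q * (n + 1) + \<delta>))"
proof -
  let ?S = "{i. 0 < i \<and> i < q * k \<and> q dvd (q * k - i) \<and> top_step dvd i}"
  let ?t = "\<lambda>i. int top_step * lift (unit_part U) $ ((q * k - i) div q)"
  have sub: "q * k - q * top_step = q * (q * (n + 1) + \<delta>)" unfolding qk_eq by simp
  have "sum ?t ?S = sum ?t {q * top_step}"
  proof (rule sum.mono_neutral_right)
    show "finite ?S" by simp
    have "0 < q * (q * (n + 1) + \<delta>)" using q_gt_2 by simp
    hence "q * top_step < q * k" unfolding qk_eq by linarith
    thus "{q * top_step} \<subseteq> ?S" using top_step_pos q_gt_2 sub by auto
    show "\<forall>i\<in>?S - {q * top_step}. ?t i = 0"
    proof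
      fix i assume i: "i \<in> ?S - {q * top_step}"
      define j where "j = (q * k - i) div q"
      have j: "q * k = i + q * j" "j > 0" using sub_dvd_obtain[of i "q * k"] i by (auto simp: j_def)
      have "j < q * (n + 1) + \<delta>"
        using top_step_multiple_low_exps[of i j "q * k"] i j qk_notin_low_exps by fastforce
      thus "?t i = 0" using lift_eq_0_below j(2) by (simp flip: j_def)
    qed
  qed
  also have "\<dots> = int top_step * lift (unit_part U) $ (q * (n + 1) + \<delta>)"
    using q_gt_2 unfolding sum.insert_remove[OF finite.emptyI] by (simp add: sub)
  finally show ?thesis
    using lam_elem_compose[OF top_elem_facts(1) top_step_pos top_elem_facts(2) qk_less_twice]
    by (simp add: algebra_simps)
qed

text \<open>With d the depth of U, only the index q d contributes: lam at q d times the coefficient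
  - q d of (1 - x)^(q d) at x. By Dwork's congruence q times lam at q d is the leading coefficient
  of U.\<close>

lemma lam_compose_elem_top:
  "lam (unit_part U oo elem top_step) (q * k) - lam (unit_part U) (q * k)
    \<approx>\<^sub>p - of_int (int (q * (n + 1) + \<delta>) * lift (unit_part U) $ (q * (n + 1) + \<delta>))"
proof -
  define D where "D = q * k"
  define d where "d = q * (n + 1) + \<delta>"
  define F P where "F = lift (unit_part U)" and "P = (1 - fps_X) oo (fps_X ^ top_step :: int fps)"
  note UT = top_elem_facts(1)
  have F0: "F $ 0 = 1" and P0: "P $ 0 = 1" using UT top_step_pos by (simp_all add: F_def P_def lift_0)
  have P: "P = 1 - fps_X ^ top_step" using top_step_pos by (simp add: P_def fps_compose_sub_distrib)
  have D: "D = q * d + q * top_step" by (simp only: D_def d_def qk_eq)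
  have d0: "d > 0" using q_gt_2 by (simp add: d_def)
  let ?t = "\<lambda>i. plog F $ i * of_int ((P ^ i) $ ((D - i) div q))"
  let ?S = "{i. i < D \<and> q dvd (D - i)}"
  have "lam (unit_part U oo elem top_step) D \<approx>\<^sub>p plog F $ D + (\<Sum>i\<in>?S. ?t i)"
    using lam_compose_subst_series[OF F0 P0] by (simp add: F_def P elem_def fps_red_diff fps_red_power)
  hence 1: "lam (unit_part U oo elem top_step) D \<approx>\<^sub>p lam (unit_part U) D + (\<Sum>i\<in>?S. ?t i)"
    by (simp add: F_def lam_def)
  have Dd: "D - q * d = q * top_step" by (simp add: D)
  have "0 < q * top_step" using q_gt_2 top_step_pos by simp
  hence dS: "q * d \<in> ?S" unfolding mem_Collect_eq Dd using D by simp
  have 2: "(\<Sum>i\<in>?S. ?t i) = ?t (q * d) + (\<Sum>i\<in>?S - {q * d}. ?t i)" using dS by (intro sum.remove) auto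
  have 3: "(\<Sum>i\<in>?S - {q * d}. ?t i) \<in> pz p"
  proof (intro pz_sum, rule ccontr)
    fix i assume i: "i \<in> ?S - {q * d}" and nz: "?t i \<notin> pz p"
    note j = sub_dvd_obtain[of i D]
    have "lam (unit_part U) i * of_int ((((1 - fps_X) oo fps_X ^ top_step) ^ i) $ ((D - i) div q)) \<notin> pz p"
      using nz by (simp add: F_def P_def lam_def)
    then obtain a e0 l where e0: "i = p ^ a * e0" "e0 > 0" "lam (unit_part U) e0 \<notin> pz p" "l > 0"
        "(D - i) div q = top_step * l" "p ^ val e0 dvd l"
      using lam_mult_compose_power_nth_support[OF unit_part_0[OF UT] top_step_pos] i j(2)
      by (metis (no_types, lifting) DiffD1 mem_Collect_eq)
    have "D = i + q * (top_step * l)" using j(1) i unfolding e0(5) [symmetric] by blast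
    hence De: "q * k = p ^ a * e0 + q * top_step * l" by (simp add: e0(1) D_def mult.assoc)
    have "p ^ a * e0 = q * d"
      using top_step_reach[of e0 l a] top_elem_facts(3)[of e0] e0 De qk_notin_low_exps
      by (simp add: exps_def d_def)
    thus False using i e0(1) by simp
  qed
  have "(P ^ (q * d)) $ top_step = - int (q * d)"
    unfolding P_def compose_X_power_power_nth[OF top_step_pos]
    using top_step_pos by (simp add: one_minus_X_power_nth)
  hence 4: "?t (q * d) = - (of_nat d * (of_nat q * lam (unit_part U) (q * d)))"
    unfolding Dd using q_gt_2 by (simp add: F_def lam_def)
  have "of_nat q * lam (unit_part U) (q * d) \<approx>\<^sub>p lam (unit_part U) d"
    using lam_dwork_iter[OF unit_part_0[OF UT], of r d] by (simp add: q_def)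
  moreover have "lam (unit_part U) d = of_int (F $ d)"
    using lam_of_depth_ge[of "unit_part U" d d] UT top_elem_facts(2)[folded d_def] d0
    by (simp add: F_def)
  ultimately have "of_nat d * (of_nat q * lam (unit_part U) (q * d) - of_int (F $ d)) \<in> pz p"
    by (intro pz_mult_int) simp
  hence 5: "of_nat d * (of_nat q * lam (unit_part U) (q * d)) \<approx>\<^sub>p of_int (int d * F $ d)"
    by (simp add: right_diff_distrib)
  have "lam (unit_part U oo elem top_step) D - lam (unit_part U) D - - of_int (int d * F $ d) =
      lam (unit_part U oo elem top_step) D - (lam (unit_part U) D + (\<Sum>i\<in>?S. ?t i)) +
      (\<Sum>i\<in>?S - {q * d}. ?t i) -
      (of_nat d * (of_nat q * lam (unit_part U) (q * d)) - of_int (int d * F $ d))"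
    unfolding 2 4 by simp
  also have "\<dots> \<in> pz p" by (rule pz_diff[OF pz_add[OF 1 3] 5])
  finally show ?thesis unfolding D_def d_def F_def .
qed

lemma qk_mem_exps_commut_top: "q * k \<in> exps (commut U (elem top_step))"
proof -
  define D where "D = q * k"
  define d where "d = q * (n + 1) + \<delta>"
  define u where "u = lift (unit_part U) $ d"
  have "lam (unit_part (commut U (elem top_step))) D \<approx>\<^sub>p
    (lam (unit_part U oo elem top_step) D - lam (unit_part U) D) -
    (lam (unit_part (elem top_step) oo U) D - lam (unit_part (elem top_step)) D)"
  proof (rule lam_commut[OF top_elem_facts(1)])
    fix e0 assume e0: "e0 \<in> exps (commut U (elem top_step))"
    hence pos: "e0 > 0" by (rule exps_pos)
    show "\<not> reaches 1 e0 D"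
    proof
      assume R: "reaches 1 e0 D"
      hence "e0 \<noteq> D" using reaches_gt[OF pos _ R] by simp
      hence "D \<in> low_exps" using admissibleD[OF admissible_low_exps _ pos R] e0 exps_commut_top
        by (auto simp: D_def)
      thus False using qk_notin_low_exps by (simp add: D_def)
    qed
  qed (use top_step_pos in simp)
  from pz_add[OF this pz_diff[OF lam_compose_elem_top lam_elem_compose_top]]
  have *: "lam (unit_part (commut U (elem top_step))) D \<approx>\<^sub>p of_int ((int top_step - int d) * u)"
    unfolding D_def d_def u_def by (simp add: algebra_simps)
  have "\<not> int p dvd u" using U(2) by (simp add: depth_at_def u_def d_def lift_nth_dvd_iff)
  moreover have "\<not> int p dvd int top_step - int d"
  proof
    assume dv: "int p dvd int top_step - int d"
    have "int k = int top_step + int d" by (simp add: k_eq d_def)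
    moreover have "int p dvd int k" using p_dvd_k by simp
    ultimately have "int p dvd int top_step + int d" by simp
    with dv have "int p dvd (int top_step - int d) + (int top_step + int d)" by (rule dvd_add)
    also have "(int top_step - int d) + (int top_step + int d) = 2 * int top_step" by simp
    finally have "int p dvd 2 * int top_step" .
    moreover have "\<not> int p dvd 2" using p_gt_2 zdvd_imp_le[of "int p" 2] by auto
    ultimately have "int p dvd int top_step" using prime_int_p by (simp only: prime_dvd_mult_iff simp_thms)
    hence "p dvd q * (base_shift + (r + 1) ^ 2) + 1" by (simp only: top_step_def int_dvd_int_iff)
    moreover have "p dvd q * (base_shift + (r + 1) ^ 2)" using p_dvd_q by simp
    ultimately have "p dvd 1" using dvd_add_right_iff by blast
    thus False using p_gt_2 by simp
  qed
  ultimately have "of_int ((int top_step - int d) * u) \<notin> pz p"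
    using prime_int_p by (simp only: of_int_pz_iff prime_dvd_mult_iff simp_thms)
  thus ?thesis using * cong_pz_mem by (auto simp: exps_def D_def)
qed

end

lemma ex_depth_multiple_p: "\<exists>Z\<in>gam (Suc n). depth_at Z (q * k)"
proof -
  \<comment> \<open>One subgroup expresses both demands on the removing elements. Commutators with
    \<open>elem (step s)\<close> are known to lie in it only for factors of depth at least p^s q (n
    + 1), which is the value taken for \<open>d0\<close> below.\<close>
  define H where "H = gam (Suc n) \<inter> exps_in low_exps"
  have H: "subgroup H T"
    unfolding H_def by (intro T.subgroups_Inter_pair subgroup_gam subgroup_exps_in admissible_low_exps)
  have X: "\<exists>X\<in>gam (Suc n). depth_at X f \<and> exps X \<subseteq> low_exps"
    if f: "f \<in> low_exps" "0 < f" "f < q * k" for f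
  proof -
    define s where "s = val f"
    have s: "s \<le> r" "thr s \<le> f" using f by (auto simp: low_exps_def s_def)
    define x where "x = p ^ s * q * step s"
    have x: "x = q * q * shift s" using power_mult_step[OF s(1)] by (metis x_def mult.assoc mult.commute)
    define d where "d = f - x"
    have fd: "f = d + x" "p ^ s * q * (n + 1) \<le> d" using s(2) by (simp_all add: thr_def x d_def)
    have "0 < p ^ s * q * (n + 1)" using p_gt_2 q_gt_2 by simp
    hence d0: "d > 0" using fd(2) by linarith
    have "p ^ Suc s dvd x" using q_mult_dvd(2)[of s "p ^ s * step s"] by (simp add: x_def mult_ac)
    hence vd: "val d = s" using val_add_eq_less[of d "Suc s" x] fd d0 by (simp add: s_def)
    have "step s \<le> n" using step_le n_large(2) by (rule le_trans)
    hence "step s < 2 * (n + 1)" by simp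
    hence "\<exists>X\<in>H. depth_at X (d + p ^ val d * q * step s) \<and> exps X \<subseteq> depth_layer d (step s)"
    proof (rule ex_commut_elem_depth[where N = "gam n" and n = n and ?d0.0 = "p ^ s * q * (n + 1)", OF H gam_subset step_pos])
      fix V assume V: "V \<in> gam n" "depth_ge (unit_part V) (p ^ s * q * (n + 1))"
      have "elem (step s) \<in> carrier T" using step_pos by simp
      moreover have "V \<in> carrier T" using V gam_subset by blast
      ultimately show "commut V (elem (step s)) \<in> H"
        using commut_in_gam[OF V(1)] exps_commut_step[OF V s(1)] by (simp add: H_def exps_in_def del: lower_central.simps)
    next
      fix e assume "val e \<le> r" "p ^ val e * q * (n + 1) \<le> e"
      thus "\<exists>U\<in>gam n. depth_at U e" by (rule ex_depth_in_gam)
    qed (use vd s fd in simp_all)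
    thus ?thesis unfolding vd x_def [symmetric] fd(1) [symmetric] by (auto simp: H_def exps_in_def)
  qed
  define d where "d = q * (n + 1) + \<delta>"
  have kd: "k = d + top_step" by (simp add: k_eq d_def)
  have "\<not> p dvd d"
  proof
    assume "p dvd d"
    hence "p dvd q * (base_shift + (r + 1) ^ 2) + 1"
      using p_dvd_k unfolding kd top_step_def by (simp only: dvd_add_right_iff)
    moreover have "p dvd q * (base_shift + (r + 1) ^ 2)" using p_dvd_q by simp
    ultimately have "p dvd 1" using dvd_add_right_iff by blast
    thus False using p_gt_2 by simp
  qed
  hence "val d = 0" by (simp add: not_dvd_imp_multiplicity_0)
  moreover from this have "p ^ val d * q * (n + 1) \<le> d" by (simp add: d_def)
  ultimately obtain U where U: "U \<in> gam n" "depth_at U (q * (n + 1) + \<delta>)"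
    using ex_depth_in_gam[of d n] unfolding d_def by auto
  have "\<exists>Z\<in>gam (Suc n). depth_at Z (q * k) \<and> exps Z \<subseteq> insert (q * k) low_exps"
  proof (rule eliminate_lower_exps[OF subgroup_gam admissible_low_exps admissible_insert_qk qk_notin_low_exps])
    show "commut U (elem top_step) \<in> gam (Suc n)" using U(1) top_step_pos by (intro commut_in_gam) simp_all
  qed (use exps_commut_top[OF U] qk_mem_exps_commut_top[OF U] X in blast)+
  thus ?thesis by blast
qed

end

section \<open>Counting cosets by depth\<close>

lemma depth_ge_Suc_iff:
  assumes "f \<in> carrier T" "depth_ge (unit_part f) i"
  shows "depth_ge (unit_part f) (Suc i) \<longleftrightarrow> \<not> depth_at f i"
  using assms by (cases "i = 0") (auto simp: depth_ge_def depth_at_def less_Suc_eq)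

lemma power_in_subgroup:
  assumes "subgroup S T" "x \<in> S"
  shows "x [^]\<^bsub>T\<^esub> (n::nat) \<in> S"
  using assms by (induction n) (auto simp: subgroup.one_closed subgroup.m_closed simp del: T_mult T_one)

lemma agree_X_if_depth_ge:
  assumes "f \<in> carrier T" "depth_ge (unit_part f) j"
  shows "fps_agree (q * j) f fps_X"
  unfolding fps_agree_def
proof (intro allI impI)
  fix n assume n: "n \<le> q * j"
  have fn: "f $ n = (if n > 0 \<and> q dvd (n - 1) then unit_part f $ ((n - 1) div q) else 0)"
    using subst_series_unit_part[OF assms(1)] subst_series_nth[of "unit_part f" n] by simp
  show "f $ n = fps_X $ n"
  proof (cases "n > 0 \<and> q dvd (n - 1)")
    case True
    then obtain i where "n - 1 = q * i" by blast
    hence i: "n = q * i + 1" using True by simp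
    have "q * i < q * j" using n i by linarith
    hence "i < j" by simp
    moreover have "f $ n = unit_part f $ i" using fn True i q_gt_2 by simp
    ultimately show ?thesis using assms q_gt_2 i by (cases "i = 0") (auto simp: depth_ge_def)
  next
    case False
    hence "n \<noteq> 1" by auto
    thus ?thesis using False unfolding fn by (simp only: if_False fps_X_nth)
  qed
qed

lemma rcos_eq_rcos_mult:
  assumes "subgroup B T" "b \<in> B" "a \<in> carrier T"
  shows "B #>\<^bsub>T\<^esub> (b oo a) = B #>\<^bsub>T\<^esub> a"
proof -
  have "b \<in> carrier T" using assms subgroup.subset by blast
  thus ?thesis
    using T.coset_mult_assoc[of B b a] T.coset_join2[of b B] assms subgroup.subset by auto
qed

text \<open>Successive cancellation of depths approximates \<open>a\<close> by elements of the closed subgroup.\<close>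

lemma mem_gam_Suc_if_deep:
  assumes deep: "\<And>d f. d \<ge> M \<Longrightarrow> f \<in> gam n \<Longrightarrow> depth_at f d \<Longrightarrow> \<exists>b\<in>gam (Suc n). depth_at b d"
    and a: "a \<in> gam n" "depth_ge (unit_part a) M"
  shows "a \<in> gam (Suc n)"
proof -
  note B = subgroup_gam[of "Suc n"] and A = subgroup_gam[of n]
  have aT: "a \<in> carrier T" using a gam_subset by blast
  have *: "\<exists>b\<in>gam (Suc n). depth_ge (unit_part (b oo a)) j" for j
  proof (induction j)
    case 0
    show ?case using subgroup.one_closed[OF B] by (auto simp: depth_ge_def)
  next
    case (Suc j)
    then obtain b where b: "b \<in> gam (Suc n)" "depth_ge (unit_part (b oo a)) j" by blast
    have bA: "b oo a \<in> gam n"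
      using b(1) a(1) gam_Suc_subset[of n] subgroup.m_closed[OF A, of b a] by (metis T_mult subsetD)
    hence baT: "b oo a \<in> carrier T" using gam_subset by blast
    show ?case
    proof (cases "depth_at (b oo a) j")
      case False
      thus ?thesis using b depth_ge_Suc_iff[OF baT b(2)] by blast
    next
      case True
      show ?thesis
      proof (cases "j < M")
        case True
        have "fps_X oo a = a" using aT by simp
        moreover have "depth_ge (unit_part a) (Suc j)" using a(2) True by (simp add: depth_ge_def)
        ultimately show ?thesis using subgroup.one_closed[OF B] by (metis T_one)
      next
        case False
        then obtain c where c: "c \<in> gam (Suc n)" "depth_at c j" using deep[OF _ bA True] by auto
        have cT: "c \<in> carrier T" using c gam_subset by blast
        obtain m where m: "depth_ge (unit_part ((c [^]\<^bsub>T\<^esub> (m::nat)) oo (b oo a))) (Suc j)"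
          using cancel_depth[OF baT b(2) c(2) cT] by blast
        have cm: "c [^]\<^bsub>T\<^esub> m \<in> gam (Suc n)" by (rule power_in_subgroup[OF B c(1)])
        hence cmT: "c [^]\<^bsub>T\<^esub> m \<in> carrier T" using gam_subset by blast
        have "(c [^]\<^bsub>T\<^esub> m) oo (b oo a) = (c [^]\<^bsub>T\<^esub> m oo b) oo a"
          using b(1) gam_subset[of "Suc n"] aT by (intro fps_compose_assoc) auto
        moreover have "c [^]\<^bsub>T\<^esub> m oo b \<in> gam (Suc n)"
          using subgroup.m_closed[OF B cm b(1)] by simp
        ultimately show ?thesis using m by metis
      qed
    qed
  qed
  show ?thesis
  proof (rule gam_limit[OF aT])
    fix N
    obtain b where b: "b \<in> gam (Suc n)" "depth_ge (unit_part (b oo a)) N" using * by blast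
    have bT: "b \<in> carrier T" using b gam_subset by blast
    have i: "inv\<^bsub>T\<^esub> b \<in> gam (Suc n)" "inv\<^bsub>T\<^esub> b \<in> carrier T"
      using subgroup.m_inv_closed[OF B b(1)] bT by simp_all
    have "fps_agree (q * N) (b oo a) fps_X"
      using b(2) bT aT by (intro agree_X_if_depth_ge) auto
    hence "fps_agree (q * N) (inv\<^bsub>T\<^esub> b oo (b oo a)) (inv\<^bsub>T\<^esub> b oo fps_X)"
      by (intro fps_agree_compose) auto
    also have "inv\<^bsub>T\<^esub> b oo (b oo a) = a"
      using T.m_assoc[of "inv\<^bsub>T\<^esub> b" b a] T.l_inv[OF bT] i bT aT by simp
    finally have "fps_agree (q * N) a (inv\<^bsub>T\<^esub> b)" by simp
    hence "fps_agree N a (inv\<^bsub>T\<^esub> b)" by (rule fps_agree_mono) (use q_gt_2 in simp)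
    thus "\<exists>g\<in>gam (Suc n). fps_agree N a g" using i by blast
  qed
qed

text \<open>Descends along depths from a bound M of E to 0, maintaining a set R of representatives.
  A depth absent from \<open>gam n\<close> or present in \<open>gam (Suc n)\<close> requires no new
  ones. A depth in E multiplies their number by at most p, through the powers of one element x of
  that depth.\<close>

lemma card_cosets_le:
  assumes E: "finite E"
    and cover: "\<And>f d. f \<in> gam n \<Longrightarrow> depth_at f d \<Longrightarrow> d \<notin> E \<Longrightarrow> \<exists>b\<in>gam (Suc n). depth_at b d"
  shows "finite (rcosets\<^bsub>T\<lparr>carrier := gam n\<rparr>\<^esub> gam (Suc n)) \<and>
    card (rcosets\<^bsub>T\<lparr>carrier := gam n\<rparr>\<^esub> gam (Suc n)) \<le> p ^ card E"
proof -
  define A B where "A = gam n" and "B = gam (Suc n)"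
  have A: "subgroup A T" and B: "subgroup B T" and BA: "B \<subseteq> A"
    unfolding A_def B_def by (rule subgroup_gam gam_Suc_subset)+
  have AT: "A \<subseteq> carrier T" using A by (rule subgroup.subset)
  obtain M where M: "E \<subseteq> {..<M}" using E finite_nat_bounded by blast
  have "\<exists>R. finite R \<and> card R \<le> p ^ card (E \<inter> {i..}) \<and> R \<subseteq> carrier T \<and>
      (\<forall>a\<in>A. depth_ge (unit_part a) i \<longrightarrow> (\<exists>y\<in>R. B #>\<^bsub>T\<^esub> a = B #>\<^bsub>T\<^esub> y))"
    if "i \<le> M" for i
    using that
  proof (induction i rule: inc_induct)
    case base
    have "\<exists>y\<in>{fps_X}. B #>\<^bsub>T\<^esub> a = B #>\<^bsub>T\<^esub> y" if "a \<in> A" "depth_ge (unit_part a) M" for a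
    proof -
      have "a \<in> B" unfolding B_def
      proof (rule mem_gam_Suc_if_deep[where M = M])
        fix d f assume *: "M \<le> d" "f \<in> gam n" "depth_at f d"
        hence "d \<notin> E" using M by auto
        thus "\<exists>b\<in>gam (Suc n). depth_at b d" using cover * by blast
      qed (use that A_def in blast)+
      hence "B #>\<^bsub>T\<^esub> (a oo fps_X) = B #>\<^bsub>T\<^esub> fps_X" by (rule rcos_eq_rcos_mult[OF B]) simp
      thus ?thesis by simp
    qed
    moreover have "1 \<le> p ^ card (E \<inter> {M..})" using p_power_pos by (simp add: Suc_le_eq)
    ultimately show ?case by (intro exI[of _ "{fps_X}"]) auto
  next
    case (step i)
    then obtain R where R: "finite R" "card R \<le> p ^ card (E \<inter> {Suc i..})" "R \<subseteq> carrier T"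
        "\<And>a. a \<in> A \<Longrightarrow> depth_ge (unit_part a) (Suc i) \<Longrightarrow> \<exists>y\<in>R. B #>\<^bsub>T\<^esub> a = B #>\<^bsub>T\<^esub> y"
      by metis
    have mono: "p ^ card (E \<inter> {Suc i..}) \<le> p ^ card (E \<inter> {i..})"
      using E by (intro power_p_mono card_mono) auto
    consider (none) "\<forall>a\<in>A. \<not> depth_at a i" | (low) b where "b \<in> B" "depth_at b i"
      | (new) x where "i \<in> E" "x \<in> A" "depth_at x i"
      using cover unfolding A_def B_def by blast
    thus ?case
    proof cases
      case none
      hence "\<forall>a\<in>A. depth_ge (unit_part a) i \<longrightarrow> (\<exists>y\<in>R. B #>\<^bsub>T\<^esub> a = B #>\<^bsub>T\<^esub> y)"
        using R(4) depth_ge_Suc_iff AT by blast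
      thus ?thesis by (intro exI[of _ R] conjI R(1,3) le_trans[OF R(2) mono])
    next
      case low
      have bT: "b \<in> carrier T" using low BA AT by blast
      have "\<exists>y\<in>R. B #>\<^bsub>T\<^esub> a = B #>\<^bsub>T\<^esub> y" if a: "a \<in> A" "depth_ge (unit_part a) i" for a
      proof -
        have aT: "a \<in> carrier T" using a AT by blast
        obtain m where m: "depth_ge (unit_part ((b [^]\<^bsub>T\<^esub> (m::nat)) oo a)) (Suc i)"
          using cancel_depth[OF aT a(2) low(2) bT] by blast
        have bm: "b [^]\<^bsub>T\<^esub> m \<in> B" by (rule power_in_subgroup[OF B low(1)])
        hence "(b [^]\<^bsub>T\<^esub> m) oo a \<in> A" using subgroup.m_closed[OF A, of "b [^]\<^bsub>T\<^esub> m" a] a BA by auto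
        then obtain y where "y \<in> R" "B #>\<^bsub>T\<^esub> ((b [^]\<^bsub>T\<^esub> m) oo a) = B #>\<^bsub>T\<^esub> y" using R(4) m by blast
        thus ?thesis using rcos_eq_rcos_mult[OF B bm aT] by auto
      qed
      thus ?thesis by (intro exI[of _ R] conjI R(1,3) le_trans[OF R(2) mono]) blast
    next
      case new
      have xT: "x \<in> carrier T" using new AT by blast
      \<comment> \<open>The cancelling power stands on the right, so it can be undone within right
        cosets of B.\<close>
      define z where "z m = inv\<^bsub>T\<^esub> (x [^]\<^bsub>T\<^esub> (m::nat))" for m
      define S where "S = (\<lambda>(y, m). y oo z m) ` (R \<times> {..<p})"
      have zT: "z m \<in> carrier T" for m using xT by (simp add: z_def)
      have "card S \<le> card (R \<times> {..<p})" unfolding S_def using R(1) by (intro card_image_le) simp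
      also have "\<dots> \<le> p ^ card (E \<inter> {Suc i..}) * p" using R(2) by (simp add: card_cartesian_product)
      also have "\<dots> = p ^ card (insert i (E \<inter> {Suc i..}))" using E by simp
      also have "insert i (E \<inter> {Suc i..}) = E \<inter> {i..}" using new(1) by (auto simp: Suc_le_eq le_less)
      finally have "card S \<le> p ^ card (E \<inter> {i..})" .
      moreover have "finite S" unfolding S_def using R(1) by simp
      moreover have "S \<subseteq> carrier T" unfolding S_def using R(3) zT by auto
      moreover have "\<exists>y\<in>S. B #>\<^bsub>T\<^esub> a = B #>\<^bsub>T\<^esub> y" if a: "a \<in> A" "depth_ge (unit_part a) i" for a
      proof -
        have aT: "a \<in> carrier T" using a AT by blast
        obtain m where m: "depth_ge (unit_part (a oo (x [^]\<^bsub>T\<^esub> (m::nat)))) (Suc i)" "m < p"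
          using cancel_depth[OF aT a(2) new(3) xT] by blast
        define w where "w = x [^]\<^bsub>T\<^esub> m"
        have w: "w \<in> A" "w \<in> carrier T" unfolding w_def using power_in_subgroup[OF A new(2)] AT by blast+
        hence "a oo w \<in> A" using subgroup.m_closed[OF A a(1), of w] by simp
        then obtain y where y: "y \<in> R" "B #>\<^bsub>T\<^esub> (a oo w) = B #>\<^bsub>T\<^esub> y" using R(4) m w_def by blast
        have yT: "y \<in> carrier T" using y R by blast
        have "a = (a oo w) oo z m"
          using T.m_assoc[of a w "z m"] T.r_inv[OF w(2)] zT[of m] w aT by (simp add: z_def w_def)
        hence "B #>\<^bsub>T\<^esub> a = (B #>\<^bsub>T\<^esub> (a oo w)) #>\<^bsub>T\<^esub> z m"
          using T.coset_mult_assoc[of B "a oo w" "z m"] BA AT aT w zT[of m] by auto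
        also have "\<dots> = B #>\<^bsub>T\<^esub> (y oo z m)"
          using T.coset_mult_assoc[of B y "z m"] BA AT yT zT[of m] unfolding y(2) by auto
        finally show ?thesis using y(1) m(2) by (auto simp: S_def)
      qed
      ultimately show ?thesis by blast
    qed
  qed
  from this[of 0] obtain R where R: "finite R" "card R \<le> p ^ card E"
      "\<And>a. a \<in> A \<Longrightarrow> \<exists>y\<in>R. B #>\<^bsub>T\<^esub> a = B #>\<^bsub>T\<^esub> y"
    by (auto simp: depth_ge_def)
  have "rcosets\<^bsub>T\<lparr>carrier := A\<rparr>\<^esub> B \<subseteq> (\<lambda>y. B #>\<^bsub>T\<^esub> y) ` R"
  proof
    fix K assume "K \<in> rcosets\<^bsub>T\<lparr>carrier := A\<rparr>\<^esub> B"
    then obtain a where "a \<in> A" "K = B #>\<^bsub>T\<^esub> a" by (auto simp: RCOSETS_def r_coset_def)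
    thus "K \<in> (\<lambda>y. B #>\<^bsub>T\<^esub> y) ` R" using R(3) by blast
  qed
  hence "finite (rcosets\<^bsub>T\<lparr>carrier := A\<rparr>\<^esub> B) \<and> card (rcosets\<^bsub>T\<lparr>carrier := A\<rparr>\<^esub> B) \<le> card R"
    using R(1) by (meson card_image_le card_mono finite_imageI finite_subset le_trans)
  thus ?thesis using R(2) unfolding A_def B_def by linarith
qed

text \<open>Dividing k - \<open>top_step\<close> by q with remainder \<delta> gives the required
  form with some m >= N >= n in place of n, and the lower central series decreases.\<close>

lemma ex_depth_multiple_p_large:
  assumes k: "p dvd k" "q * (N + 1) + top_step \<le> k" and N: "top_step + 3 * r + 2 \<le> N" "n \<le> N"
  shows "\<exists>Z\<in>gam (Suc n). depth_at Z (q * k)"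
proof -
  define x where "x = k - top_step"
  define m \<delta> where "m = x div q - 1" and "\<delta> = x mod q"
  have x: "q * (N + 1) \<le> x" "k = x + top_step" using k by (simp_all add: x_def)
  have "(q * (N + 1)) div q \<le> x div q" using x(1) by (rule div_le_mono)
  hence xm: "x div q = m + 1" "N \<le> m" using q_gt_2 by (simp_all add: m_def)
  have "q * (m + 1) + \<delta> = x" using mult_div_mod_eq[of q x] xm(1) by (simp only: \<delta>_def)
  hence "k = q * (m + 1) + top_step + \<delta>" using x(2) by simp
  moreover have "\<delta> < q" using q_gt_2 by (simp add: \<delta>_def)
  ultimately have "\<exists>Z\<in>gam (Suc m). depth_at Z (q * k)"
    using k(1) N xm(2) by (intro ex_depth_multiple_p) auto
  moreover have "gam (Suc m) \<subseteq> gam (Suc n)" using N(2) xm(2) by (intro gam_mono) simp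
  ultimately show ?thesis by blast
qed

text \<open>For valuation s <= r, depths are at least p^s q (n - s) by \<open>gam_exps\<close> and
  occur in the next term from p^s q (n + 2) on, which leaves p^s q (s + 2) candidates at most. The
  remaining summands count the interval for valuations above r.\<close>

definition gap_bound :: nat where
  "gap_bound = (\<Sum>s\<le>r. p ^ s * q * (s + 2)) + q * q * (top_step + 3 * r + 2 + r + 1) + q * top_step"

lemma ex_gap_set:
  "\<exists>E. finite E \<and> card E \<le> gap_bound \<and>
    (\<forall>f\<in>gam n. \<forall>d. depth_at f d \<longrightarrow> d \<notin> E \<longrightarrow> (\<exists>b\<in>gam (Suc n). depth_at b d))"
proof -
  \<comment> \<open>Large valuations are constructed for large n only; for small n a later term of
    the series is used, and N - n stays bounded.\<close>
  define N where "N = max n (top_step + 3 * r + 2)"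
  define I where "I s = {p ^ s * q * (n - s)..<p ^ s * q * (n + 2)}" for s
  define J where "J = {q * q * (n - r)..<q * (q * (N + 1) + top_step)}"
  define E where "E = (\<Union>s\<le>r. I s) \<union> J"
  have "card (I s) \<le> p ^ s * q * (s + 2)" for s
  proof -
    have "card (I s) = p ^ s * q * (n + 2 - (n - s))" by (simp add: I_def diff_mult_distrib2)
    also have "\<dots> \<le> p ^ s * q * (s + 2)" by (intro mult_le_mono2) simp
    finally show ?thesis .
  qed
  hence "card (\<Union>s\<le>r. I s) \<le> (\<Sum>s\<le>r. p ^ s * q * (s + 2))"
    by (intro le_trans[OF card_UN_le] sum_mono) simp_all
  moreover have "card J \<le> q * q * (top_step + 3 * r + 2 + r + 1) + q * top_step"
  proof -
    have "q * (q * (N + 1) + top_step) = q * q * (N + 1) + q * top_step" by (simp only: distrib_left mult.assoc)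
    also have "q * q * (N + 1) \<le> q * q * ((n - r) + (top_step + 3 * r + 2 + r + 1))"
      by (intro mult_le_mono2) (simp add: N_def)
    finally have "q * (q * (N + 1) + top_step) \<le>
        q * q * (n - r) + q * q * (top_step + 3 * r + 2 + r + 1) + q * top_step"
      by (simp only: distrib_left)
    thus ?thesis by (simp add: J_def)
  qed
  ultimately have "card E \<le> gap_bound"
    using card_Un_le[of "\<Union>s\<le>r. I s" J] unfolding E_def gap_bound_def by linarith
  moreover have "finite E" by (simp add: E_def I_def J_def)
  moreover have "\<exists>b\<in>gam (Suc n). depth_at b d" if f: "f \<in> gam n" "depth_at f d" "d \<notin> E" for f d
  proof -
    have d0: "d > 0" using f by (simp add: depth_at_def)
    have "f \<in> carrier T" "exps f \<subseteq> gam_exps n" using f gam_subset_exps_in by (auto simp: exps_in_def)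
    hence dn: "p ^ sig d * q * (n - sig d) \<le> d" using f depth_at_iff by (auto simp: gam_exps_def)
    show ?thesis
    proof (cases "val d \<le> r")
      case True
      hence "d \<notin> I (val d)" using f(3) by (auto simp: E_def)
      hence "p ^ val d * q * (Suc n + 1) \<le> d" using dn True by (auto simp: I_def sig_def)
      thus ?thesis using ex_depth_in_gam True by blast
    next
      case False
      hence "p ^ Suc r dvd d" using power_dvd_iff[OF d0, of "Suc r"] by (simp del: power_Suc)
      then obtain c where c: "d = p ^ Suc r * c" by blast
      define k where "k = p * c"
      have k: "d = q * k" "p dvd k" by (simp_all add: k_def c q_def)
      have "q * q * (n - r) \<le> d" using dn False by (simp add: sig_def q_def)
      hence "q * (q * (N + 1) + top_step) \<le> q * k" using f(3) k by (auto simp: E_def J_def)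
      hence "q * (N + 1) + top_step \<le> k" using q_gt_2 by simp
      thus ?thesis unfolding k(1)
        by (rule ex_depth_multiple_p_large[OF k(2)]) (simp_all only: N_def max.cobounded1 max.cobounded2)
    qed
  qed
  ultimately show ?thesis by blast
qed

lemma finite_width_T: "finite_width T"
  unfolding finite_width_def
proof (intro exI[of _ "p ^ gap_bound"] allI impI)
  fix n :: nat assume "n \<ge> 1"
  then obtain m where m: "n = Suc m" by (cases n) auto
  obtain E where E: "finite E" "card E \<le> gap_bound"
      "\<And>f d. f \<in> gam m \<Longrightarrow> depth_at f d \<Longrightarrow> d \<notin> E \<Longrightarrow> \<exists>b\<in>gam (Suc m). depth_at b d"
    using ex_gap_set[of m] by blast
  have "finite (rcosets\<^bsub>T\<lparr>carrier := gam m\<rparr>\<^esub> gam (Suc m)) \<and>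
      card (rcosets\<^bsub>T\<lparr>carrier := gam m\<rparr>\<^esub> gam (Suc m)) \<le> p ^ card E"
    by (rule card_cosets_le[OF E(1)]) (rule E(3))
  moreover have "p ^ card E \<le> p ^ gap_bound" using E(2) by (rule power_p_mono)
  ultimately show "finite (rcosets\<^bsub>T\<lparr>carrier := lower_central T n\<rparr>\<^esub> (lower_central T (n + 1))) \<and>
    card (rcosets\<^bsub>T\<lparr>carrier := lower_central T n\<rparr>\<^esub> (lower_central T (n + 1))) \<le> p ^ gap_bound"
    unfolding m Suc_eq_plus1 [symmetric] by linarith
qed

end

theorem theorem1p1:
  fixes p r q :: nat
  assumes "prime p" and "p > 2" and "r \<ge> 1" and "q = p ^ r"
    and "CARD('a::{field, finite}) = p"
  shows "finite_width (fesenko_group q :: 'a fps monoid)"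
proof -
  interpret fesenko p r q "TYPE('a)"
    using assms by unfold_locales
  show ?thesis by (rule finite_width_T)
qed

end
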